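(* The map $\sigma:W^{\mathrm{Sch}}(\mathbb{N})\to 1+t\mathbb{Z}[[t]]$, $a\mapsto\sum_{n\ge0}a(e_n)t^n$, is a bijection from $W^{\mathrm{Sch}}(\mathbb{N})$ onto the set of integral series $f(t)\in1+t\mathbb{Z}[[t]]$ of the form $$f(t)=\frac{g(t)}{h(t)}$$ for some (necessarily unique) integral polynomials $g(t),h(t)\in1+t\mathbb{Z}[t]$ such that all the complex roots of $g(t)$ are negative real numbers and all those of $h(t)$ are positive real numbers.
   Context: $\mathbb{N}=\{0,1,2,\dots\}$. Semirings are commutative with $0$ and $1$, and homomorphisms preserve $0$ and $1$. Let $\Lambda_{\mathbb{Z}}$ be the ring of symmetric functions in $x_1,x_2,\dots$, with Schur basis $(s_\lambda)$ indexed by partitions $\lambda$. Put $\Lambda^{\mathrm{Sch}}=\bigoplus_\lambda\mathbb{N}s_\lambda$, a subsemiring of $\Lambda_{\mathbb{Z}}$, and for a semiring $A$ let $W^{\mathrm{Sch}}(A)=\mathrm{Hom}_{\mathrm{semiring}}(\Lambda^{\mathrm{Sch}},A)$. The element $e_n=\sum_{i_1<\cdots<i_n}x_{i_1}\cdots x_{i_n}\in\Lambda^{\mathrm{Sch}}$ is the $n$-th elementary symmetric function ($e_0=1$). *)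

theory Defs
  imports
    Complex_Main
    "HOL-Library.Multiset"
    "HOL-Library.FuncSet"
    "HOL-Computational_Algebra.Polynomial_FPS"
begin

section \<open>Integral power series in countably many variables\<close>

text \<open>
  A finite multiset \<open>M\<close> of natural numbers encodes the monomial
  \<open>\<Prod>i\<in>#M. x\<^sub>i\<close> (the variables are indexed from \<open>0\<close>), so that multiset sum is the
  product of monomials and \<^term>\<open>size M\<close> is the degree.  The type below is the ring
  of all formal power series with integer coefficients in these variables; it contains the
  ring of symmetric functions as a subring.
\<close>

typedef xseries = "UNIV :: (nat multiset \<Rightarrow> int) set"
  morphisms xcoeff Abs_xseries
  by simp

setup_lifting type_definition_xseries

lemma xseries_eqI: "(\<And>M. xcoeff f M = xcoeff g M) \<Longrightarrow> f = g"
  by transfer (rule ext)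

lemma finite_submultisets: "finite {N. N \<subseteq># (M :: 'a multiset)}"
proof (rule finite_subset)
  show "{N. N \<subseteq># M} \<subseteq> (\<Union>n\<le>size M. multisets_of_size (set_mset M) n)"
    by (auto simp: multisets_of_size_def dest: size_mset_mono set_mset_mono)
  show "finite (\<Union>n\<le>size M. multisets_of_size (set_mset M) n)"
    by (intro finite_UN_I finite_multisets_of_size) auto
qed

instantiation xseries :: comm_ring_1
begin

lift_definition zero_xseries :: xseries is "\<lambda>_. 0" .

lift_definition one_xseries :: xseries is "\<lambda>M. if M = {#} then 1 else 0" .

lift_definition plus_xseries :: "xseries \<Rightarrow> xseries \<Rightarrow> xseries" is "\<lambda>f g M. f M + g M" .

lift_definition uminus_xseries :: "xseries \<Rightarrow> xseries" is "\<lambda>f M. - f M" .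

lift_definition minus_xseries :: "xseries \<Rightarrow> xseries \<Rightarrow> xseries" is "\<lambda>f g M. f M - g M" .

lift_definition times_xseries :: "xseries \<Rightarrow> xseries \<Rightarrow> xseries" is
  "\<lambda>f g M. \<Sum>N | N \<subseteq># M. f N * g (M - N)" .

instance
proof
  fix a b c :: xseries
  show "a * b * c = a * (b * c)"
  proof (transfer, rule ext)
    fix a b c :: "nat multiset \<Rightarrow> int" and M
    have "(\<Sum>N | N \<subseteq># M. (\<Sum>K | K \<subseteq># N. a K * b (N - K)) * c (M - N)) =
        (\<Sum>(N, K)\<in>(SIGMA N:{N. N \<subseteq># M}. {K. K \<subseteq># N}). a K * b (N - K) * c (M - N))"
      by (simp add: sum_distrib_right sum.Sigma finite_submultisets)
    also have "\<dots> = (\<Sum>(K, L)\<in>(SIGMA K:{K. K \<subseteq># M}. {L. L \<subseteq># M - K}).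
        a K * (b L * c (M - K - L)))"
    proof (rule sum.reindex_bij_witness[where
          i = "\<lambda>(K, L). (K + L, K)" and j = "\<lambda>(N, K). (K, N - K)"])
      fix p assume p: "p \<in> (SIGMA N:{N. N \<subseteq># M}. {K. K \<subseteq># N})"
      obtain N K where [simp]: "p = (N, K)" by (cases p)
      obtain L where N: "N = K + L" using p by (auto simp: subset_mset.le_iff_add)
      obtain J where M: "M = K + L + J" using p by (auto simp: subset_mset.le_iff_add N)
      show "(case case p of (N, K) \<Rightarrow> (K, N - K) of (K, L) \<Rightarrow> (K + L, K)) = p"
        by (simp add: N)
      show "(case p of (N, K) \<Rightarrow> (K, N - K)) \<in> (SIGMA K:{K. K \<subseteq># M}. {L. L \<subseteq># M - K})"
        by (simp add: N M add.assoc)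
      show "(case case p of (N, K) \<Rightarrow> (K, N - K) of (K, L) \<Rightarrow> a K * (b L * c (M - K - L))) =
          (case p of (N, K) \<Rightarrow> a K * b (N - K) * c (M - N))"
        by (simp add: N M add.assoc mult.assoc)
    next
      fix p assume p: "p \<in> (SIGMA K:{K. K \<subseteq># M}. {L. L \<subseteq># M - K})"
      obtain K L where [simp]: "p = (K, L)" by (cases p)
      obtain J' where J': "M = K + J'" using p by (auto simp: subset_mset.le_iff_add)
      obtain J where M: "M = K + (L + J)" using p by (auto simp: subset_mset.le_iff_add J')
      show "(case case p of (K, L) \<Rightarrow> (K + L, K) of (N, K) \<Rightarrow> (K, N - K)) = p"
        by simp
      show "(case p of (K, L) \<Rightarrow> (K + L, K)) \<in> (SIGMA N:{N. N \<subseteq># M}. {K. K \<subseteq># N})"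
        by (simp add: M)
    qed
    also have "\<dots> = (\<Sum>K | K \<subseteq># M. a K * (\<Sum>L | L \<subseteq># M - K. b L * c (M - K - L)))"
      by (simp add: sum_distrib_left sum.Sigma finite_submultisets)
    finally show "(\<Sum>N | N \<subseteq># M. (\<Sum>K | K \<subseteq># N. a K * b (N - K)) * c (M - N)) = \<dots>" .
  qed
  show "a * b = b * a"
  proof (transfer, rule ext)
    fix a b :: "nat multiset \<Rightarrow> int" and M
    show "(\<Sum>N | N \<subseteq># M. a N * b (M - N)) = (\<Sum>N | N \<subseteq># M. b N * a (M - N))"
      by (rule sum.reindex_bij_witness[where i = "\<lambda>N. M - N" and j = "\<lambda>N. M - N"])
        (auto simp: subset_mset.diff_diff_right mult.commute)
  qed
  show "1 * a = a"
  proof (transfer, rule ext)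
    fix a :: "nat multiset \<Rightarrow> int" and M
    have "(\<Sum>N | N \<subseteq># M. (if N = {#} then 1 else 0) * a (M - N)) =
        (\<Sum>N\<in>{{#}}. (if N = {#} then 1 else 0) * a (M - N))"
      by (rule sum.mono_neutral_right) (auto simp: finite_submultisets)
    then show "(\<Sum>N | N \<subseteq># M. (if N = {#} then 1 else 0) * a (M - N)) = a M"
      by simp
  qed
  show "(a + b) * c = a * c + b * c"
    by transfer (simp add: fun_eq_iff distrib_right sum.distrib)
  show "a + b + c = a + (b + c)" by transfer (simp add: fun_eq_iff)
  show "a + b = b + a" by transfer (simp add: fun_eq_iff)
  show "0 + a = a" by transfer simp
  show "- a + a = 0" by transfer simp
  show "a - b = a + - b" by transfer simp
  show "(0 :: xseries) \<noteq> 1" by transfer (auto simp: fun_eq_iff)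
qed

end


section \<open>Schur functions and elementary symmetric functions\<close>

definition partitions :: "nat list set" where
  "partitions = {l. sorted_wrt (\<ge>) l \<and> 0 \<notin> set l}"

definition diagram :: "nat list \<Rightarrow> (nat \<times> nat) set" where
  "diagram l = {(i, j). i < length l \<and> j < l ! i}"

text \<open>
  Semistandard Young tableaux, in matrix coordinates (row, column).  Tableaux are
  \<^const>\<open>extensional\<close> functions so that each one is counted once.
\<close>

definition ssyt :: "nat list \<Rightarrow> (nat \<times> nat \<Rightarrow> nat) set" where
  "ssyt l = {T \<in> extensional (diagram l).
     (\<forall>i j. (i, Suc j) \<in> diagram l \<longrightarrow> T (i, j) \<le> T (i, Suc j)) \<and>
     (\<forall>i j. (Suc i, j) \<in> diagram l \<longrightarrow> T (i, j) < T (Suc i, j))}"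

definition tab_content :: "nat list \<Rightarrow> (nat \<times> nat \<Rightarrow> nat) \<Rightarrow> nat multiset" where
  "tab_content l T = image_mset T (mset_set (diagram l))"

text \<open>The Schur function \<open>s\<^sub>l = (\<Sum>T\<in>ssyt l. x\<^sup>T)\<close>.\<close>

definition schur :: "nat list \<Rightarrow> xseries" where
  "schur l = Abs_xseries (\<lambda>M. int (card {T \<in> ssyt l. tab_content l T = M}))"

text \<open>The monomials of the elementary symmetric function are the products of \<open>n\<close> distinct variables.\<close>

definition elem_sym :: "nat \<Rightarrow> xseries" where
  "elem_sym n = Abs_xseries (\<lambda>M. if size M = n \<and> (\<forall>i. count M i \<le> 1) then 1 else 0)"


section \<open>The semiring \<open>\<Lambda>\<^sup>S\<^sup>c\<^sup>h\<close> and Schur--Witt vectors\<close>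

text \<open>
  The ring of symmetric functions is the ring of those \<open>f :: xseries\<close> that have bounded degree
  and are invariant under all permutations of the variables.  Schur functions lie in this
  subring of \<^typ>\<open>xseries\<close>, and hence so does their span over the natural numbers; only the
  latter is needed below.
\<close>

definition Lambda_Sch :: "xseries set" where
  "Lambda_Sch = {(\<Sum>l\<in>S. of_nat (c l) * schur l) | S (c :: nat list \<Rightarrow> nat).
     finite S \<and> S \<subseteq> partitions}"

text \<open>
  Homomorphisms of semirings from \<^term>\<open>Lambda_Sch\<close>, as functions that are extensional
  outside the domain.
\<close>

definition W_Sch :: "(xseries \<Rightarrow> 'a :: comm_semiring_1) set" where
  "W_Sch = {a \<in> extensional Lambda_Sch.
     a 0 = 0 \<and> a 1 = 1 \<and>
     (\<forall>x\<in>Lambda_Sch. \<forall>y\<in>Lambda_Sch. a (x + y) = a x + a y) \<and>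
     (\<forall>x\<in>Lambda_Sch. \<forall>y\<in>Lambda_Sch. a (x * y) = a x * a y)}"

definition sigma :: "(xseries \<Rightarrow> nat) \<Rightarrow> int fps" where
  "sigma a = Abs_fps (\<lambda>n. int (a (elem_sym n)))"

lemma schur_column: "schur (replicate n 1) = elem_sym n"
proof (rule xseries_eqI)
  fix M :: "nat multiset"
  define l where "l = replicate n (1 :: nat)"
  have dia: "diagram l = (\<lambda>i. (i, 0)) ` {..<n}"
    by (auto simp: diagram_def l_def)
  have ms: "mset_set (diagram l) = image_mset (\<lambda>i. (i, 0)) (mset [0..<n])"
    unfolding dia by (subst image_mset_mset_set[symmetric]) (auto simp: inj_on_def atLeast0LessThan)
  have cont: "tab_content l T = mset (map (\<lambda>i. T (i, 0)) [0..<n])" for T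
    by (simp add: tab_content_def ms multiset.map_comp comp_def)
  have ssyt: "T \<in> ssyt l \<longleftrightarrow> T \<in> extensional (diagram l) \<and>
      sorted_wrt (<) (map (\<lambda>i. T (i, 0)) [0..<n])" for T
    by (auto simp: ssyt_def dia sorted_wrt_iff_nth_Suc_transp)
  let ?A = "{T \<in> ssyt l. tab_content l T = M}"
  have "card ?A = (if size M = n \<and> (\<forall>i. count M i \<le> 1) then 1 else 0)"
  proof (cases "size M = n \<and> (\<forall>i. count M i \<le> 1)")
    case True
    define xs where "xs = sorted_list_of_multiset M"
    have xs: "mset xs = M" "sorted xs" "length xs = n"
      using True by (auto simp: xs_def simp flip: size_mset)
    have "count (mset xs) i = (if i \<in> set xs then 1 else 0)" for i
    proof (cases "i \<in> set xs")
      case in_set: True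
      then have "count (mset xs) i > 0" by (simp only: count_greater_zero_iff set_mset_mset)
      moreover have "count (mset xs) i \<le> 1" unfolding xs(1) using True by blast
      ultimately have "count (mset xs) i = 1" by linarith
      then show ?thesis using in_set by simp
    qed (simp add: count_eq_zero_iff)
    then have "distinct xs"
      by (simp only: distinct_count_atmost_1) blast
    then have str: "sorted_wrt (<) xs"
      using xs(2) by (simp add: strict_sorted_iff)
    define T where "T = (\<lambda>p. if p \<in> diagram l then xs ! fst p else undefined)"
    have mapT: "map (\<lambda>i. T (i, 0)) [0..<n] = xs"
      by (rule nth_equalityI) (auto simp: xs(3) T_def dia)
    have "?A = {T}"
    proof (intro equalityI subsetI)
      fix U assume U: "U \<in> ?A"
      let ?ys = "map (\<lambda>i. U (i, 0)) [0..<n]"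
      have "sorted ?ys" "mset ?ys = mset xs"
        using U ssyt cont xs(1) by (auto simp: strict_sorted_iff simp del: mset_map)
      then have "?ys = xs"
        using xs(2) by (metis properties_for_sort)
      then have "U (i, 0) = xs ! i" if "i < n" for i
        using that nth_map[of i "[0..<n]" "\<lambda>i. U (i, 0)"] by simp
      then have "U p = T p" for p
        using U ssyt[of U]
        by (cases "p \<in> diagram l"; cases p) (auto simp: T_def dia extensional_def)
      then show "U \<in> {T}" by auto
    next
      fix U assume "U \<in> {T}"
      then show "U \<in> ?A"
        using str xs(1) by (auto simp: ssyt cont mapT extensional_def simp del: mset_map)
          (auto simp: T_def)
    qed
    then show ?thesis using True by simp
  next
    case False
    have "?A = {}"
    proof (rule ccontr)
      assume "?A \<noteq> {}"
      then obtain T where T: "T \<in> ssyt l" "tab_content l T = M" by auto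
      let ?ys = "map (\<lambda>i. T (i, 0)) [0..<n]"
      have d: "distinct ?ys" using T ssyt by (auto simp: strict_sorted_iff)
      have m: "mset ?ys = M" using T cont by simp
      have "size M = n" unfolding m[symmetric] by simp
      moreover have "count M i \<le> 1" for i
        using d unfolding m[symmetric] distinct_count_atmost_1 by simp
      ultimately show False using False by simp
    qed
    then show ?thesis using False by (simp only: card.empty if_False)
  qed
  then show "xcoeff (schur (replicate n 1)) M = xcoeff (elem_sym n) M"
    by (simp add: schur_def elem_sym_def Abs_xseries_inverse l_def)
qed

lemma elem_sym_in_Lambda_Sch: "elem_sym n \<in> Lambda_Sch"
proof -
  have "elem_sym n = (\<Sum>l\<in>{replicate n 1}. of_nat 1 * schur l)"
    using schur_column[of n] by simp
  moreover have "{replicate n 1} \<subseteq> partitions"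
    by (auto simp: partitions_def sorted_wrt_iff_nth_less)
  ultimately show ?thesis
    unfolding Lambda_Sch_def by (intro CollectI exI[of _ "{replicate n 1}"] exI[of _ "\<lambda>_. 1"]) simp
qed

text \<open>
  \<open>f = g / h\<close> is expressed as \<open>f h = g\<close>, which is the same since \<open>h\<close> has constant
  term \<open>1\<close> and hence is a unit of the ring of integral power series.
\<close>

definition neg_pos_quotient :: "int fps \<Rightarrow> int poly \<Rightarrow> int poly \<Rightarrow> bool" where
  "neg_pos_quotient f g h \<longleftrightarrow>
     coeff g 0 = 1 \<and> coeff h 0 = 1 \<and>
     (\<forall>z::complex. poly (map_poly of_int g) z = 0 \<longrightarrow> z \<in> \<real> \<and> Re z < 0) \<and>
     (\<forall>z::complex. poly (map_poly of_int h) z = 0 \<longrightarrow> z \<in> \<real> \<and> Re z > 0) \<and>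
     f * fps_of_poly h = fps_of_poly g"

end

theory Submission
  imports
    Defs
    "HOL-Combinatorics.Permutations"
    "HOL-Computational_Algebra.Computational_Algebra"
    "HOL-Computational_Algebra.Field_as_Ring"
begin

text \<open>
  A homomorphism from \<open>\<Lambda>\<^sup>S\<^sup>c\<^sup>h\<close> is a nonnegative function \<open>\<phi>\<close> on partitions that satisfies the Pieri
  rule for multiplication by the \<open>e\<^sub>n\<close>, and by unitriangularity \<open>\<phi>\<close> is determined by its values on
  columns.  This gives injectivity.  Conversely, such a function extends to a homomorphism because
  products of Schur functions are Schur-positive and Schur functions are linearly independent; for
  \<open>g / h = \<Prod>(1 + \<alpha>\<^sub>i t) / \<Prod>(1 - \<beta>\<^sub>j t)\<close> it is obtained from the trivial one by adjoining the
  variables \<open>\<beta>\<^sub>j\<close>, conjugating, and adjoining the \<open>\<alpha>\<^sub>i\<close>, and its values are integers by unitriangularity.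

  That every \<open>\<phi>\<close> yields such a quotient is where integrality enters, in place of the
  Edrei--Thoma theorem: the staircase of size \<open>k\<close> has so many standard tableaux that \<open>\<phi>\<close> is less than
  \<open>1\<close>, hence \<open>0\<close>, there for large \<open>k\<close>, so \<open>\<phi>\<close> vanishes on all partitions containing some rectangle.
  Putting a long column in front of the partitions and passing to the limit removes a factor
  \<open>1 / (1 - \<beta> t)\<close> and narrows the rectangle.  After finitely many steps the series is a polynomial; the
  same process for the conjugate functional removes the factors \<open>1 + \<alpha> t\<close> until nothing is left.
  Finally the real quotient is turned into an integral one by Fatou's lemma.
\<close>

section \<open>Partitions and the Pieri rule\<close>

text \<open>The obstacle on the way back from a series to a homomorphism is multiplicativity: the
  Pieri rule speaks only of products with a single \<open>e\<^sub>n\<close>, whereas a homomorphism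
  has to respect all products of Schur functions. The way out is uniformity. Each product of two
  Schur functions is expanded into a list of partitions that depends on the two factors only and
  serves every functional that satisfies the Pieri rule and has values in \<open>xseries\<close>. It
  is used twice: for the Schur functions themselves and for an integral functional regarded as a
  family of constant series.

  Partitions are functions on all natural numbers, so that adding a vertical strip or a long column
  is a pointwise operation without bookkeeping of lengths.

  The staircase is a good test shape because all its \<open>k + 1\<close> corners can be filled in
  any order, and filling them gives the next staircase; each such passage costs a factor
  \<open>x ^ (k + 1) / (k + 1)!\<close>, where \<open>x\<close> is the value at one cell. The
  rectangle bounds the number of factors to be removed, so that only finite products arise and no
  convergence of infinite products is at stake.\<close>

definition ypart :: "(nat \<Rightarrow> nat) \<Rightarrow> bool" where
  "ypart p \<longleftrightarrow> decseq p \<and> (\<exists>N. p N = 0)"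

definition cells :: "(nat \<Rightarrow> nat) \<Rightarrow> (nat \<times> nat) set" where
  "cells p = {(i, j). j < p i}"

definition ysize :: "(nat \<Rightarrow> nat) \<Rightarrow> nat" where
  "ysize p = card (cells p)"

definition addv :: "(nat \<Rightarrow> nat) \<Rightarrow> nat set \<Rightarrow> nat \<Rightarrow> nat" where
  "addv p S = (\<lambda>i. p i + of_bool (i \<in> S))"

text \<open>This is the interlacing condition, which says that no column of the skew shape holds two
  cells.\<close>

definition hstrip :: "(nat \<Rightarrow> nat) \<Rightarrow> (nat \<Rightarrow> nat) \<Rightarrow> bool" where
  "hstrip p q \<longleftrightarrow> (\<forall>i. p i \<le> q i \<and> q (Suc i) \<le> p i)"

definition vstrip :: "(nat \<Rightarrow> nat) \<Rightarrow> (nat \<Rightarrow> nat) \<Rightarrow> bool" where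
  "vstrip p q \<longleftrightarrow> (\<forall>i. p i \<le> q i \<and> q i \<le> Suc (p i))"

definition vstrips :: "nat \<Rightarrow> (nat \<Rightarrow> nat) \<Rightarrow> (nat \<Rightarrow> nat) set" where
  "vstrips n p = {q. ypart q \<and> vstrip p q \<and> ysize q = ysize p + n}"

definition hstrips :: "nat \<Rightarrow> (nat \<Rightarrow> nat) \<Rightarrow> (nat \<Rightarrow> nat) set" where
  "hstrips n p = {q. ypart q \<and> hstrip p q \<and> ysize q = ysize p + n}"

text \<open>
  \<open>pieri \<phi> c\<close> says that \<open>\<phi> p\<close> is the value at \<open>s\<^sub>p\<close> of the ring homomorphism from the symmetric
  functions that maps \<open>e\<^sub>n\<close> to the \<open>n\<close>-th coefficient of \<open>c\<close>.
\<close>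

definition pieri :: "((nat \<Rightarrow> nat) \<Rightarrow> 'a :: comm_ring_1) \<Rightarrow> 'a fps \<Rightarrow> bool" where
  "pieri \<phi> c \<longleftrightarrow> \<phi> (\<lambda>_. 0) = 1 \<and>
     (\<forall>p n. ypart p \<longrightarrow> fps_nth c n * \<phi> p = (\<Sum>q\<in>vstrips n p. \<phi> q))"

lemma ypart_mono: "ypart p \<Longrightarrow> i \<le> j \<Longrightarrow> p j \<le> p i"
  by (simp add: ypart_def decseq_def)

lemma ypart_zero [simp]: "ypart (\<lambda>_. 0)"
  by (auto simp: ypart_def decseq_def)

lemma ypart_vanish: "ypart p \<Longrightarrow> p n = 0 \<Longrightarrow> n \<le> i \<Longrightarrow> p i = 0"
  using ypart_mono[of p n i] by simp

lemma finite_cells: "ypart p \<Longrightarrow> finite (cells p)"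
proof -
  assume p: "ypart p"
  then obtain N where N: "p N = 0" by (auto simp: ypart_def)
  have "cells p \<subseteq> {..<N} \<times> {..<p 0}"
  proof
    fix x assume "x \<in> cells p"
    then obtain i j where x: "x = (i, j)" "j < p i" by (auto simp: cells_def)
    have "i < N" using ypart_vanish[OF p N, of i] x by (cases "i < N") auto
    with x ypart_mono[OF p, of 0 i] show "x \<in> {..<N} \<times> {..<p 0}" by auto
  qed
  then show ?thesis by (rule finite_subset) simp
qed

lemma ysize_zero [simp]: "ysize (\<lambda>_. 0) = 0"
  by (simp add: ysize_def cells_def)

lemma ysize_mono: "ypart q \<Longrightarrow> (\<And>i. p i \<le> q i) \<Longrightarrow> ysize p \<le> ysize q"
  unfolding ysize_def
  by (rule card_mono[OF finite_cells]) (auto simp: cells_def intro: less_le_trans)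

lemma addv_diff_set: "vstrip p q \<Longrightarrow> q = addv p {i. p i < q i}"
  unfolding vstrip_def addv_def
  by (rule ext) (simp add: of_bool_def, metis le_antisym not_less not_less_eq_eq)

lemma vstrip_addv [simp]: "vstrip p (addv p S)"
  by (auto simp: vstrip_def addv_def)

lemma inj_addv: "inj (addv p)"
  by (rule injI) (auto simp: addv_def fun_eq_iff of_bool_def split: if_splits)

lemma addv_empty [simp]: "addv p {} = p"
  by (simp add: addv_def)

lemma ypart_addv_initial:
  assumes "ypart p" "p n = 0"
  shows "ypart (addv p {..<n})"
proof -
  have "decseq (addv p {..<n})"
    using ypart_mono[OF assms(1)] by (auto simp: decseq_def addv_def of_bool_def intro: le_SucI)
  moreover have "addv p {..<n} n = 0" using assms by (simp add: addv_def)
  ultimately show ?thesis by (auto simp: ypart_def)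
qed

lemma finite_diff_set: "ypart q \<Longrightarrow> finite {i. p i < (q i :: nat)}"
proof -
  assume q: "ypart q"
  then obtain N where N: "q N = 0" by (auto simp: ypart_def)
  have "{i. p i < q i} \<subseteq> {..<N}" using ypart_vanish[OF q N] by (metis (no_types, lifting) lessThan_iff mem_Collect_eq not_less0 not_less subsetI)
  then show ?thesis by (rule finite_subset) simp
qed

lemma ysize_addv:
  assumes "ypart p" "finite S"
  shows "ysize (addv p S) = ysize p + card S"
proof -
  have "cells (addv p S) = cells p \<union> (\<lambda>i. (i, p i)) ` S"
    by (auto simp: cells_def addv_def of_bool_def less_Suc_eq split: if_splits)
  moreover have "cells p \<inter> (\<lambda>i. (i, p i)) ` S = {}" by (auto simp: cells_def)
  moreover have "card ((\<lambda>i. (i, p i)) ` S) = card S" by (rule card_image) (auto simp: inj_on_def)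
  ultimately show ?thesis
    using assms finite_cells by (simp add: ysize_def card_Un_disjoint)
qed

lemma ypart_addv_iff:
  assumes "ypart p" "finite S"
  shows "ypart (addv p S) \<longleftrightarrow> decseq (addv p S)"
proof
  assume "decseq (addv p S)"
  moreover have "\<exists>N. addv p S N = 0"
  proof -
    obtain N where N: "p N = 0" using assms by (auto simp: ypart_def)
    obtain K where K: "\<forall>i\<in>S. i < K" using assms(2) finite_nat_set_iff_bounded by auto
    then have "addv p S (max N K) = 0"
      using ypart_vanish[OF assms(1) N, of "max N K"] by (auto simp: addv_def)
    then show ?thesis ..
  qed
  ultimately show "ypart (addv p S)" by (simp add: ypart_def)
qed (simp add: ypart_def)

text \<open>A vertical strip is determined by the rows that receive a cell, so that sums over strips
  become sums over finite sets of rows.\<close>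

lemma vstrips_eq:
  assumes "ypart p"
  shows "vstrips n p = addv p ` {S. finite S \<and> card S = n \<and> ypart (addv p S)}"
proof (intro equalityI subsetI)
  fix q assume q: "q \<in> vstrips n p"
  let ?S = "{i. p i < q i}"
  have fin: "finite ?S" using q finite_diff_set by (auto simp: vstrips_def)
  have eq: "q = addv p ?S" using q addv_diff_set by (auto simp: vstrips_def)
  have "card ?S = n" using ysize_addv[OF assms fin] q eq by (auto simp: vstrips_def)
  with fin eq q show "q \<in> addv p ` {S. finite S \<and> card S = n \<and> ypart (addv p S)}"
    by (intro image_eqI[of _ _ ?S]) (auto simp: vstrips_def)
next
  fix q assume "q \<in> addv p ` {S. finite S \<and> card S = n \<and> ypart (addv p S)}"
  then show "q \<in> vstrips n p" using assms by (auto simp: vstrips_def ysize_addv)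
qed

text \<open>Below the rows of \<open>p\<close> the added cells are a gapless piece of the first
  column: if row \<open>i \<ge> N\<close> is used, then so are all rows from \<open>N\<close> to
  \<open>i\<close>.\<close>

lemma vstrips_sets_subset:
  assumes "ypart p" "p N = 0" "ypart (addv p S)" "finite S"
  shows "S \<subseteq> {..<N + card S}"
proof
  fix i assume i: "i \<in> S"
  show "i \<in> {..<N + card S}"
  proof (cases "i < N")
    case False
    have "{N..i} \<subseteq> S"
    proof
      fix j assume j: "j \<in> {N..i}"
      have "addv p S i \<le> addv p S j" using ypart_mono[OF assms(3)] j by auto
      moreover have "p j = 0" using ypart_vanish[OF assms(1,2)] j by auto
      ultimately show "j \<in> S" using i by (auto simp: addv_def of_bool_def split: if_splits)
    qed
    then have "card {N..i} \<le> card S" using assms(4) by (rule card_mono[rotated])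
    then show ?thesis using False by auto
  qed auto
qed

lemma finite_vstrip_sets:
  assumes "ypart p"
  shows "finite {S. finite S \<and> card S = n \<and> ypart (addv p S)}"
proof -
  obtain N where N: "p N = 0" using assms by (auto simp: ypart_def)
  have "{S. finite S \<and> card S = n \<and> ypart (addv p S)} \<subseteq> Pow {..<N+n}"
    using vstrips_sets_subset[OF assms N] by blast
  then show ?thesis by (rule finite_subset) simp
qed

lemma finite_vstrips: "ypart p \<Longrightarrow> finite (vstrips n p)"
  by (simp add: vstrips_eq finite_vstrip_sets)

lemma sum_vstrips:
  assumes "ypart p"
  shows "(\<Sum>q\<in>vstrips n p. f q) = (\<Sum>S | finite S \<and> card S = n \<and> ypart (addv p S). f (addv p S))"
  unfolding vstrips_eq[OF assms]
  by (subst sum.reindex) (auto intro: inj_on_subset[OF inj_addv])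

lemma addv_initial_in_vstrips:
  assumes "ypart p" "p n = 0"
  shows "addv p {..<n} \<in> vstrips n p"
  using ypart_addv_initial[OF assms] assms by (auto simp: vstrips_eq)

lemma vstrips_0: "ypart p \<Longrightarrow> vstrips 0 p = {p}"
  by (auto simp: vstrips_eq conj_commute cong: conj_cong)

text \<open>If row \<open>n\<close> stays empty, then all \<open>n\<close> cells go to the first
  \<open>n\<close> rows, and there is only one way to do this.\<close>

lemma vstrips_other:
  assumes "ypart p" "q \<in> vstrips n p" "q \<noteq> addv p {..<n}"
  shows "q n \<noteq> 0"
proof
  assume 0: "q n = 0"
  obtain S where S: "finite S" "card S = n" "ypart (addv p S)" "q = addv p S"
    using assms by (auto simp: vstrips_eq)
  have "S \<subseteq> {..<n}"
  proof
    fix i assume "i \<in> S"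
    then have "q i \<noteq> 0" using S by (simp add: addv_def)
    then have "\<not> n \<le> i" using ypart_vanish[of q n i] S(3,4) 0 by auto
    then show "i \<in> {..<n}" by simp
  qed
  then have "S = {..<n}" using S by (simp add: card_subset_eq)
  then show False using S assms by simp
qed

lemma ysize_gt_length:
  assumes "ypart p" "p n \<noteq> 0"
  shows "n < ysize p"
proof -
  have "(\<lambda>i. (i, 0 :: nat)) ` {..n} \<subseteq> cells p"
  proof
    fix x assume "x \<in> (\<lambda>i. (i, 0 :: nat)) ` {..n}"
    then obtain i where i: "x = (i, 0)" "i \<le> n" by auto
    with ypart_mono[OF assms(1) i(2)] assms(2) show "x \<in> cells p" by (auto simp: cells_def)
  qed
  then have "card ((\<lambda>i. (i, 0::nat)) ` {..n}) \<le> ysize p"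
    unfolding ysize_def by (rule card_mono[OF finite_cells[OF assms(1)]])
  moreover have "card ((\<lambda>i. (i, 0::nat)) ` {..n}) = Suc n"
    by (subst card_image) (auto simp: inj_on_def)
  ultimately show ?thesis by simp
qed

text \<open>
  Every nonempty partition is \<^term>\<open>addv p {..<n}\<close> for a partition \<open>p\<close> of length at most \<open>n\<close>; the
  other elements of \<^term>\<open>vstrips n p\<close> have the same size but are longer.
\<close>

lemma ypart_induct [consumes 1, case_names zero add]:
  assumes "ypart p"
    and zero: "P (\<lambda>_. 0)"
    and add: "\<And>n p. ypart p \<Longrightarrow> p n = 0 \<Longrightarrow> 0 < n \<Longrightarrow>
      (\<And>q. ypart q \<Longrightarrow> ysize q < ysize p + n \<Longrightarrow> P q) \<Longrightarrow>
      (\<And>q. q \<in> vstrips n p \<Longrightarrow> q \<noteq> addv p {..<n} \<Longrightarrow> P q) \<Longrightarrow> P (addv p {..<n})"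
  shows "P p"
  using assms(1)
proof (induction "ysize p" arbitrary: p rule: less_induct)
  case (less p)
  note IH1 = less.hyps
  \<comment> \<open>A second induction at fixed size, on the size minus the length, treats longer
    partitions before shorter ones. It is well founded because the length is at most the
    size.\<close>
  have "P r" if "ypart r" "ysize r = ysize p" for r
    using that
  proof (induction "ysize r - (LEAST n. r n = 0)" arbitrary: r rule: less_induct)
    case (less r)
    note IH2 = less.hyps
    define n where "n = (LEAST n. r n = 0)"
    have rn: "r n = 0" unfolding n_def using less.prems by (auto simp: ypart_def intro: LeastI)
    have rlt: "r i > 0" if "i < n" for i using that not_less_Least unfolding n_def by blast
    show "P r"
    proof (cases "n = 0")
      case True
      then have "r = (\<lambda>_. 0)" using ypart_vanish[OF less.prems(1) rn] by auto
      then show ?thesis using zero by simp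
    next
      case False
      define s where "s = (\<lambda>i. r i - 1)"
      have r: "r = addv s {..<n}"
      proof (rule ext)
        fix i show "r i = addv s {..<n} i"
          using rlt[of i] ypart_vanish[OF less.prems(1) rn, of i] by (cases "i < n") (auto simp: addv_def s_def)
      qed
      have s: "ypart s"
        using less.prems(1) unfolding ypart_def s_def decseq_def by (metis diff_0_eq_0 diff_le_mono)
      have sn: "s n = 0" using rn by (simp add: s_def)
      have size: "ysize r = ysize s + n" unfolding r by (subst ysize_addv[OF s]) auto
      show ?thesis unfolding r
      proof (rule add[OF s sn])
        show "0 < n" using False by simp
        fix q assume "ypart q" "ysize q < ysize s + n"
        then show "P q" using IH1[of q] size less.prems by simp
      next
        fix q assume q: "q \<in> vstrips n s" "q \<noteq> addv s {..<n}"
        have yq: "ypart q" and sq: "ysize q = ysize r" using q size by (auto simp: vstrips_def)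
        have qn: "q n \<noteq> 0" using vstrips_other[OF s q] .
        have "n < (LEAST m. q m = 0)"
        proof -
          have "q (LEAST m. q m = 0) = 0" using yq by (auto simp: ypart_def intro: LeastI)
          with qn ypart_vanish[OF yq] show ?thesis by (meson not_less)
        qed
        moreover have "(LEAST m. q m = 0) > 0 \<Longrightarrow> (LEAST m. q m = 0) - 1 < ysize q"
          by (rule ysize_gt_length[OF yq]) (use not_less_Least[of "(LEAST m. q m = 0) - 1" "\<lambda>m. q m = 0"] in auto)
        ultimately have "ysize q - (LEAST m. q m = 0) < ysize r - (LEAST n. r n = 0)"
          using sq unfolding n_def[symmetric] by linarith
        then show "P q" using IH2 yq sq less.prems by simp
      qed
    qed
  qed
  then show "P p" using less.prems by simp
qed

text \<open>The Pieri rule, solved for its shortest term. Combined with \<open>ypart_induct\<close>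
  it is the unitriangular recursion behind uniqueness and integrality.\<close>

lemma pieri_column_eq:
  assumes "pieri \<phi> c" "ypart p" "p n = 0"
  shows "\<phi> (addv p {..<n}) = fps_nth c n * \<phi> p - (\<Sum>q\<in>vstrips n p - {addv p {..<n}}. \<phi> q)"
  using assms addv_initial_in_vstrips[OF assms(2,3)] finite_vstrips[OF assms(2)]
  by (simp add: pieri_def sum_diff1)

lemma pieri_unique:
  assumes "pieri \<phi> c" "pieri \<psi> c" "ypart p"
  shows "\<phi> p = \<psi> p"
  using assms(3)
proof (induction rule: ypart_induct)
  case zero
  then show ?case using assms by (simp add: pieri_def)
next
  case (add n p)
  have "\<phi> p = \<psi> p" using add by simp
  moreover have "(\<Sum>q\<in>vstrips n p - {addv p {..<n}}. \<phi> q) = (\<Sum>q\<in>vstrips n p - {addv p {..<n}}. \<psi> q)"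
    using add by (intro sum.cong) auto
  ultimately show ?case
    using pieri_column_eq[OF assms(1)] pieri_column_eq[OF assms(2)] add by simp
qed

section \<open>Exchanging horizontal and vertical strips\<close>

lemma card_interval_sets:
  assumes "finite D" "F \<subseteq> D"
  shows "card {S. F \<subseteq> S \<and> S \<subseteq> D \<and> card S = n} =
    (if n < card F then 0 else (card D - card F) choose (n - card F))"
proof -
  have finF: "finite F" using assms finite_subset by blast
  have eq: "{S. F \<subseteq> S \<and> S \<subseteq> D \<and> card S = n} = (\<union>) F ` {B. B \<subseteq> D - F \<and> card B + card F = n}"
  proof (intro equalityI subsetI)
    fix S assume S: "S \<in> {S. F \<subseteq> S \<and> S \<subseteq> D \<and> card S = n}"
    then have "finite S" using assms finite_subset by blast
    then have "card (S - F) + card F = n" using S finF card_mono[of S F] by (simp add: card_Diff_subset)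
    with S show "S \<in> (\<union>) F ` {B. B \<subseteq> D - F \<and> card B + card F = n}"
      by (intro image_eqI[of _ _ "S - F"]) auto
  next
    fix S assume "S \<in> (\<union>) F ` {B. B \<subseteq> D - F \<and> card B + card F = n}"
    then obtain B where B: "S = F \<union> B" "B \<subseteq> D - F" "card B + card F = n" by auto
    moreover have "card (F \<union> B) = card F + card B"
      using B assms finF finite_subset[of B D] by (subst card_Un_disjoint) auto
    ultimately show "S \<in> {S. F \<subseteq> S \<and> S \<subseteq> D \<and> card S = n}" using assms by auto
  qed
  have "inj_on ((\<union>) F) {B. B \<subseteq> D - F \<and> card B + card F = n}" by (rule inj_onI) blast
  then have "card {S. F \<subseteq> S \<and> S \<subseteq> D \<and> card S = n} = card {B. B \<subseteq> D - F \<and> card B + card F = n}"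
    unfolding eq by (rule card_image)
  also have "\<dots> = (if n < card F then 0 else (card D - card F) choose (n - card F))"
  proof (cases "n < card F")
    case False
    then have "{B. B \<subseteq> D - F \<and> card B + card F = n} = {B. B \<subseteq> D - F \<and> card B = n - card F}" by auto
    then show ?thesis using False assms finF by (simp add: n_subsets card_Diff_subset)
  qed (auto simp: card_eq_0_iff)
  finally show ?thesis .
qed

definition subv :: "(nat \<Rightarrow> nat) \<Rightarrow> nat set \<Rightarrow> nat \<Rightarrow> nat" where
  "subv p S = (\<lambda>i. p i - of_bool (i \<in> S))"

lemma vstrip_subv: "vstrip r k \<Longrightarrow> r = subv k {i. r i < k i}"
  unfolding vstrip_def subv_def
proof (rule ext)
  fix i assume "\<forall>i. r i \<le> k i \<and> k i \<le> Suc (r i)"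
  then have "r i \<le> k i \<and> k i \<le> Suc (r i)" by blast
  then show "r i = k i - of_bool (i \<in> {i. r i < k i})" by (cases "r i < k i") auto
qed

lemma addv_subv: "(\<And>i. i \<in> T \<Longrightarrow> 0 < k i) \<Longrightarrow> addv (subv k T) T = k"
  by (auto simp: addv_def subv_def fun_eq_iff of_bool_def)

lemma vstrips_subv:
  assumes "ypart k" "ypart (subv k T)" "finite T" "\<And>i. i \<in> T \<Longrightarrow> 0 < k i"
  shows "k \<in> vstrips (card T) (subv k T)"
  using assms addv_subv[of T k] by (auto simp: vstrips_eq intro!: image_eqI[of _ _ T])

lemma inj_on_subv: "inj_on (subv k) {T. \<forall>i\<in>T. 0 < k i}"
proof (rule inj_onI)
  fix S T assume S: "S \<in> {T. \<forall>i\<in>T. 0 < k i}" and T: "T \<in> {T. \<forall>i\<in>T. 0 < k i}" and eq: "subv k S = subv k T"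
  have "i \<in> S \<longleftrightarrow> i \<in> T" for i
  proof -
    have "k i - of_bool (i \<in> S) = k i - of_bool (i \<in> T)"
      using fun_cong[OF eq, of i] by (simp add: subv_def)
    with S T show ?thesis by (cases "i \<in> S"; cases "i \<in> T") auto
  qed
  then show "S = T" by blast
qed

lemma ypart_mono_Suc: "ypart p \<Longrightarrow> p (Suc i) \<le> p i"
  by (simp add: ypart_mono)

lemma ypartI: "(\<And>i. p (Suc i) \<le> p i) \<Longrightarrow> p N = 0 \<Longrightarrow> ypart p"
  unfolding ypart_def by (auto intro: decseq_SucI)

context
  fixes m k :: "nat \<Rightarrow> nat"
  assumes m: "ypart m" and k: "ypart k"
begin

text \<open>\<open>F\<close> is the set of rows that a strip is forced to use. \<open>D\<close> is
  the set of rows from which a cell may be removed, and \<open>D'\<close> the set of rows to which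
  one may be added: the bound for row \<open>i + 1\<close> comes from row \<open>i\<close> of
  \<open>k\<close>, which shifts \<open>D\<close> by one, and row 0 has no row above it and is
  always allowed.\<close>

private definition "F = {i. m i < k i}"
private definition "D = {i. m (Suc i) < k i}"
private definition "D' = insert 0 (Suc ` D)"

private lemma fin: "finite D" "F \<subseteq> D"
proof -
  have "D \<subseteq> {i. 0 < k i}" by (auto simp: D_def)
  then show "finite D" using finite_diff_set[OF k, of "\<lambda>_. 0"] finite_subset by auto
  show "F \<subseteq> D" using ypart_mono_Suc[OF m] le_less_trans by (auto simp: D_def F_def)
qed

private lemma up_down:
  assumes "\<forall>i. k i \<le> Suc (m i) \<and> m (Suc i) \<le> k i"
  shows "{q \<in> vstrips n m. hstrip k q} = addv m ` {S. F \<subseteq> S \<and> S \<subseteq> D' \<and> card S = n}" (is ?A)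
    and "{r. ypart r \<and> hstrip r m \<and> k \<in> vstrips n r} = subv k ` {S. F \<subseteq> S \<and> S \<subseteq> D \<and> card S = n}" (is ?B)
proof -
  show ?A
  proof (intro equalityI subsetI)
    fix q assume "q \<in> {q \<in> vstrips n m. hstrip k q}"
    then obtain S where S: "finite S" "card S = n" "q = addv m S" "hstrip k q"
      using m by (auto simp: vstrips_eq)
    have "F \<subseteq> S"
    proof
      fix i assume "i \<in> F"
      then have "m i < addv m S i" using S by (auto simp: F_def hstrip_def intro: less_le_trans)
      then show "i \<in> S" by (auto simp: addv_def of_bool_def split: if_splits)
    qed
    moreover have "S \<subseteq> D'"
    proof
      fix i assume i: "i \<in> S"
      show "i \<in> D'"
      proof (cases i)
        case (Suc j)
        have "addv m S (Suc j) \<le> k j" using S by (auto simp: hstrip_def)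
        then show ?thesis using i Suc by (auto simp: D_def D'_def addv_def)
      qed (simp add: D'_def)
    qed
    ultimately show "q \<in> addv m ` {S. F \<subseteq> S \<and> S \<subseteq> D' \<and> card S = n}" using S by auto
  next
    fix q assume "q \<in> addv m ` {S. F \<subseteq> S \<and> S \<subseteq> D' \<and> card S = n}"
    then obtain S where S: "F \<subseteq> S" "S \<subseteq> D'" "card S = n" "q = addv m S" by auto
    have finS: "finite S" using S(2) fin(1) by (auto simp: D'_def intro: finite_subset)
    have h: "hstrip k q"
      unfolding hstrip_def
    proof (intro allI conjI)
      fix i
      show "k i \<le> q i" using S assms by (cases "i \<in> F") (auto simp: F_def addv_def)
      show "q (Suc i) \<le> k i"
      proof (cases "Suc i \<in> S")
        case True
        then have "i \<in> D" using S(2) by (auto simp: D'_def)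
        then show ?thesis using S by (auto simp: addv_def D_def)
      qed (use S assms in \<open>auto simp: addv_def\<close>)
    qed
    then have "decseq q" by (intro decseq_SucI) (auto simp: hstrip_def intro: le_trans)
    then have "ypart q" using ypart_addv_iff[OF m finS] S by simp
    then show "q \<in> {q \<in> vstrips n m. hstrip k q}" using h S finS m by (auto simp: vstrips_eq)
  qed
  show ?B
  proof (intro equalityI subsetI)
    fix r assume r: "r \<in> {r. ypart r \<and> hstrip r m \<and> k \<in> vstrips n r}"
    define T where "T = {i. r i < k i}"
    have v: "vstrip r k" and yr: "ypart r" using r by (auto simp: vstrips_def)
    have finT: "finite T" unfolding T_def by (rule finite_diff_set[OF k])
    have "k = addv r T" unfolding T_def by (rule addv_diff_set[OF v])
    then have "card T = n" using ysize_addv[OF yr finT] r by (auto simp: vstrips_def)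
    moreover have "F \<subseteq> T" using r by (auto simp: F_def T_def hstrip_def intro: le_less_trans)
    moreover have "T \<subseteq> D" using r by (auto simp: D_def T_def hstrip_def intro: le_less_trans)
    ultimately show "r \<in> subv k ` {S. F \<subseteq> S \<and> S \<subseteq> D \<and> card S = n}"
      using vstrip_subv[OF v] T_def by auto
  next
    fix r assume "r \<in> subv k ` {S. F \<subseteq> S \<and> S \<subseteq> D \<and> card S = n}"
    then obtain T where T: "F \<subseteq> T" "T \<subseteq> D" "card T = n" "r = subv k T" by auto
    have finT: "finite T" using T(2) fin(1) finite_subset by blast
    have h: "hstrip r m"
      unfolding hstrip_def
    proof (intro allI conjI)
      fix i
      show "r i \<le> m i" using T assms[rule_format, of i]
        by (cases "i \<in> F") (auto simp: F_def subv_def of_bool_def)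
      show "m (Suc i) \<le> r i" using T assms[rule_format, of i]
        by (cases "i \<in> T") (auto simp: D_def subv_def)
    qed
    obtain N where "k N = 0" using k by (auto simp: ypart_def)
    then have "r N = 0" by (simp add: T subv_def)
    then have yr: "ypart r"
      using h by (intro ypartI[of r N]) (auto simp: hstrip_def intro: le_trans[of _ "m (Suc _)"])
    have "k \<in> vstrips n r" using vstrips_subv[OF k _ finT] yr T by (force simp: D_def)
    then show "r \<in> {r. ypart r \<and> hstrip r m \<and> k \<in> vstrips n r}" using h yr by simp
  qed
qed

text \<open>
  The relation \<open>D\<^sub>h(y) U\<^sub>v(x) = (1 + x y) U\<^sub>v(x) D\<^sub>h(y)\<close> for adding vertical and removing horizontal
  strips.  Both sides count the sets between \<open>F\<close> and \<open>D\<close> or \<open>D'\<close>, where \<open>D'\<close> has one more element.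
\<close>

lemma hstrip_vstrip_exchange:
  "card {q \<in> vstrips n m. hstrip k q} =
     card {r. ypart r \<and> hstrip r m \<and> k \<in> vstrips n r} +
     (if n = 0 then 0 else card {r. ypart r \<and> hstrip r m \<and> k \<in> vstrips (n - 1) r})"
proof (cases "\<forall>i. k i \<le> Suc (m i) \<and> m (Suc i) \<le> k i")
  case True
  have D': "finite D'" "card D' = Suc (card D)"
    using fin by (auto simp: D'_def card_image)
  have "F \<subseteq> D'"
  proof
    fix i assume i: "i \<in> F"
    show "i \<in> D'"
    proof (cases i)
      case (Suc j)
      then have "m (Suc j) < k j" using i ypart_mono_Suc[OF k, of j] by (auto simp: F_def)
      then show ?thesis using Suc by (auto simp: D'_def D_def)
    qed (simp add: D'_def)
  qed
  moreover have "card {q \<in> vstrips n m. hstrip k q} = card {S. F \<subseteq> S \<and> S \<subseteq> D' \<and> card S = n}"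
    unfolding up_down(1)[OF True] by (rule card_image) (auto intro: inj_on_subset[OF inj_addv])
  moreover have "card {r. ypart r \<and> hstrip r m \<and> k \<in> vstrips n r} =
      card {S. F \<subseteq> S \<and> S \<subseteq> D \<and> card S = n}" for n
    unfolding up_down(2)[OF True]
    by (rule card_image, rule inj_on_subset[OF inj_on_subv]) (auto simp: D_def)
  moreover have "card F \<le> card D" using fin by (simp add: card_mono)
  \<comment> \<open>Pascal's rule, since \<open>D'\<close> has exactly one element more than
    \<open>D\<close>.\<close>
  moreover have "(if n < card F then 0 else (card D' - card F) choose (n - card F)) =
      (if n < card F then 0 else (card D - card F) choose (n - card F)) +
      (if n = 0 then 0 else if n - 1 < card F then 0 else (card D - card F) choose (n - 1 - card F))"
    if "card F \<le> card D"
  proof (cases "n \<le> card F")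
    case False
    then obtain j where "n = Suc (card F + j)" by (metis less_imp_Suc_add not_less)
    then show ?thesis using D' that by (simp add: Suc_diff_le)
  qed (auto simp: le_Suc_eq)
  ultimately show ?thesis
    using D' fin by (simp only: card_interval_sets)
next
  case False
  then obtain i where i: "\<not> (k i \<le> Suc (m i) \<and> m (Suc i) \<le> k i)" by blast
  have "\<not> hstrip k q" if "q \<in> vstrips n m" for q
  proof -
    have "q i \<le> Suc (m i)" "m (Suc i) \<le> q (Suc i)" using that by (auto simp: vstrips_def vstrip_def)
    moreover have "k i \<le> q i" "q (Suc i) \<le> k i" if "hstrip k q" using that by (auto simp: hstrip_def)
    ultimately show ?thesis using i by linarith
  qed
  then have "{q \<in> vstrips n m. hstrip k q} = {}" by blast
  moreover have "\<not> hstrip r m" if "k \<in> vstrips n r" for n r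
  proof -
    have "k i \<le> Suc (r i)" "r i \<le> k i" using that by (auto simp: vstrips_def vstrip_def)
    moreover have "r i \<le> m i" "m (Suc i) \<le> r i" if "hstrip r m" using that by (auto simp: hstrip_def)
    ultimately show ?thesis using i by linarith
  qed
  then have "{r. ypart r \<and> hstrip r m \<and> k \<in> vstrips n r} = {}" for n by blast
  ultimately show ?thesis by (simp only: card.empty if_cancel add_0)
qed

end

lemma inj_cells: "inj cells"
proof (rule injI)
  fix p q assume "cells p = cells q"
  then have "j < p i \<longleftrightarrow> j < q i" for i j by (auto simp: cells_def set_eq_iff)
  then have "p i = q i" for i by (metis nat_neq_iff)
  then show "p = q" by auto
qed

lemma finite_cells_subset: "finite A \<Longrightarrow> finite {p. cells p \<subseteq> A}"
  by (rule inj_on_finite[of cells _ "Pow A"]) (auto intro: inj_on_subset[OF inj_cells])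

lemma finite_below: "ypart q \<Longrightarrow> finite {p. \<forall>i. p i \<le> q i}"
  by (rule finite_subset[OF _ finite_cells_subset[OF finite_cells[of q]]])
     (auto simp: cells_def intro: less_le_trans)

lemma finite_hstrip_below: "ypart q \<Longrightarrow> finite {p. ypart p \<and> hstrip p q}"
  by (rule finite_subset[OF _ finite_below[of q]]) (auto simp: hstrip_def)

lemma finite_yparts_size: "finite {p. ypart p \<and> ysize p = n}"
proof -
  have "cells p \<subseteq> {..<n} \<times> {..<n}" if "ypart p" "ysize p = n" for p
  proof
    fix x assume "x \<in> cells p"
    then obtain i j where x: "x = (i, j)" "j < p i" by (auto simp: cells_def)
    have "i < n" using ysize_gt_length[of p i] that x by simp
    moreover have "j < n"
    proof -
      have "(\<lambda>j. (i, j)) ` {..<p i} \<subseteq> cells p" by (auto simp: cells_def)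
      from card_mono[OF finite_cells[OF that(1)] this] have "p i \<le> n"
        using that by (simp add: ysize_def card_image inj_on_def)
      then show ?thesis using x by simp
    qed
    ultimately show "x \<in> {..<n} \<times> {..<n}" using x by simp
  qed
  then have "{p. ypart p \<and> ysize p = n} \<subseteq> {p. cells p \<subseteq> {..<n} \<times> {..<n}}" by blast
  then show ?thesis by (rule finite_subset) (rule finite_cells_subset, simp)
qed

lemma finite_hstrips: "finite (hstrips n p)"
  by (rule finite_subset[OF _ finite_yparts_size[of "ysize p + n"]]) (auto simp: hstrips_def)

lemma sum_card_eq:
  assumes "finite A" "finite B"
  shows "(\<Sum>x\<in>A. \<Sum>y | y \<in> B \<and> R x y. f y) = (\<Sum>y\<in>B. of_nat (card {x \<in> A. R x y}) * (f y :: 'a :: comm_ring_1))"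
  by (subst sum.swap_restrict[OF assms, of "\<lambda>_. f" R]) simp

text \<open>Adjoining \<open>a\<close> to the variables at which the Schur functions are evaluated.\<close>

definition hstep :: "'a :: comm_ring_1 \<Rightarrow> ((nat \<Rightarrow> nat) \<Rightarrow> 'a) \<Rightarrow> (nat \<Rightarrow> nat) \<Rightarrow> 'a" where
  "hstep a \<phi> p = (\<Sum>q | ypart q \<and> hstrip q p. a ^ (ysize p - ysize q) * \<phi> q)"

lemma hstrip_ysize: "ypart q \<Longrightarrow> hstrip p q \<Longrightarrow> ysize p \<le> ysize q"
  by (rule ysize_mono) (auto simp: hstrip_def)

text \<open>The exchange relation, summed with a factor \<open>a\<close> for every cell of the
  horizontal strip. In its second term the vertical strip has one cell less, so the horizontal strip
  has one cell more; this accounts for the summand \<open>a X\<close> of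
  \<open>1 + a X\<close>.\<close>

lemma pieri_hstep:
  fixes c :: "'a :: comm_ring_1 fps"
  assumes "pieri \<phi> c"
  shows "pieri (hstep a \<phi>) ((1 + fps_const a * fps_X) * c)"
  unfolding pieri_def
proof (intro conjI allI impI)
  have "hstrip q (\<lambda>_. 0) \<longleftrightarrow> q = (\<lambda>_. 0)" for q by (auto simp: hstrip_def)
  then have "{q. ypart q \<and> hstrip q (\<lambda>_. 0)} = {\<lambda>_. 0}" by auto
  then show "hstep a \<phi> (\<lambda>_. 0) = 1"
    using assms by (simp add: hstep_def pieri_def)
next
  fix m :: "nat \<Rightarrow> nat" and n assume m: "ypart m"
  define H where "H = (\<lambda>q. {p. ypart p \<and> hstrip p q})"
  have finH: "finite (H q)" if "ypart q" for q unfolding H_def using finite_hstrip_below that .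
  define B where "B = (\<Union>q\<in>vstrips n m. H q) \<union> (\<Union>r\<in>H m. vstrips n r \<union> vstrips (n - 1) r)"
  have finB: "finite B"
    unfolding B_def using finite_vstrips[OF m] finH[OF m]
    by (auto simp: H_def intro!: finite_vstrips finite_hstrip_below) (auto simp: vstrips_def)
  have yB: "ypart k" if "k \<in> B" for k using that by (auto simp: B_def H_def vstrips_def)
  \<comment> \<open>The exponent depends only on the inner shape \<open>k\<close> and not on the
    intermediate shape, so that both orders of the strips carry the same weight.\<close>
  define w where "w = (\<lambda>k. a ^ (ysize m + n - ysize k) * \<phi> k)"
  have "(\<Sum>q\<in>vstrips n m. hstep a \<phi> q) = (\<Sum>q\<in>vstrips n m. \<Sum>k | k \<in> B \<and> hstrip k q. w k)"
  proof (intro sum.cong refl)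
    fix q assume q: "q \<in> vstrips n m"
    then have eq: "{k. ypart k \<and> hstrip k q} = {k. k \<in> B \<and> hstrip k q}" using yB by (auto simp: B_def H_def)
    show "hstep a \<phi> q = (\<Sum>k | k \<in> B \<and> hstrip k q. w k)"
      unfolding hstep_def w_def eq using q by (intro sum.cong) (auto simp: vstrips_def)
  qed
  also have "\<dots> = (\<Sum>k\<in>B. of_nat (card {q \<in> vstrips n m. hstrip k q}) * w k)"
    by (rule sum_card_eq) (use finite_vstrips[OF m] finB in auto)
  finally have L: "(\<Sum>q\<in>vstrips n m. hstep a \<phi> q) = \<dots>" .
  have R: "(\<Sum>r\<in>H m. \<Sum>k\<in>vstrips j r. w k) =
      (\<Sum>k\<in>B. of_nat (card {r. ypart r \<and> hstrip r m \<and> k \<in> vstrips j r}) * w k)"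
    if "j = n \<or> j = n - 1" for j
  proof -
    have "(\<Sum>r\<in>H m. \<Sum>k\<in>vstrips j r. w k) = (\<Sum>r\<in>H m. \<Sum>k | k \<in> B \<and> k \<in> vstrips j r. w k)"
      using that by (intro sum.cong) (auto simp: B_def)
    also have "\<dots> = (\<Sum>k\<in>B. of_nat (card {r \<in> H m. k \<in> vstrips j r}) * w k)"
      by (rule sum_card_eq) (use finH[OF m] finB in auto)
    finally show ?thesis by (simp add: H_def conj_assoc)
  qed
  have c0: "fps_nth c j * \<phi> r = (\<Sum>k\<in>vstrips j r. \<phi> k)" if "r \<in> H m" for j r
    using assms that by (auto simp: pieri_def H_def)
  have 1: "fps_nth c n * hstep a \<phi> m = (\<Sum>r\<in>H m. \<Sum>k\<in>vstrips n r. w k)"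
    unfolding hstep_def sum_distrib_left H_def[symmetric]
  proof (rule sum.cong)
    fix r assume r: "r \<in> H m"
    have "fps_nth c n * (a ^ (ysize m - ysize r) * \<phi> r) = a ^ (ysize m - ysize r) * (\<Sum>k\<in>vstrips n r. \<phi> k)"
      using c0[OF r] by (metis mult.left_commute)
    also have "\<dots> = (\<Sum>k\<in>vstrips n r. w k)"
      unfolding sum_distrib_left by (intro sum.cong) (auto simp: w_def vstrips_def)
    finally show "fps_nth c n * (a ^ (ysize m - ysize r) * \<phi> r) = \<dots>" .
  qed (simp add: H_def)
  have 2: "a * fps_nth c (n - 1) * hstep a \<phi> m = (\<Sum>r\<in>H m. \<Sum>k\<in>vstrips (n - 1) r. w k)" if "n > 0"
    unfolding hstep_def sum_distrib_left H_def[symmetric]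
  proof (rule sum.cong)
    fix r assume r: "r \<in> H m"
    have le: "ysize r \<le> ysize m" using r hstrip_ysize[OF m] by (auto simp: H_def)
    have "a * fps_nth c (n - 1) * (a ^ (ysize m - ysize r) * \<phi> r) =
        a ^ Suc (ysize m - ysize r) * (fps_nth c (n - 1) * \<phi> r)" by (simp add: mult_ac)
    also have "\<dots> = a ^ Suc (ysize m - ysize r) * (\<Sum>k\<in>vstrips (n - 1) r. \<phi> k)"
      by (simp only: c0[OF r])
    also have "\<dots> = (\<Sum>k\<in>vstrips (n - 1) r. w k)"
      unfolding sum_distrib_left
    proof (intro sum.cong refl)
      fix k assume "k \<in> vstrips (n - 1) r"
      then have "ysize m + n - ysize k = Suc (ysize m - ysize r)"
        using le that by (auto simp: vstrips_def)
      then show "a ^ Suc (ysize m - ysize r) * \<phi> k = w k" by (simp only: w_def)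
    qed
    finally show "a * fps_nth c (n - 1) * (a ^ (ysize m - ysize r) * \<phi> r) = \<dots>" .
  qed (simp add: H_def)
  have ex: "of_nat (card {q \<in> vstrips n m. hstrip k q}) * w k =
     of_nat (card {r. ypart r \<and> hstrip r m \<and> k \<in> vstrips n r}) * w k +
     (if n = 0 then 0 else of_nat (card {r. ypart r \<and> hstrip r m \<and> k \<in> vstrips (n - 1) r}) * w k)"
    if "k \<in> B" for k
    using hstrip_vstrip_exchange[OF m yB[OF that], of n] by (simp add: distrib_right)
  have "fps_nth ((1 + fps_const a * fps_X) * c) n * hstep a \<phi> m =
      fps_nth c n * hstep a \<phi> m + (if n = 0 then 0 else a * fps_nth c (n - 1) * hstep a \<phi> m)"
    by (simp add: distrib_right mult.assoc)
  also have "\<dots> = (\<Sum>q\<in>vstrips n m. hstep a \<phi> q)"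
    unfolding L using 1 2 R[of n] R[of "n - 1"] ex by (simp add: sum.distrib)
  finally show "fps_nth ((1 + fps_const a * fps_X) * c) n * hstep a \<phi> m = \<dots>" .
qed

subsection \<open>Horizontal strips and conjugation\<close>

text \<open>Toggling a fixed element of \<open>D - F\<close> pairs sets of opposite sign.\<close>

lemma alternating_interval:
  assumes "finite D" "F \<subseteq> D" "F \<noteq> D"
  shows "(\<Sum>T | F \<subseteq> T \<and> T \<subseteq> D. (- 1 :: int) ^ card T) = 0"
proof -
  obtain x where x: "x \<in> D" "x \<notin> F" using assms by blast
  define A where "A = {T. F \<subseteq> T \<and> T \<subseteq> D \<and> x \<notin> T}"
  have finA: "finite A" using assms(1) by (auto simp: A_def intro: finite_subset[of _ "Pow D"])
  have eq: "{T. F \<subseteq> T \<and> T \<subseteq> D} = A \<union> insert x ` A"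
  proof (intro equalityI subsetI)
    fix T assume T: "T \<in> {T. F \<subseteq> T \<and> T \<subseteq> D}"
    show "T \<in> A \<union> insert x ` A"
    proof (cases "x \<in> T")
      case True
      then have "T = insert x (T - {x})" "T - {x} \<in> A" using T x by (auto simp: A_def)
      then show ?thesis by blast
    qed (use T in \<open>auto simp: A_def\<close>)
  qed (use x in \<open>auto simp: A_def\<close>)
  have inj: "inj_on (insert x) A" by (rule inj_onI) (auto simp: A_def)
  have card: "card (insert x T) = Suc (card T)" if "T \<in> A" for T
    using that assms(1) by (auto simp: A_def finite_subset)
  have "A \<inter> insert x ` A = {}" by (auto simp: A_def)
  then have "(\<Sum>T | F \<subseteq> T \<and> T \<subseteq> D. (- 1 :: int) ^ card T) =
      (\<Sum>T\<in>A. (- 1) ^ card T) + (\<Sum>T\<in>A. (- 1) ^ card (insert x T))"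
    unfolding eq using finA inj by (simp add: sum.union_disjoint sum.reindex)
  also have "\<dots> = 0" using card by (simp add: sum_negf)
  finally show ?thesis .
qed

lemma hstrip_vstrip_cancel:
  assumes m: "ypart m" and k: "ypart k"
  shows "(\<Sum>r | ypart r \<and> hstrip m r \<and> vstrip r k. (- 1 :: int) ^ (ysize k - ysize r)) = of_bool (k = m)"
proof -
  define F where "F = {Suc i | i. m i < k (Suc i)}"
  define D where "D = {i. m i < k i}"
  have finD: "finite D" unfolding D_def by (rule finite_diff_set[OF k])
  have FD: "F \<subseteq> D" using ypart_mono_Suc[OF m] le_less_trans by (auto simp: F_def D_def)
  define A where "A = {r. ypart r \<and> hstrip m r \<and> vstrip r k}"
  show ?thesis
  proof (cases "\<forall>i. m i \<le> k i \<and> k (Suc i) \<le> Suc (m i)")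
    case True
    have A: "A = subv k ` {T. F \<subseteq> T \<and> T \<subseteq> D}"
    proof (intro equalityI subsetI)
      fix r assume r: "r \<in> A"
      define T where "T = {i. r i < k i}"
      have "F \<subseteq> T" using r by (auto simp: A_def hstrip_def F_def T_def intro: le_less_trans)
      moreover have "T \<subseteq> D" using r by (auto simp: A_def hstrip_def D_def T_def intro: le_less_trans)
      ultimately show "r \<in> subv k ` {T. F \<subseteq> T \<and> T \<subseteq> D}"
        using vstrip_subv[of r k] r T_def by (auto simp: A_def)
    next
      fix r assume "r \<in> subv k ` {T. F \<subseteq> T \<and> T \<subseteq> D}"
      then obtain T where T: "F \<subseteq> T" "T \<subseteq> D" "r = subv k T" by auto
      have h: "hstrip m r"
        unfolding hstrip_def
      proof (intro allI conjI)
        fix i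
        show "m i \<le> r i" using T True[rule_format, of i]
          by (cases "i \<in> T") (auto simp: D_def subv_def)
        show "r (Suc i) \<le> m i" using T True[rule_format, of i]
          by (cases "Suc i \<in> F") (auto simp: F_def subv_def of_bool_def)
      qed
      obtain N where "k N = 0" using k by (auto simp: ypart_def)
      then have "r N = 0" by (simp add: T subv_def)
      then have yr: "ypart r"
        using h by (intro ypartI[of r N]) (auto simp: hstrip_def intro: le_trans[of _ "m _"])
      have "vstrip r k" using T by (auto simp: vstrip_def subv_def of_bool_def)
      then show "r \<in> A" using h yr by (simp add: A_def)
    qed
    have inj: "inj_on (subv k) {T. F \<subseteq> T \<and> T \<subseteq> D}"
      by (rule inj_on_subset[OF inj_on_subv]) (auto simp: D_def)
    have "(\<Sum>r\<in>A. (- 1 :: int) ^ (ysize k - ysize r)) = (\<Sum>T | F \<subseteq> T \<and> T \<subseteq> D. (- 1) ^ card T)"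
      unfolding A sum.reindex[OF inj]
    proof (intro sum.cong refl)
      fix T assume T: "T \<in> {T. F \<subseteq> T \<and> T \<subseteq> D}"
      then have "subv k T \<in> A" using A by blast
      then have y: "ypart (subv k T)" by (simp add: A_def)
      have "finite T" using T finD finite_subset by auto
      have "k \<in> vstrips (card T) (subv k T)" using vstrips_subv[OF k y \<open>finite T\<close>] T by (force simp: D_def)
      then have "ysize k = ysize (subv k T) + card T" by (simp add: vstrips_def)
      then show "((\<lambda>r. (- 1 :: int) ^ (ysize k - ysize r)) \<circ> subv k) T = (- 1) ^ card T" by simp
    qed
    also have "\<dots> = of_bool (k = m)"
    proof (cases "F = D")
      case FD: True
      \<comment> \<open>Row 0 is never in \<open>F\<close>. If row \<open>i\<close> is not in
        \<open>D\<close>, then \<open>k i = m i\<close>, and this bounds \<open>k (Suc i)\<close> by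
        \<open>m i\<close> and keeps row \<open>i + 1\<close> out of \<open>F\<close>. Hence
        \<open>F = D\<close> leaves both sets empty.\<close>
      have "i \<notin> D" for i
      proof (induction i)
        case (Suc i)
        then have "k i = m i" using True by (auto simp: D_def intro: antisym)
        then have "k (Suc i) \<le> m i" using ypart_mono_Suc[OF k, of i] by simp
        then show ?case unfolding FD[symmetric] by (auto simp: F_def)
      qed (auto simp: F_def simp flip: FD)
      then have "D = {}" "F = {}" using FD by auto
      then have "k i \<le> m i" "m i \<le> k i" for i using True by (auto simp: D_def not_less)
      then have "k = m" by (intro ext antisym)
      then show ?thesis using \<open>D = {}\<close> \<open>F = {}\<close> by simp
    next
      case False
      then have "k \<noteq> m" using FD by (auto simp: D_def)
      then show ?thesis using alternating_interval[OF finD FD False] by simp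
    qed
    finally show ?thesis unfolding A_def .
  next
    case False
    then obtain i where i: "\<not> (m i \<le> k i \<and> k (Suc i) \<le> Suc (m i))" by blast
    have "A = {}"
    proof (rule ccontr)
      assume "A \<noteq> {}"
      then obtain r where r: "hstrip m r" "vstrip r k" by (auto simp: A_def)
      have "m i \<le> r i" "r (Suc i) \<le> m i" "r i \<le> k i" "k (Suc i) \<le> Suc (r (Suc i))"
        using r by (auto simp: hstrip_def vstrip_def)
      then show False using i by linarith
    qed
    moreover have "k \<noteq> m" using i ypart_mono_Suc[OF m, of i] by auto
    ultimately show ?thesis unfolding A_def by (simp only:) simp
  qed
qed

text \<open>The series with \<open>- t\<close> substituted for \<open>t\<close>.\<close>

definition fps_alt :: "'a :: comm_ring_1 fps \<Rightarrow> 'a fps" where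
  "fps_alt c = Abs_fps (\<lambda>n. (- 1) ^ n * fps_nth c n)"

text \<open>The Pieri rule for the complete symmetric functions, whose generating series is
  \<open>1 / c(- t)\<close> if \<open>c\<close> is that of the elementary ones. Writing it as a
  product avoids inverses over a general ring. It follows by inserting vertical strips after
  horizontal ones, where everything cancels except \<open>m\<close> itself.\<close>

lemma hstrips_gen:
  fixes c :: "'a :: comm_ring_1 fps"
  assumes "pieri \<phi> c" "ypart m"
  shows "Abs_fps (\<lambda>n. \<Sum>q\<in>hstrips n m. \<phi> q) * fps_alt c = fps_const (\<phi> m)"
proof (rule fps_ext)
  fix n
  define P where "P = {r. ypart r \<and> hstrip m r \<and> ysize r \<le> ysize m + n}"
  have P: "P = (\<Union>j\<le>n. hstrips j m)"
    unfolding P_def hstrips_def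
  proof (intro equalityI subsetI)
    fix r assume r: "r \<in> {r. ypart r \<and> hstrip m r \<and> ysize r \<le> ysize m + n}"
    then have "ysize m \<le> ysize r" using hstrip_ysize by auto
    then show "r \<in> (\<Union>j\<le>n. {q. ypart q \<and> hstrip m q \<and> ysize q = ysize m + j})"
      using r by (intro UN_I[of "ysize r - ysize m"]) auto
  qed auto
  have finP: "finite P" unfolding P using finite_hstrips by auto
  define B where "B = {k. ypart k \<and> ysize k = ysize m + n}"
  have finB: "finite B" unfolding B_def by (rule finite_yparts_size)
  have "fps_nth (Abs_fps (\<lambda>n. \<Sum>q\<in>hstrips n m. \<phi> q) * fps_alt c) n =
      (\<Sum>j\<le>n. \<Sum>r\<in>hstrips j m. \<phi> r * ((- 1) ^ (n - j) * fps_nth c (n - j)))"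
    by (simp add: fps_mult_nth fps_alt_def sum_distrib_right atLeast0AtMost)
  also have "\<dots> = (\<Sum>j\<le>n. \<Sum>r\<in>hstrips j m. \<Sum>k | k \<in> B \<and> vstrip r k. (- 1) ^ (ysize k - ysize r) * \<phi> k)"
  proof (intro sum.cong refl)
    fix j r assume j: "j \<in> {..n}" and r: "r \<in> hstrips j m"
    have eq: "vstrips (n - j) r = {k. k \<in> B \<and> vstrip r k}"
      using j r by (auto simp: vstrips_def B_def hstrips_def)
    have "\<phi> r * ((- 1) ^ (n - j) * fps_nth c (n - j)) = (- 1) ^ (n - j) * (\<Sum>k\<in>vstrips (n - j) r. \<phi> k)"
    proof -
      have "fps_nth c (n - j) * \<phi> r = (\<Sum>k\<in>vstrips (n - j) r. \<phi> k)"
        using assms r by (simp add: pieri_def hstrips_def)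
      then show ?thesis by (metis mult.commute mult.left_commute)
    qed
    also have "\<dots> = (\<Sum>k | k \<in> B \<and> vstrip r k. (- 1) ^ (ysize k - ysize r) * \<phi> k)"
      unfolding eq sum_distrib_left using j r
      by (intro sum.cong refl) (auto simp: B_def hstrips_def)
    finally show "\<phi> r * ((- 1) ^ (n - j) * fps_nth c (n - j)) = \<dots>" .
  qed
  also have "\<dots> = (\<Sum>r\<in>P. \<Sum>k | k \<in> B \<and> vstrip r k. (- 1) ^ (ysize k - ysize r) * \<phi> k)"
    unfolding P by (rule sum.UNION_disjoint[symmetric]) (auto simp: hstrips_def intro: finite_hstrips[unfolded hstrips_def])
  also have "\<dots> = (\<Sum>k\<in>B. \<Sum>r | r \<in> P \<and> vstrip r k. (- 1) ^ (ysize k - ysize r) * \<phi> k)"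
    by (rule sum.swap_restrict[OF finP finB])
  also have "\<dots> = (\<Sum>k\<in>B. of_bool (k = m) * \<phi> k)"
  proof (intro sum.cong refl)
    fix k assume k: "k \<in> B"
    have eq: "{r. r \<in> P \<and> vstrip r k} = {r. ypart r \<and> hstrip m r \<and> vstrip r k}"
      using k ysize_mono[of k] by (auto simp: P_def B_def vstrip_def)
    have "(\<Sum>r | r \<in> P \<and> vstrip r k. (- 1 :: 'a) ^ (ysize k - ysize r)) =
        of_int (\<Sum>r | ypart r \<and> hstrip m r \<and> vstrip r k. (- 1) ^ (ysize k - ysize r))"
      unfolding eq by simp
    also have "\<dots> = of_bool (k = m)"
      using hstrip_vstrip_cancel[OF assms(2), of k] k by (simp add: B_def)
    finally show "(\<Sum>r | r \<in> P \<and> vstrip r k. (- 1) ^ (ysize k - ysize r) * \<phi> k) = of_bool (k = m) * \<phi> k"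
      by (simp flip: sum_distrib_right)
  qed
  also have "\<dots> = fps_nth (fps_const (\<phi> m)) n"
  proof (cases "n = 0")
    case True
    then have "m \<in> B" using assms(2) by (simp add: B_def)
    then show ?thesis using True finB by (simp add: if_distrib[of "\<lambda>x. x * _"] of_bool_def sum.delta cong: if_cong)
  next
    case False
    then have "k \<noteq> m" if "k \<in> B" for k using that by (auto simp: B_def)
    then show ?thesis using False by simp
  qed
  finally show "fps_nth (Abs_fps (\<lambda>n. \<Sum>q\<in>hstrips n m. \<phi> q) * fps_alt c) n = \<dots>" .
qed

definition yconj :: "(nat \<Rightarrow> nat) \<Rightarrow> nat \<Rightarrow> nat" where
  "yconj p = (\<lambda>j. card {i. j < p i})"

text \<open>The rows longer than \<open>j\<close> form an initial segment. This adjunction is the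
  source of the other facts about conjugation.\<close>

lemma less_yconj_iff: "ypart p \<Longrightarrow> i < yconj p j \<longleftrightarrow> j < p i"
proof -
  assume p: "ypart p"
  obtain N where N: "p N \<le> j" using p unfolding ypart_def by (metis le0)
  define L where "L = (LEAST n. p n \<le> j)"
  have L: "p L \<le> j" unfolding L_def using N by (rule LeastI)
  have "{i. j < p i} = {..<L}"
  proof (intro equalityI subsetI)
    fix i assume "i \<in> {i. j < p i}"
    then show "i \<in> {..<L}" using ypart_mono[OF p, of L i] L by (cases "i < L") auto
  next
    fix i assume "i \<in> {..<L}"
    then show "i \<in> {i. j < p i}" using not_less_Least[of i "\<lambda>n. p n \<le> j"] unfolding L_def by auto
  qed
  then show ?thesis by (auto simp: yconj_def set_eq_iff)
qed

lemma ypart_yconj: "ypart p \<Longrightarrow> ypart (yconj p)"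
proof (rule ypartI)
  assume p: "ypart p"
  show "yconj p (Suc i) \<le> yconj p i" for i
    using less_yconj_iff[OF p, of "yconj p i" "Suc i"] less_yconj_iff[OF p, of "yconj p i" i]
    by (auto simp: not_less[symmetric])
  have "p i \<le> p 0" for i using ypart_mono[OF p] by simp
  then have "{i. p 0 < p i} = {}" by (auto simp: not_less)
  then show "yconj p (p 0) = 0" unfolding yconj_def by (metis card.empty)
qed

lemma cells_yconj: "ypart p \<Longrightarrow> cells (yconj p) = prod.swap ` cells p"
  by (auto simp: cells_def less_yconj_iff image_iff)

lemma ysize_yconj: "ypart p \<Longrightarrow> ysize (yconj p) = ysize p"
  by (simp add: ysize_def cells_yconj card_image)

lemma yconj_yconj: "ypart p \<Longrightarrow> yconj (yconj p) = p"
  using less_yconj_iff[OF ypart_yconj] less_yconj_iff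
  by (metis (no_types, lifting) ext nat_neq_iff)

lemma yconj_zero [simp]: "yconj (\<lambda>_. 0) = (\<lambda>_. 0)"
  by (simp add: yconj_def)

lemma le_yconj_iff: "ypart p \<Longrightarrow> yconj p j \<le> i \<longleftrightarrow> p i \<le> j"
  using less_yconj_iff[of p i j] by (auto simp: not_less[symmetric])

lemma yconj_mono_iff:
  assumes "ypart p" "ypart q"
  shows "(\<forall>i. p i \<le> q i) \<longleftrightarrow> (\<forall>j. yconj p j \<le> yconj q j)"
  by (metis assms le_refl le_trans le_yconj_iff)

text \<open>Reflection in the diagonal turns at most one new cell per row into at most one new cell
  per column.\<close>

lemma hstrip_yconj:
  assumes p: "ypart p" and q: "ypart q"
  shows "hstrip (yconj p) (yconj q) \<longleftrightarrow> vstrip p q"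
proof -
  have "(\<forall>j. yconj q (Suc j) \<le> yconj p j) \<longleftrightarrow> (\<forall>i. q i \<le> Suc (p i))"
  proof
    assume a: "\<forall>j. yconj q (Suc j) \<le> yconj p j"
    show "\<forall>i. q i \<le> Suc (p i)"
    proof
      fix i
      have "yconj p (p i) \<le> i" using le_yconj_iff[OF p] by simp
      then have "yconj q (Suc (p i)) \<le> i" using a le_trans by blast
      then show "q i \<le> Suc (p i)" using le_yconj_iff[OF q] by simp
    qed
  next
    assume a: "\<forall>i. q i \<le> Suc (p i)"
    show "\<forall>j. yconj q (Suc j) \<le> yconj p j"
    proof
      fix j
      have "p (yconj p j) \<le> j" using le_yconj_iff[OF p] by blast
      then have "q (yconj p j) \<le> Suc j" using a le_trans Suc_le_mono by blast
      then show "yconj q (Suc j) \<le> yconj p j" using le_yconj_iff[OF q] by simp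
    qed
  qed
  then show ?thesis using yconj_mono_iff[OF p q] by (auto simp: hstrip_def vstrip_def)
qed

text \<open>The involution that exchanges elementary and complete symmetric functions:
  \<open>c(t)\<close> becomes \<open>1 / c(- t)\<close>. In particular a factor
  \<open>1 + \<beta> t\<close> becomes \<open>1 / (1 - \<beta> t)\<close>.\<close>

lemma pieri_yconj:
  fixes c :: "'a :: comm_ring_1 fps"
  assumes "pieri \<phi> c" "h * fps_alt c = 1"
  shows "pieri (\<lambda>p. \<phi> (yconj p)) h"
  unfolding pieri_def
proof (intro conjI allI impI)
  show "\<phi> (yconj (\<lambda>_. 0)) = 1" using assms by (simp add: pieri_def)
  fix p :: "nat \<Rightarrow> nat" and n assume p: "ypart p"
  have bij: "bij_betw yconj (vstrips n p) (hstrips n (yconj p))"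
  proof (rule bij_betw_byWitness[where f' = yconj])
    show "\<forall>q\<in>vstrips n p. yconj (yconj q) = q" by (auto simp: vstrips_def yconj_yconj)
    show "\<forall>q\<in>hstrips n (yconj p). yconj (yconj q) = q" by (auto simp: hstrips_def yconj_yconj)
    show "yconj ` vstrips n p \<subseteq> hstrips n (yconj p)"
      using p by (auto simp: vstrips_def hstrips_def ypart_yconj ysize_yconj hstrip_yconj)
    show "yconj ` hstrips n (yconj p) \<subseteq> vstrips n p"
    proof
      fix r assume "r \<in> yconj ` hstrips n (yconj p)"
      then obtain q where q: "r = yconj q" "q \<in> hstrips n (yconj p)" by auto
      then have y: "ypart q" by (simp add: hstrips_def)
      have "vstrip p r" using hstrip_yconj[OF p ypart_yconj[OF y]] q y by (simp add: yconj_yconj hstrips_def)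
      then show "r \<in> vstrips n p" using q p by (auto simp: vstrips_def hstrips_def ypart_yconj ysize_yconj)
    qed
  qed
  let ?H = "Abs_fps (\<lambda>n. \<Sum>q\<in>hstrips n (yconj p). \<phi> q)"
  have "?H = ?H * fps_alt c * h" using assms(2) by (simp add: mult.assoc mult.commute[of "fps_alt c" h])
  also have "\<dots> = fps_const (\<phi> (yconj p)) * h"
    by (simp only: hstrips_gen[OF assms(1) ypart_yconj[OF p]])
  finally have "fps_nth ?H n = fps_nth (fps_const (\<phi> (yconj p)) * h) n" by simp
  then have "fps_nth h n * \<phi> (yconj p) = (\<Sum>q\<in>hstrips n (yconj p). \<phi> q)" by (simp add: mult.commute)
  also have "\<dots> = (\<Sum>q\<in>vstrips n p. \<phi> (yconj q))" by (rule sum.reindex_bij_betw[OF bij, symmetric])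
  finally show "fps_nth h n * \<phi> (yconj p) = \<dots>" .
qed

section \<open>Schur functions\<close>

lemma vstrips_of_zero: "vstrips n (\<lambda>_. 0) = {addv (\<lambda>_. 0) {..<n}}"
proof -
  have "q = addv (\<lambda>_. 0) {..<n}" if q: "q \<in> vstrips n (\<lambda>_. 0)" for q
  proof (rule ccontr)
    assume "q \<noteq> addv (\<lambda>_. 0) {..<n}"
    then have "q n \<noteq> 0" by (rule vstrips_other[OF ypart_zero q])
    then have "n < ysize q" using q by (intro ysize_gt_length) (auto simp: vstrips_def)
    then show False using q by (simp add: vstrips_def)
  qed
  moreover have "addv (\<lambda>_. 0) {..<n} \<in> vstrips n (\<lambda>_. 0)" by (rule addv_initial_in_vstrips) auto
  ultimately show ?thesis by blast
qed

lemma pieri_nth: "pieri \<phi> c \<Longrightarrow> fps_nth c n = \<phi> (addv (\<lambda>_. 0) {..<n})"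
proof -
  assume p: "pieri \<phi> c"
  then have "fps_nth c n * \<phi> (\<lambda>_. 0) = (\<Sum>q\<in>vstrips n (\<lambda>_. 0). \<phi> q)"
    using ypart_zero unfolding pieri_def by blast
  with p show ?thesis by (simp add: vstrips_of_zero pieri_def)
qed

section \<open>Monomials as power series\<close>

definition xmon :: "nat multiset \<Rightarrow> xseries" where
  "xmon A = Abs_xseries (\<lambda>M. of_bool (M = A))"

lemma xcoeff_Abs [simp]: "xcoeff (Abs_xseries f) = f"
  by (simp add: Abs_xseries_inverse)

lemma xcoeff_xmon: "xcoeff (xmon A) M = of_bool (M = A)"
  by (simp add: xmon_def)

lemma xcoeff_mult: "xcoeff (f * g) M = (\<Sum>N | N \<subseteq># M. xcoeff f N * xcoeff g (M - N))"
  by transfer simp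

lemma xcoeff_add: "xcoeff (f + g) M = xcoeff f M + xcoeff g M"
  by transfer simp

lemma xcoeff_0: "xcoeff 0 M = 0"
  by transfer simp

lemma xcoeff_1: "xcoeff 1 M = of_bool (M = {#})"
  by transfer simp

lemma xcoeff_sum: "xcoeff (\<Sum>i\<in>A. f i) M = (\<Sum>i\<in>A. xcoeff (f i) M)"
  by (induction A rule: infinite_finite_induct) (auto simp: xcoeff_add xcoeff_0)

lemma xcoeff_of_int_mult: "xcoeff (of_int k * f) M = k * xcoeff f M"
proof -
  have nat: "xcoeff (of_nat n * f) M = int n * xcoeff f M" for n
    by (induction n) (auto simp: xcoeff_0 xcoeff_add algebra_simps)
  have minus: "xcoeff (- g) M = - xcoeff g M" for g by transfer simp
  show ?thesis
  proof (cases k)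
    case (neg n)
    then have "of_int k * f = - (of_nat (Suc n) * f)"
      by (simp only: of_int_minus of_int_of_nat_eq mult_minus_left)
    then show ?thesis unfolding neg(1)
      by (simp only: minus nat mult_minus_left)
  qed (simp add: nat)
qed

lemma xmon_add: "xmon (A + B) = xmon A * xmon B"
proof (rule xseries_eqI)
  fix M
  have "xcoeff (xmon A * xmon B) M = (\<Sum>N | N \<subseteq># M. if N = A then of_bool (M - A = B) else 0)"
    unfolding xcoeff_mult by (intro sum.cong refl) (auto simp: xcoeff_xmon)
  also have "\<dots> = of_bool (A \<subseteq># M \<and> M - A = B)"
    by (simp add: sum.delta[OF finite_submultisets])
  also have "A \<subseteq># M \<and> M - A = B \<longleftrightarrow> M = A + B"
    by auto
  finally show "xcoeff (xmon (A + B)) M = xcoeff (xmon A * xmon B) M" by (simp add: xcoeff_xmon)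
qed

lemma xmon_empty: "xmon {#} = 1"
  by (rule xseries_eqI) (simp add: xcoeff_xmon xcoeff_1)

lemma xmon_replicate: "xmon (replicate_mset n i) = xmon {#i#} ^ n"
proof (induction n)
  case (Suc n)
  have "xmon (replicate_mset (Suc n) i) = xmon ({#i#} + replicate_mset n i)" by simp
  then show ?case using Suc by (simp only: xmon_add power_Suc)
qed (simp add: xmon_empty)

section \<open>Tableaux and Schur polynomials, one variable at a time\<close>

definition tableaux :: "(nat \<Rightarrow> nat) \<Rightarrow> (nat \<times> nat \<Rightarrow> nat) set" where
  "tableaux p = {T \<in> extensional (cells p).
     (\<forall>i j. (i, Suc j) \<in> cells p \<longrightarrow> T (i, j) \<le> T (i, Suc j)) \<and>
     (\<forall>i j. (Suc i, j) \<in> cells p \<longrightarrow> T (i, j) < T (Suc i, j))}"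

definition tcontent :: "(nat \<Rightarrow> nat) \<Rightarrow> (nat \<times> nat \<Rightarrow> nat) \<Rightarrow> nat multiset" where
  "tcontent p T = image_mset T (mset_set (cells p))"

text \<open>Bounding the entries by \<open>N\<close> means setting all variables except the first
  \<open>N\<close> to zero; a partition then has only finitely many tableaux, and
  \<open>bschur\<close> is a finite sum.\<close>

definition btableaux :: "nat \<Rightarrow> (nat \<Rightarrow> nat) \<Rightarrow> (nat \<times> nat \<Rightarrow> nat) set" where
  "btableaux N p = {T \<in> tableaux p. \<forall>x\<in>cells p. T x < N}"

definition bschur :: "nat \<Rightarrow> (nat \<Rightarrow> nat) \<Rightarrow> xseries" where
  "bschur N p = (\<Sum>T\<in>btableaux N p. xmon (tcontent p T))"

lemma finite_btableaux: "ypart p \<Longrightarrow> finite (btableaux N p)"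
  by (rule finite_subset[of _ "PiE (cells p) (\<lambda>_. {..<N})"])
    (simp_all add: btableaux_def tableaux_def PiE_iff subset_iff finite_PiE finite_cells)

lemma tableaux_row_mono:
  assumes "T \<in> tableaux p" "(i, j') \<in> cells p" "j \<le> j'"
  shows "T (i, j) \<le> T (i, j')"
  using assms(3,2)
proof (induction j' rule: dec_induct)
  case (step n)
  then have "T (i, n) \<le> T (i, Suc n)" using assms(1) by (auto simp: tableaux_def)
  moreover have "(i, n) \<in> cells p" using step by (auto simp: cells_def)
  ultimately show ?case using step by auto
qed simp

lemma mem_cells_iff [simp]: "(i, j) \<in> cells p \<longleftrightarrow> j < p i"
  by (simp add: cells_def)

text \<open>The entries below \<open>N\<close> fill a smaller partition, and the cells with the
  largest possible entry \<open>N\<close> form a horizontal strip because the columns increase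
  strictly. Conversely such a strip can be filled with \<open>N\<close> in one way.\<close>

lemma bij_btableaux_Suc:
  fixes N :: nat
  assumes p: "ypart p"
  defines "sh \<equiv> \<lambda>T i. card {j. j < p i \<and> T (i, j) < N}"
  shows "bij_betw (\<lambda>T. (sh T, restrict T (cells (sh T)))) (btableaux (Suc N) p)
    (SIGMA q:{q. ypart q \<and> hstrip q p}. btableaux N q)"
proof -
  let ?ext = "\<lambda>(q, T) x. if x \<in> cells q then T x else if x \<in> cells p then N else undefined"
  have sh_iff: "j < sh T i \<longleftrightarrow> j < p i \<and> T (i, j) < N" if T: "T \<in> tableaux p" for T i j
  proof -
    define A where "A = {j. j < p i \<and> T (i, j) < N}"
    have down: "j \<in> A" if "j' \<in> A" "j \<le> j'" for j j'
      using that tableaux_row_mono[OF T, of i j' j] by (auto simp: A_def)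
    have fin: "finite A" unfolding A_def by simp
    have "A = {..<card A}"
    proof -
      have "\<exists>n. A = {..<n}"
      proof (cases "A = {}")
        case False
        have "A = {..<Suc (Max A)}"
          using down[OF Max_in[OF fin False]] Max_ge[OF fin] by (auto simp: less_Suc_eq_le)
        then show ?thesis ..
      qed (auto intro: exI[of _ 0])
      then show ?thesis by auto
    qed
    then have "j < card A \<longleftrightarrow> j \<in> A" by auto
    then show ?thesis by (simp add: sh_def A_def)
  qed
  have csh: "cells (sh T) = {x \<in> cells p. T x < N}" if T: "T \<in> tableaux p" for T
    using sh_iff[OF T] by auto
  show ?thesis
  proof (rule bij_betw_byWitness[where f' = ?ext])
    show "\<forall>T\<in>btableaux (Suc N) p. ?ext (sh T, restrict T (cells (sh T))) = T"
    proof
      fix T assume T: "T \<in> btableaux (Suc N) p"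
      then have T': "T \<in> tableaux p" by (simp add: btableaux_def)
      have "(if x \<in> cells (sh T) then restrict T (cells (sh T)) x else if x \<in> cells p then N else undefined) = T x" for x
      proof (cases "x \<in> cells p")
        case True
        then have "T x < Suc N" using T unfolding btableaux_def by blast
        then show ?thesis using True by (cases "T x < N") (simp_all add: csh[OF T'])
      next
        case False
        have "T \<in> extensional (cells p)" using T' by (simp add: tableaux_def)
        from extensional_arb[OF this False] show ?thesis using False by (simp add: csh[OF T'])
      qed
      then show "?ext (sh T, restrict T (cells (sh T))) = T" by (simp add: fun_eq_iff)
    qed
    show "\<forall>x\<in>(SIGMA q:{q. ypart q \<and> hstrip q p}. btableaux N q). (sh (?ext x), restrict (?ext x) (cells (sh (?ext x)))) = x"
    proof
      fix x assume "x \<in> (SIGMA q:{q. ypart q \<and> hstrip q p}. btableaux N q)"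
      then obtain q T where x: "x = (q, T)" and q: "ypart q" "hstrip q p" and T: "T \<in> btableaux N q" by auto
      have "{j. j < p i \<and> ?ext (q, T) (i, j) < N} = {..<q i}" for i
        using q T by (auto simp: btableaux_def hstrip_def cells_def intro: less_le_trans)
      then have "sh (?ext x) = q" unfolding sh_def x by simp
      moreover have "restrict (?ext x) (cells q) = T"
        using T unfolding x by (auto simp: btableaux_def tableaux_def extensional_def restrict_def)
      ultimately show "(sh (?ext x), restrict (?ext x) (cells (sh (?ext x)))) = x" by (simp add: x)
    qed
    show "(\<lambda>T. (sh T, restrict T (cells (sh T)))) ` btableaux (Suc N) p \<subseteq> (SIGMA q:{q. ypart q \<and> hstrip q p}. btableaux N q)"
    proof
      fix x assume "x \<in> (\<lambda>T. (sh T, restrict T (cells (sh T)))) ` btableaux (Suc N) p"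
      then obtain T where T: "T \<in> btableaux (Suc N) p" and x: "x = (sh T, restrict T (cells (sh T)))" by auto
      then have T': "T \<in> tableaux p" by (simp add: btableaux_def)
      have h: "hstrip (sh T) p"
        unfolding hstrip_def
      proof (intro allI conjI)
        fix i
        show "sh T i \<le> p i" using sh_iff[OF T', of "p i" i] by (simp add: not_less[symmetric])
        show "p (Suc i) \<le> sh T i"
        proof (rule ccontr)
          assume "\<not> p (Suc i) \<le> sh T i"
          then have l: "sh T i < p (Suc i)" by simp
          then have "T (i, sh T i) < T (Suc i, sh T i)" using T' by (simp add: tableaux_def)
          moreover have "T (Suc i, sh T i) < Suc N" using T l by (auto simp: btableaux_def)
          ultimately have "T (i, sh T i) < N" by simp
          moreover have "sh T i < p i" using l ypart_mono_Suc[OF p, of i] by simp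
          ultimately show False using sh_iff[OF T', of "sh T i" i] by simp
        qed
      qed
      obtain M where "p M = 0" using p by (auto simp: ypart_def)
      then have "sh T M = 0" by (simp add: sh_def)
      then have y: "ypart (sh T)" using h
        by (intro ypartI[of _ M]) (auto simp: hstrip_def intro: le_trans[of _ "p (Suc _)"])
      have dn: "(i, j) \<in> cells (sh T)" if "(i, Suc j) \<in> cells (sh T)" for i j using that by simp
      have up: "(i, j) \<in> cells (sh T)" if "(Suc i, j) \<in> cells (sh T)" for i j
        using that ypart_mono_Suc[OF y, of i] by simp
      have sub: "cells (sh T) \<subseteq> cells p" using csh[OF T'] by auto
      have "restrict T (cells (sh T)) \<in> tableaux (sh T)"
        unfolding tableaux_def
      proof (intro CollectI conjI allI impI)
        fix i j assume a: "(i, Suc j) \<in> cells (sh T)"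
        then have "(i, Suc j) \<in> cells p" using sub by blast
        with T' have "T (i, j) \<le> T (i, Suc j)" by (simp add: tableaux_def)
        then show "restrict T (cells (sh T)) (i, j) \<le> restrict T (cells (sh T)) (i, Suc j)"
          using a dn[OF a] by (simp only: restrict_apply if_True)
      next
        fix i j assume a: "(Suc i, j) \<in> cells (sh T)"
        then have "(Suc i, j) \<in> cells p" using sub by blast
        with T' have "T (i, j) < T (Suc i, j)" by (simp add: tableaux_def)
        then show "restrict T (cells (sh T)) (i, j) < restrict T (cells (sh T)) (Suc i, j)"
          using a up[OF a] by (simp only: restrict_apply if_True)
      qed simp
      then have "restrict T (cells (sh T)) \<in> btableaux N (sh T)"
        using csh[OF T'] by (auto simp: btableaux_def)
      then show "x \<in> (SIGMA q:{q. ypart q \<and> hstrip q p}. btableaux N q)" using h y x by simp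
    qed
    show "?ext ` (SIGMA q:{q. ypart q \<and> hstrip q p}. btableaux N q) \<subseteq> btableaux (Suc N) p"
    proof
      fix U assume "U \<in> ?ext ` (SIGMA q:{q. ypart q \<and> hstrip q p}. btableaux N q)"
      then obtain q T where U: "U = ?ext (q, T)" and q: "ypart q" "hstrip q p" and T: "T \<in> btableaux N q" by auto
      have T1: "T (i, j) \<le> T (i, Suc j)" if "Suc j < q i" for i j
        using T that by (simp add: btableaux_def tableaux_def)
      have T2: "T (i, j) < T (Suc i, j)" if "j < q (Suc i)" for i j
        using T that by (simp add: btableaux_def tableaux_def)
      have T3: "T (i, j) < N" if "j < q i" for i j
        using T that by (auto simp: btableaux_def)
      have qp: "q i \<le> p i" "p (Suc i) \<le> q i" "q (Suc i) \<le> q i" for i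
        using q ypart_mono_Suc by (auto simp: hstrip_def)
      have "U \<in> extensional (cells p)"
      proof -
        have "cells q \<subseteq> cells p" using less_le_trans[OF _ qp(1)] by (auto simp: cells_def)
        then show ?thesis unfolding U extensional_def by (auto dest: less_le_trans[OF _ qp(1)])
      qed
      moreover have "U (i, j) \<le> U (i, Suc j)" if "Suc j < p i" for i j
        using that T1[of j i] T3[of j i] by (auto simp: U)
      moreover have "U (i, j) < U (Suc i, j)" if j: "j < p (Suc i)" for i j
        using j qp[of i] T2[of j i] T3[of j i] by (auto simp: U)
      moreover have "U x < Suc N" if "x \<in> cells p" for x
        using that T3 by (cases x) (auto simp: U less_Suc_eq)
      ultimately show "U \<in> btableaux (Suc N) p"
        by (simp add: btableaux_def tableaux_def)
    qed
  qed
qed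

text \<open>The branching rule. It presents Schur polynomials as iterated \<open>hstep\<close> and
  thereby transfers the Pieri rule to them.\<close>

lemma bschur_Suc:
  assumes p: "ypart p"
  shows "bschur (Suc N) p = hstep (xmon {#N#}) (bschur N) p"
proof -
  define sh where "sh = (\<lambda>T i. card {j. j < p i \<and> T (i, j) < N})"
  let ?f = "\<lambda>(q, T). xmon {#N#} ^ (ysize p - ysize q) * xmon (tcontent q T)"
  have bij: "bij_betw (\<lambda>T. (sh T, restrict T (cells (sh T)))) (btableaux (Suc N) p)
    (SIGMA q:{q. ypart q \<and> hstrip q p}. btableaux N q)"
    unfolding sh_def by (rule bij_btableaux_Suc[OF p])
  have "hstep (xmon {#N#}) (bschur N) p = (\<Sum>x\<in>(SIGMA q:{q. ypart q \<and> hstrip q p}. btableaux N q). ?f x)"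
    unfolding hstep_def bschur_def sum_distrib_left
    by (subst sum.Sigma) (auto intro: finite_hstrip_below[OF p] finite_btableaux)
  also have "\<dots> = (\<Sum>T\<in>btableaux (Suc N) p. ?f (sh T, restrict T (cells (sh T))))"
    by (rule sum.reindex_bij_betw[OF bij, symmetric])
  also have "\<dots> = bschur (Suc N) p"
    unfolding bschur_def
  proof (intro sum.cong refl)
    fix T assume T: "T \<in> btableaux (Suc N) p"
    define q where "q = sh T"
    define U where "U = restrict T (cells q)"
    have "(q, U) \<in> (SIGMA q:{q. ypart q \<and> hstrip q p}. btableaux N q)"
      using bij_betw_apply[OF bij T] by (simp add: q_def U_def)
    then have q: "ypart q" "hstrip q p" and U: "U \<in> btableaux N q" by auto
    have sub: "cells q \<subseteq> cells p" using q by (auto simp: cells_def hstrip_def intro: less_le_trans)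
    have fin: "finite (cells p)" "finite (cells q)" using finite_cells p q by auto
    have N: "T x = N" if "x \<in> cells p - cells q" for x
    proof -
      obtain i j where x: "x = (i, j)" by (cases x)
      have "\<not> T (i, j) < N"
      proof
        assume l: "T (i, j) < N"
        have "{..j} \<subseteq> {j. j < p i \<and> T (i, j) < N}"
          using that l tableaux_row_mono[of T p i j] T x by (auto simp: btableaux_def intro: le_less_trans)
        then have "card {..j} \<le> card {j. j < p i \<and> T (i, j) < N}" by (intro card_mono) auto
        then have "j < q i" by (simp add: q_def sh_def)
        then show False using that x by simp
      qed
      moreover have "T x < Suc N" using T that by (auto simp: btableaux_def)
      ultimately show ?thesis using x by simp
    qed
    have "mset_set (cells p) = mset_set (cells q) + mset_set (cells p - cells q)"
      using mset_set_Union[of "cells q" "cells p - cells q"] fin sub by (simp add: Un_absorb1)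
    then have "tcontent p T = image_mset T (mset_set (cells q)) + image_mset T (mset_set (cells p - cells q))"
      by (simp add: tcontent_def)
    also have "image_mset T (mset_set (cells q)) = tcontent q U"
      unfolding tcontent_def U_def using fin by (intro image_mset_cong) auto
    also have "image_mset T (mset_set (cells p - cells q)) = image_mset (\<lambda>_. N) (mset_set (cells p - cells q))"
      using fin N by (intro image_mset_cong) auto
    also have "\<dots> = replicate_mset (ysize p - ysize q) N"
      using fin sub by (simp add: image_mset_const_eq ysize_def card_Diff_subset)
    finally have "xmon (tcontent p T) = xmon {#N#} ^ (ysize p - ysize q) * xmon (tcontent q U)"
      by (simp only: xmon_add xmon_replicate mult.commute)
    then show "?f (sh T, restrict T (cells (sh T))) = xmon (tcontent p T)"
      by (simp add: q_def U_def)
  qed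
  finally show ?thesis by simp
qed

lemma pieri_bschur_0: "pieri (bschur 0) 1"
proof -
  have *: "bschur 0 p = of_bool (p = (\<lambda>_. 0))" for p
  proof (cases "p = (\<lambda>_. 0)")
    case True
    then have c: "cells p = {}" by (auto simp: cells_def)
    have "btableaux 0 p = {\<lambda>_. undefined}" unfolding btableaux_def tableaux_def c by auto
    then show ?thesis using True by (simp add: bschur_def tcontent_def c[unfolded True] xmon_empty)
  next
    case False
    then obtain i where "p i > 0" by auto
    then have "(i, 0) \<in> cells p" by simp
    then have "btableaux 0 p = {}" unfolding btableaux_def by blast
    then show ?thesis using False by (simp add: bschur_def)
  qed
  show ?thesis
    unfolding pieri_def
  proof (intro conjI allI impI)
    fix p :: "nat \<Rightarrow> nat" and n assume p: "ypart p"
    show "fps_nth 1 n * bschur 0 p = (\<Sum>q\<in>vstrips n p. bschur 0 q)"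
    proof (cases "n = 0")
      case False
      then have "q \<noteq> (\<lambda>_. 0)" if "q \<in> vstrips n p" for q using that by (auto simp: vstrips_def)
      then show ?thesis using False by (simp add: *)
    qed (simp add: vstrips_0[OF p])
  qed (simp add: *)
qed

lemma pieri_cong:
  assumes "pieri \<phi> c" "\<And>p. ypart p \<Longrightarrow> \<phi> p = \<psi> p"
  shows "pieri \<psi> c"
  unfolding pieri_def
proof (intro conjI allI impI)
  show "\<psi> (\<lambda>_. 0) = 1" using assms(1) assms(2)[OF ypart_zero] by (simp add: pieri_def)
  fix p :: "nat \<Rightarrow> nat" and n assume p: "ypart p"
  have "(\<Sum>q\<in>vstrips n p. \<phi> q) = (\<Sum>q\<in>vstrips n p. \<psi> q)"
    using assms(2) by (intro sum.cong) (auto simp: vstrips_def)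
  then show "fps_nth c n * \<psi> p = (\<Sum>q\<in>vstrips n p. \<psi> q)" using assms p by (simp add: pieri_def)
qed

lemma ex_pieri_bschur: "\<exists>c. pieri (bschur N) c"
proof (induction N)
  case (Suc N)
  then obtain c where "pieri (bschur N) c" by blast
  from pieri_cong[OF pieri_hstep[OF this]] show ?case using bschur_Suc by metis
qed (use pieri_bschur_0 in blast)

definition yschur :: "(nat \<Rightarrow> nat) \<Rightarrow> xseries" where
  "yschur p = Abs_xseries (\<lambda>M. int (card {T \<in> tableaux p. tcontent p T = M}))"

lemma btableaux_content:
  assumes "ypart p" "set_mset M \<subseteq> {..<N}"
  shows "{T \<in> tableaux p. tcontent p T = M} = {T \<in> btableaux N p. tcontent p T = M}"
proof -
  have "T x < N" if "tcontent p T = M" "x \<in> cells p" for T x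
  proof -
    have "T x \<in># tcontent p T" using that(2) finite_cells[OF assms(1)] by (simp add: tcontent_def)
    then show ?thesis using assms(2) that(1) by auto
  qed
  then show ?thesis by (auto simp: btableaux_def)
qed

lemma xcoeff_bschur:
  assumes "ypart p"
  shows "xcoeff (bschur N p) M = int (card {T \<in> btableaux N p. tcontent p T = M})"
proof -
  have "xcoeff (bschur N p) M = (\<Sum>T\<in>btableaux N p. of_bool (tcontent p T = M))"
    unfolding bschur_def xcoeff_sum xcoeff_xmon by (intro sum.cong) auto
  also have "\<dots> = int (card {T \<in> btableaux N p. tcontent p T = M})"
    using finite_btableaux[OF assms] by (simp add: of_bool_def sum.If_cases Int_def)
  finally show ?thesis .
qed

lemma xcoeff_yschur:
  assumes "ypart p" "set_mset M \<subseteq> {..<N}"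
  shows "xcoeff (yschur p) M = xcoeff (bschur N p) M"
  by (simp add: yschur_def xcoeff_bschur[OF assms(1)] btableaux_content[OF assms])

lemma ypart_column: "ypart (addv (\<lambda>_. 0) {..<n})"
  by (rule ypart_addv_initial) auto

text \<open>The coefficient of a monomial involves only the variables that divide it, so the rule
  for power series reduces to the one for polynomials in sufficiently many variables.\<close>

theorem pieri_yschur: "pieri yschur (Abs_fps (\<lambda>n. yschur (addv (\<lambda>_. 0) {..<n})))"
  unfolding pieri_def
proof (intro conjI allI impI)
  have c: "cells (\<lambda>_. 0) = {}" by (auto simp: cells_def)
  have "tableaux (\<lambda>_. 0) = {\<lambda>_. undefined}" by (auto simp: tableaux_def c)
  then have "{T \<in> tableaux (\<lambda>_. 0). tcontent (\<lambda>_. 0) T = M} = (if M = {#} then {\<lambda>_. undefined} else {})" for M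
    by (auto simp: tcontent_def c)
  then show "yschur (\<lambda>_. 0) = 1"
    by (intro xseries_eqI) (simp add: yschur_def xcoeff_1)
next
  fix p :: "nat \<Rightarrow> nat" and n assume p: "ypart p"
  show "fps_nth (Abs_fps (\<lambda>n. yschur (addv (\<lambda>_. 0) {..<n}))) n * yschur p = (\<Sum>q\<in>vstrips n p. yschur q)"
  proof (rule xseries_eqI)
    fix M :: "nat multiset"
    obtain N where N: "set_mset M \<subseteq> {..<N}" using finite_nat_iff_bounded by blast
    obtain c where c: "pieri (bschur N) c" using ex_pieri_bschur by blast
    have sub: "set_mset A \<subseteq> {..<N}" if "A \<subseteq># M" for A using that N set_mset_mono by blast
    have "xcoeff (yschur (addv (\<lambda>_. 0) {..<n}) * yschur p) M =
        xcoeff (bschur N (addv (\<lambda>_. 0) {..<n}) * bschur N p) M"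
      unfolding xcoeff_mult
    proof (intro sum.cong refl)
      fix A assume A: "A \<in> {A. A \<subseteq># M}"
      have 1: "set_mset A \<subseteq> {..<N}" using A sub by blast
      have 2: "set_mset (M - A) \<subseteq> {..<N}" by (rule sub) simp
      show "xcoeff (yschur (addv (\<lambda>_. 0) {..<n})) A * xcoeff (yschur p) (M - A) =
          xcoeff (bschur N (addv (\<lambda>_. 0) {..<n})) A * xcoeff (bschur N p) (M - A)"
        by (simp only: xcoeff_yschur[OF ypart_column 1] xcoeff_yschur[OF p 2])
    qed
    also have "bschur N (addv (\<lambda>_. 0) {..<n}) * bschur N p = (\<Sum>q\<in>vstrips n p. bschur N q)"
      unfolding pieri_nth[OF c, of n, symmetric] using c p unfolding pieri_def by blast
    also have "xcoeff \<dots> M = xcoeff (\<Sum>q\<in>vstrips n p. yschur q) M"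
      unfolding xcoeff_sum using xcoeff_yschur[OF _ N] by (intro sum.cong) (auto simp: vstrips_def)
    finally show "xcoeff (fps_nth (Abs_fps (\<lambda>n. yschur (addv (\<lambda>_. 0) {..<n}))) n * yschur p) M = \<dots>" by simp
  qed
qed

section \<open>Partitions as lists and as functions\<close>

definition yfun :: "nat list \<Rightarrow> nat \<Rightarrow> nat" where
  "yfun l = (\<lambda>i. if i < length l then l ! i else 0)"

lemma cells_yfun: "cells (yfun l) = diagram l"
  by (auto simp: cells_def yfun_def diagram_def split: if_splits)

lemma yschur_yfun: "yschur (yfun l) = schur l"
  by (simp add: yschur_def schur_def tableaux_def ssyt_def tcontent_def tab_content_def cells_yfun)

lemma ypart_yfun: "l \<in> partitions \<Longrightarrow> ypart (yfun l)"
proof (rule ypartI)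
  assume l: "l \<in> partitions"
  show "yfun l (Suc i) \<le> yfun l i" for i
    using l by (auto simp: yfun_def partitions_def sorted_wrt_iff_nth_less)
  show "yfun l (length l) = 0" by (simp add: yfun_def)
qed

lemma yfun_replicate: "yfun (replicate n 1) = addv (\<lambda>_. 0) {..<n}"
  by (auto simp: yfun_def addv_def)

lemma yfun_image: "yfun ` partitions = {p. ypart p}"
proof (intro equalityI subsetI)
  fix p assume "p \<in> {p. ypart p}"
  then have p: "ypart p" by simp
  define n where "n = (LEAST n. p n = 0)"
  have pn: "p n = 0" unfolding n_def using p by (auto simp: ypart_def intro: LeastI)
  have gt: "p i > 0" if "i < n" for i using that not_less_Least unfolding n_def by blast
  have "p = yfun (map p [0..<n])" using ypart_vanish[OF p pn] by (auto simp: yfun_def)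
  moreover have "map p [0..<n] \<in> partitions"
    unfolding partitions_def sorted_wrt_iff_nth_less
  proof (intro CollectI conjI allI impI)
    fix i j assume "i < j" "j < length (map p [0..<n])"
    then show "map p [0..<n] ! j \<le> map p [0..<n] ! i" using ypart_mono[OF p, of i j] by simp
  next
    have "p i \<noteq> 0" if "i < n" for i using gt[OF that] by simp
    then show "0 \<notin> set (map p [0..<n])" by force
  qed
  ultimately show "p \<in> yfun ` partitions" by blast
qed (auto simp: ypart_yfun)

lemma inj_on_yfun: "inj_on yfun partitions"
proof (rule inj_onI)
  fix l l' assume l: "l \<in> partitions" "l' \<in> partitions" and eq: "yfun l = yfun l'"
  have len: "length l = card {i. yfun l i \<noteq> 0}" if "l \<in> partitions" for l
  proof -
    have "l ! i \<noteq> 0" if "i < length l" for i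
      using \<open>l \<in> partitions\<close> nth_mem[OF that] unfolding partitions_def by (metis (no_types, lifting) mem_Collect_eq)
    then have "{i. yfun l i \<noteq> 0} = {..<length l}" by (auto simp: yfun_def)
    then show ?thesis by simp
  qed
  have "length l = length l'" using len l eq by simp
  moreover have "l ! i = l' ! i" if "i < length l" for i
    using fun_cong[OF eq, of i] that \<open>length l = length l'\<close> by (simp add: yfun_def)
  ultimately show "l = l'" by (rule nth_equalityI)
qed

lemma elem_sym_yschur: "elem_sym n = yschur (addv (\<lambda>_. 0) {..<n})"
  by (simp only: schur_column[symmetric] yschur_yfun[symmetric] yfun_replicate)

section \<open>Linear independence of the Schur functions\<close>

lemma sum_ypart_cells: "finite A \<Longrightarrow> card (cells p \<inter> A \<times> UNIV) = (\<Sum>i\<in>A. p i)"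
proof -
  assume A: "finite A"
  have "cells p \<inter> A \<times> UNIV = (SIGMA i:A. {..<p i})" by (auto simp: cells_def)
  then show ?thesis using A by simp
qed

lemma count_tcontent:
  assumes "ypart p"
  shows "count (tcontent p T) i = card {x \<in> cells p. T x = i}"
  using finite_cells[OF assms]
  by (simp add: tcontent_def count_image_mset Int_def vimage_def conj_commute eq_commute)

lemma tableaux_ge_row:
  assumes "T \<in> tableaux p" "ypart p" "j < p i"
  shows "i \<le> T (i, j)"
  using assms(3)
proof (induction i)
  case (Suc i)
  then have "j < p i" using ypart_mono_Suc[OF assms(2), of i] by simp
  then have "i \<le> T (i, j)" using Suc by simp
  also have "T (i, j) < T (Suc i, j)" using assms(1) Suc by (simp add: tableaux_def)
  finally show ?case by simp
qed simp

text \<open>The monomial with exponent vector \<open>p\<close>, as the content of the filling of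
  each cell with its row number. The function \<open>fst\<close> is not extensional, but the content
  sees only its values on the cells.\<close>

definition row_content :: "(nat \<Rightarrow> nat) \<Rightarrow> nat multiset" where
  "row_content p = tcontent p fst"

text \<open>Entries below \<open>k\<close> of a tableau lie in the first \<open>k\<close> rows.\<close>

lemma dominance:
  assumes p: "ypart p" and q: "ypart q" and T: "T \<in> tableaux q" "tcontent q T = row_content p"
  shows "(\<Sum>i<k. p i) \<le> (\<Sum>i<k. q i)"
proof -
  have cnt: "p i = card {x \<in> cells q. T x = i}" for i
  proof -
    have "{x \<in> cells p. fst x = i} = {i} \<times> {..<p i}" by auto
    then have "count (row_content p) i = p i" by (simp add: row_content_def count_tcontent[OF p])
    then show ?thesis using count_tcontent[OF q, of T i] T(2) by simp
  qed
  have "(\<Sum>i<k. p i) = card (\<Union>i<k. {x \<in> cells q. T x = i})"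
    unfolding cnt by (subst card_UN_disjoint) (auto simp: finite_cells[OF q])
  also have "\<dots> \<le> card (cells q \<inter> {..<k} \<times> UNIV)"
  proof (rule card_mono)
    show "(\<Union>i<k. {x \<in> cells q. T x = i}) \<subseteq> cells q \<inter> {..<k} \<times> UNIV"
      using tableaux_ge_row[OF T(1) q] by (fastforce intro: le_less_trans)
  qed (simp add: finite_cells[OF q])
  also have "\<dots> = (\<Sum>i<k. q i)" by (rule sum_ypart_cells) simp
  finally show ?thesis .
qed

text \<open>An entry \<open>i\<close> cannot lie below row \<open>i\<close>, and by induction the
  rows above are already filled with smaller numbers. So the entries \<open>i\<close> fill exactly
  row \<open>i\<close>.\<close>

lemma yschur_row_content:
  assumes p: "ypart p"
  shows "xcoeff (yschur p) (row_content p) = 1"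
proof -
  let ?R = "restrict fst (cells p)"
  have R: "?R \<in> tableaux p"
    using ypart_mono_Suc[OF p] by (auto simp: tableaux_def intro: less_le_trans)
  have Rc: "tcontent p ?R = row_content p"
    unfolding tcontent_def row_content_def using finite_cells[OF p] by (intro image_mset_cong) auto
  have "T = ?R" if T: "T \<in> tableaux p" "tcontent p T = row_content p" for T
  proof -
    have inv: "card {x \<in> cells p. T x = i} = card {x \<in> cells p. fst x = i}" for i
      using count_tcontent[OF p, of T i] count_tcontent[OF p, of fst i] T(2) by (simp add: row_content_def)
    have "\<forall>j<p i. T (i, j) = i" for i
    proof (induction i rule: less_induct)
      case (less i)
      have "{x \<in> cells p. T x = i} \<subseteq> {x \<in> cells p. fst x = i}"
      proof
        fix x assume x: "x \<in> {x \<in> cells p. T x = i}"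
        obtain r j where rj: "x = (r, j)" by (cases x)
        then have "r \<le> i" using tableaux_ge_row[OF T(1) p, of j r] x by auto
        moreover have "\<not> r < i" using less[of r] x rj by auto
        ultimately show "x \<in> {x \<in> cells p. fst x = i}" using x rj by auto
      qed
      then have eq: "{x \<in> cells p. T x = i} = {x \<in> cells p. fst x = i}"
        using finite_cells[OF p] inv[of i] by (intro card_subset_eq) auto
      show ?case
      proof (intro allI impI)
        fix j assume "j < p i"
        then have "(i, j) \<in> {x \<in> cells p. T x = i}" unfolding eq by simp
        then show "T (i, j) = i" by simp
      qed
    qed
    then show ?thesis using T(1) by (auto simp: tableaux_def extensional_def restrict_def fun_eq_iff)
  qed
  then have "{T \<in> tableaux p. tcontent p T = row_content p} = {?R}" using R Rc by blast
  then show ?thesis by (simp add: yschur_def)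
qed

text \<open>By \<open>dominance\<close>, the monomial of a partition \<open>r\<close> occurs in
  another Schur function only if that one is indexed by a larger partition. For \<open>r\<close>
  maximal in the support, its coefficient isolates \<open>z r\<close>.\<close>

theorem yschur_independent:
  assumes fin: "finite P" and yp: "\<And>p. p \<in> P \<Longrightarrow> ypart p"
    and zero: "(\<Sum>p\<in>P. of_int (z p) * yschur p) = 0" and p: "p \<in> P"
  shows "z p = 0"
proof (rule ccontr)
  assume "z p \<noteq> 0"
  define Q where "Q = {p \<in> P. z p \<noteq> 0}"
  have finQ: "finite Q" and neQ: "Q \<noteq> {}" using fin p \<open>z p \<noteq> 0\<close> by (auto simp: Q_def)
  have "\<exists>L. \<forall>q\<in>Q. q L = 0"
  proof -
    have "\<forall>q\<in>Q. \<exists>L. q L = 0" using yp by (auto simp: Q_def ypart_def)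
    then obtain f where f: "\<forall>q\<in>Q. q (f q) = 0" by metis
    have "q (Max (f ` Q)) = 0" if "q \<in> Q" for q
      using f that yp ypart_vanish[of q "f q" "Max (f ` Q)"] finQ by (auto simp: Q_def)
    then show ?thesis by blast
  qed
  then obtain L where L: "\<forall>q\<in>Q. q L = 0" by blast
  \<comment> \<open>A number that grows strictly along the dominance order on partitions with at
    most \<open>L\<close> rows, so that a maximal element is found by maximizing
    \<open>w\<close>.\<close>
  define w where "w = (\<lambda>q :: nat \<Rightarrow> nat. \<Sum>k\<le>L. \<Sum>i<k. q i)"
  obtain r where r: "r \<in> Q" "\<And>q. q \<in> Q \<Longrightarrow> w r \<ge> w q"
    using Max_in[of "w ` Q"] Max_ge[of "w ` Q"] finQ neQ
    by (metis (no_types, lifting) finite_imageI image_iff image_is_empty)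
  have yr: "ypart r" using r yp by (auto simp: Q_def)
  have K: "xcoeff (yschur q) (row_content r) = 0" if q: "q \<in> Q" "q \<noteq> r" for q
  proof -
    have yq: "ypart q" using q yp by (auto simp: Q_def)
    have "{T \<in> tableaux q. tcontent q T = row_content r} = {}"
    proof (rule ccontr)
      assume "{T \<in> tableaux q. tcontent q T = row_content r} \<noteq> {}"
      then obtain T where T: "T \<in> tableaux q" "tcontent q T = row_content r" by auto
      have dom: "(\<Sum>i<k. r i) \<le> (\<Sum>i<k. q i)" for k by (rule dominance[OF yr yq T])
      have "w r = w q" using r(2)[OF q(1)] dom by (intro antisym) (auto simp: w_def intro: sum_mono)
      have eqL: "(\<Sum>i<k. r i) = (\<Sum>i<k. q i)" if "k \<le> L" for k
      proof (rule ccontr)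
        assume "(\<Sum>i<k. r i) \<noteq> (\<Sum>i<k. q i)"
        then have "(\<Sum>i<k. r i) < (\<Sum>i<k. q i)" using dom[of k] by simp
        then have "w r < w q" unfolding w_def using dom that by (intro sum_strict_mono_ex1) auto
        then show False using \<open>w r = w q\<close> by simp
      qed
      have "r i = q i" for i
      proof (cases "i < L")
        case True
        then show ?thesis using eqL[of i] eqL[of "Suc i"] by simp
      next
        case False
        then show ?thesis using L r(1) q(1) ypart_vanish[OF yr, of L i] ypart_vanish[OF yq, of L i] by auto
      qed
      then show False using q by auto
    qed
    then show ?thesis unfolding yschur_def xcoeff_Abs by (simp only: card.empty of_nat_0)
  qed
  have "0 = xcoeff (\<Sum>p\<in>P. of_int (z p) * yschur p) (row_content r)" by (simp add: zero xcoeff_0)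
  also have "\<dots> = (\<Sum>p\<in>P. z p * xcoeff (yschur p) (row_content r))"
    by (simp add: xcoeff_sum xcoeff_of_int_mult)
  also have "\<dots> = (\<Sum>p\<in>{r}. z p * xcoeff (yschur p) (row_content r))"
    using K r(1) fin by (intro sum.mono_neutral_right) (auto simp: Q_def)
  also have "\<dots> = z r" by (simp add: yschur_row_content[OF yr])
  finally show False using r(1) by (simp add: Q_def)
qed

subsection \<open>The semiring of Schur-positive functions\<close>

lemma Lambda_Sch_eq: "Lambda_Sch = {\<Sum>p\<in>P. of_nat (c p) * yschur p | P (c :: _ \<Rightarrow> nat). finite P \<and> (\<forall>p\<in>P. ypart p)}"
proof (intro equalityI subsetI)
  fix x assume "x \<in> Lambda_Sch"
  then obtain S and c :: "nat list \<Rightarrow> nat" where x: "x = (\<Sum>l\<in>S. of_nat (c l) * schur l)"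
    and S: "finite S" "S \<subseteq> partitions" by (auto simp: Lambda_Sch_def)
  have inj: "inj_on yfun S" using inj_on_yfun S(2) by (rule inj_on_subset)
  have "x = (\<Sum>p\<in>yfun ` S. of_nat (c (the_inv_into S yfun p)) * yschur p)"
    unfolding x sum.reindex[OF inj] by (intro sum.cong) (auto simp: the_inv_into_f_f[OF inj] yschur_yfun)
  then show "x \<in> {\<Sum>p\<in>P. of_nat (c p) * yschur p | P (c :: _ \<Rightarrow> nat). finite P \<and> (\<forall>p\<in>P. ypart p)}"
    using S ypart_yfun by (intro CollectI exI[of _ "yfun ` S"] exI[of _ "\<lambda>p. c (the_inv_into S yfun p)"]) auto
next
  fix x assume "x \<in> {\<Sum>p\<in>P. of_nat (c p) * yschur p | P (c :: _ \<Rightarrow> nat). finite P \<and> (\<forall>p\<in>P. ypart p)}"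
  then obtain P and c :: "_ \<Rightarrow> nat" where x: "x = (\<Sum>p\<in>P. of_nat (c p) * yschur p)"
    and P: "finite P" "\<And>p. p \<in> P \<Longrightarrow> ypart p" by auto
  define S where "S = {l \<in> partitions. yfun l \<in> P}"
  have inj: "inj_on yfun S" by (rule inj_on_subset[OF inj_on_yfun]) (auto simp: S_def)
  have im: "yfun ` S = P"
  proof (intro equalityI subsetI)
    fix p assume p: "p \<in> P"
    then have "p \<in> yfun ` partitions" using yfun_image P(2) by blast
    then show "p \<in> yfun ` S" using p by (auto simp: S_def)
  qed (auto simp: S_def)
  have "finite S" using P(1) im inj finite_image_iff by blast
  moreover have "x = (\<Sum>l\<in>S. of_nat (c (yfun l)) * schur l)"
    unfolding x im[symmetric] sum.reindex[OF inj] by (simp add: yschur_yfun)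
  moreover have "S \<subseteq> partitions" by (auto simp: S_def)
  ultimately show "x \<in> Lambda_Sch" unfolding Lambda_Sch_def
    by (intro CollectI exI[of _ S] exI[of _ "\<lambda>l. c (yfun l)"]) simp
qed

lemma Lambda_Sch_0: "0 \<in> Lambda_Sch"
  unfolding Lambda_Sch_eq by (intro CollectI exI[of _ "{}"]) auto

lemma yschur_in_Lambda_Sch: "ypart p \<Longrightarrow> yschur p \<in> Lambda_Sch"
  unfolding Lambda_Sch_eq by (intro CollectI exI[of _ "{p}"] exI[of _ "\<lambda>_. 1"]) simp

lemma Lambda_Sch_add:
  assumes "x \<in> Lambda_Sch" "y \<in> Lambda_Sch"
  shows "x + y \<in> Lambda_Sch"
proof -
  obtain P Q and c d :: "_ \<Rightarrow> nat" where x: "x = (\<Sum>p\<in>P. of_nat (c p) * yschur p)" "finite P" "\<forall>p\<in>P. ypart p"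
    and y: "y = (\<Sum>p\<in>Q. of_nat (d p) * yschur p)" "finite Q" "\<forall>p\<in>Q. ypart p"
    using assms unfolding Lambda_Sch_eq by blast
  have ext: "(\<Sum>p\<in>A. of_nat (c p) * yschur p) =
      (\<Sum>p\<in>P \<union> Q. of_nat (if p \<in> A then c p else 0) * yschur p)" if "A \<subseteq> P \<union> Q" for A and c :: "_ \<Rightarrow> nat"
    using x y that by (intro sum.mono_neutral_cong_left) auto
  have "x + y = (\<Sum>p\<in>P \<union> Q. of_nat ((if p \<in> P then c p else 0) + (if p \<in> Q then d p else 0)) * yschur p)"
    unfolding x y using ext[of P c] ext[of Q d] by (simp add: sum.distrib distrib_right)
  then show ?thesis using x y unfolding Lambda_Sch_eq
    by (intro CollectI exI[of _ "P \<union> Q"] exI[of _ "\<lambda>p. (if p \<in> P then c p else 0) + (if p \<in> Q then d p else 0)"]) auto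
qed

lemma Lambda_Sch_induct [consumes 1, case_names zero add]:
  assumes "x \<in> Lambda_Sch" and zero: "P 0"
    and add: "\<And>p y. ypart p \<Longrightarrow> y \<in> Lambda_Sch \<Longrightarrow> P y \<Longrightarrow> P (yschur p + y)"
  shows "P x"
proof -
  obtain A and c :: "_ \<Rightarrow> nat" where x: "x = (\<Sum>p\<in>A. of_nat (c p) * yschur p)" and A: "finite A" "\<forall>p\<in>A. ypart p"
    using assms(1) unfolding Lambda_Sch_eq by blast
  have "(\<Sum>p\<in>A. of_nat (c p) * yschur p) \<in> Lambda_Sch \<and> P (\<Sum>p\<in>A. of_nat (c p) * yschur p)"
    using A
  proof (induction A rule: finite_induct)
    case (insert p A)
    have "of_nat k * yschur p + y \<in> Lambda_Sch \<and> P (of_nat k * yschur p + y)"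
      if "y \<in> Lambda_Sch" "P y" for k y
    proof (induction k)
      case (Suc k)
      then have "yschur p + (of_nat k * yschur p + y) \<in> Lambda_Sch \<and> P (yschur p + (of_nat k * yschur p + y))"
        using insert add Lambda_Sch_add yschur_in_Lambda_Sch by simp
      then show ?case by (simp add: algebra_simps)
    qed (use that in simp)
    then show ?case using insert by simp
  qed (simp add: zero Lambda_Sch_0)
  then show ?thesis by (simp add: x)
qed

lemma Lambda_Sch_sum: "(\<And>i. i \<in> A \<Longrightarrow> f i \<in> Lambda_Sch) \<Longrightarrow> (\<Sum>i\<in>A. f i) \<in> Lambda_Sch"
  by (induction A rule: infinite_finite_induct) (auto simp: Lambda_Sch_0 Lambda_Sch_add)

lemma W_Sch_sum:
  assumes "a \<in> W_Sch" "\<And>i. i \<in> A \<Longrightarrow> f i \<in> Lambda_Sch"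
  shows "a (\<Sum>i\<in>A. f i) = (\<Sum>i\<in>A. a (f i))"
  using assms(2)
proof (induction A rule: infinite_finite_induct)
  case (insert i A)
  then have "a (f i + (\<Sum>i\<in>A. f i)) = a (f i) + a (\<Sum>i\<in>A. f i)"
    using assms(1) Lambda_Sch_sum[of A f] unfolding W_Sch_def by simp
  then show ?case using insert by simp
qed (use assms(1) in \<open>auto simp: W_Sch_def\<close>)

lemma pieri_W_Sch:
  fixes a :: "xseries \<Rightarrow> nat"
  assumes a: "a \<in> W_Sch"
  shows "pieri (\<lambda>p. int (a (yschur p))) (sigma a)"
  unfolding pieri_def
proof (intro conjI allI impI)
  show "int (a (yschur (\<lambda>_. 0))) = 1" using a pieri_yschur by (simp add: W_Sch_def pieri_def)
  fix p :: "nat \<Rightarrow> nat" and n assume p: "ypart p"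
  have "a (elem_sym n * yschur p) = a (elem_sym n) * a (yschur p)"
    using a elem_sym_in_Lambda_Sch yschur_in_Lambda_Sch[OF p] by (simp add: W_Sch_def)
  moreover have "elem_sym n * yschur p = (\<Sum>q\<in>vstrips n p. yschur q)"
    using pieri_yschur p by (simp add: pieri_def elem_sym_yschur)
  moreover have "a (\<Sum>q\<in>vstrips n p. yschur q) = (\<Sum>q\<in>vstrips n p. a (yschur q))"
    by (rule W_Sch_sum[OF a]) (auto simp: vstrips_def yschur_in_Lambda_Sch)
  ultimately show "fps_nth (sigma a) n * int (a (yschur p)) = (\<Sum>q\<in>vstrips n p. int (a (yschur q)))"
    by (simp add: sigma_def flip: of_nat_mult of_nat_sum)
qed

theorem inj_on_sigma: "inj_on sigma (W_Sch :: (xseries \<Rightarrow> nat) set)"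
proof (rule inj_onI)
  fix a b :: "xseries \<Rightarrow> nat" assume a: "a \<in> W_Sch" and b: "b \<in> W_Sch" and eq: "sigma a = sigma b"
  have s: "a (yschur p) = b (yschur p)" if "ypart p" for p
    using pieri_unique[OF pieri_W_Sch[OF a] pieri_W_Sch[OF b, folded eq] that] by simp
  have "a x = b x" if "x \<in> Lambda_Sch" for x
    using that
  proof (induction rule: Lambda_Sch_induct)
    case (add p y)
    then show ?case using a b s yschur_in_Lambda_Sch[of p] by (simp add: W_Sch_def)
  qed (use a b in \<open>simp add: W_Sch_def\<close>)
  moreover have "a x = b x" if "x \<notin> Lambda_Sch" for x
    using a b that by (simp add: W_Sch_def extensional_def)
  ultimately show "a = b" by blast
qed

section \<open>Littlewood--Richardson positivity\<close>

text \<open>The integers have no 2-torsion. This is how antisymmetry turns into vanishing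
  below.\<close>

lemma xseries_double_zero: "x = - x \<Longrightarrow> x = (0 :: xseries)"
proof (rule xseries_eqI)
  fix M assume x: "x = - x"
  have "xcoeff x M = xcoeff (- x) M" using x by (rule arg_cong)
  moreover have "xcoeff (- x) M = - xcoeff x M" by transfer simp
  ultimately show "xcoeff x M = xcoeff 0 M" by (simp add: xcoeff_0)
qed

text \<open>
  Consecutive columns of a tableau, viewed as sets of entries, are related by \<open>dominates\<close>.
\<close>

definition dominates :: "nat set \<Rightarrow> nat set \<Rightarrow> bool" where
  "dominates D C \<longleftrightarrow> (\<forall>k. card (C \<inter> {..<k}) \<le> card (D \<inter> {..<k}))"

definition dom_cols :: "nat \<Rightarrow> nat \<Rightarrow> nat set \<Rightarrow> nat set set" where
  "dom_cols N n C = {D. D \<subseteq> {..<N} \<and> card D = n \<and> dominates D C}"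

text \<open>The sum of \<open>F\<close> at the contents of all semistandard fillings whose columns
  have the given lengths, listed from right to left, and stand to the left of \<open>C\<close>. The
  content of the columns already chosen is absorbed into \<open>F\<close>.\<close>

fun col_sum :: "nat \<Rightarrow> nat list \<Rightarrow> nat set \<Rightarrow> ((nat \<Rightarrow> nat) \<Rightarrow> xseries) \<Rightarrow> xseries" where
  "col_sum N [] C F = F (\<lambda>_. 0)"
| "col_sum N (n # ns) C F = (\<Sum>D\<in>dom_cols N n C. col_sum N ns D (\<lambda>g. F (addv g D)))"

lemma finite_dom_cols: "finite (dom_cols N n C)"
  by (rule finite_subset[of _ "Pow {..<N}"]) (auto simp: dom_cols_def)

lemma col_sum_add: "col_sum N ns C (\<lambda>g. F g + G g) = col_sum N ns C F + col_sum N ns C G"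
  by (induction ns arbitrary: C F G) (simp_all add: sum.distrib)

definition anti :: "nat \<Rightarrow> ((nat \<Rightarrow> nat) \<Rightarrow> xseries) \<Rightarrow> bool" where
  "anti i F \<longleftrightarrow> (\<forall>g. F (g \<circ> transpose i (Suc i)) = - F g)"

lemma addv_transpose: "addv (g \<circ> transpose i j) D = addv g (transpose i j ` D) \<circ> transpose i j"
proof (rule ext)
  fix x
  have "x \<in> D \<longleftrightarrow> transpose i j x \<in> transpose i j ` D"
    by (simp add: inj_image_mem_iff[OF inj_on_transpose])
  then show "addv (g \<circ> transpose i j) D x = (addv g (transpose i j ` D) \<circ> transpose i j) x"
    by (simp add: addv_def)
qed

lemma transpose_image_neutral: "(i \<in> D \<longleftrightarrow> j \<in> D) \<Longrightarrow> transpose i j ` D = D"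
  by (auto simp: transpose_def image_iff split: if_splits)

lemma transpose_image_only: "i \<in> D \<Longrightarrow> j \<notin> D \<Longrightarrow> transpose i j ` D = insert j (D - {i})"
  by (auto simp: transpose_def image_iff split: if_splits)

lemma anti_addv: "anti i F \<Longrightarrow> (i \<in> D \<longleftrightarrow> Suc i \<in> D) \<Longrightarrow> anti i (\<lambda>g. F (addv g D))"
  by (simp add: anti_def addv_transpose transpose_image_neutral)

lemma addv_disjoint: "A \<inter> B = {} \<Longrightarrow> addv (addv g A) B = addv g (A \<union> B)"
  by (auto simp: addv_def fun_eq_iff of_bool_def)

lemma card_below_Suc: "finite D \<Longrightarrow> card (D \<inter> {..<Suc i}) = card (D \<inter> {..<i}) + of_bool (i \<in> D)"
  by (auto simp: lessThan_Suc Int_insert_right)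

lemma card_transpose_below:
  assumes "finite D" "k \<noteq> Suc i"
  shows "card (transpose i (Suc i) ` D \<inter> {..<k}) = card (D \<inter> {..<k})"
proof -
  have "transpose i (Suc i) ` {..<k} = {..<k}"
    using assms(2) by (intro transpose_image_neutral) auto
  then have "transpose i (Suc i) ` D \<inter> {..<k} = transpose i (Suc i) ` (D \<inter> {..<k})"
    by (simp add: image_Int[OF inj_on_transpose])
  then show ?thesis by (simp add: card_image[OF inj_on_transpose])
qed

lemma card_transpose_at:
  assumes "finite D"
  shows "card (transpose i (Suc i) ` D \<inter> {..<Suc i}) = card (D \<inter> {..<i}) + of_bool (Suc i \<in> D)"
proof -
  have "i \<in> transpose i (Suc i) ` D \<longleftrightarrow> Suc i \<in> D"
    using inj_image_mem_iff[OF inj_on_transpose, of i "Suc i" "Suc i" D] by simp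
  then show ?thesis
    using card_below_Suc[of "transpose i (Suc i) ` D" i] card_transpose_below[OF assms, of i i] assms by simp
qed

text \<open>The exchange changes only the number of entries below \<open>i + 1\<close>. If
  \<open>i \<notin> C\<close>, the required bound follows from the one at \<open>i\<close>, and if
  \<open>C\<close> contains both \<open>i\<close> and \<open>i + 1\<close>, it follows from the one
  at \<open>i + 2\<close>.\<close>

lemma transpose_dom_cols:
  assumes D: "D \<in> dom_cols N n C" and C: "finite C" "\<not> (i \<in> C \<and> Suc i \<notin> C)" and i: "Suc i < N"
  shows "transpose i (Suc i) ` D \<in> dom_cols N n C"
proof -
  have finD: "finite D" using D by (auto simp: dom_cols_def intro: finite_subset)
  have "transpose i (Suc i) ` D \<subseteq> {..<N}" using D i by (auto simp: dom_cols_def transpose_def)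
  moreover have "card (transpose i (Suc i) ` D) = n"
    using D by (simp add: dom_cols_def card_image[OF inj_on_transpose])
  moreover have "card (C \<inter> {..<k}) \<le> card (transpose i (Suc i) ` D \<inter> {..<k})" for k
  proof (cases "k = Suc i")
    case False
    then show ?thesis using D by (simp add: card_transpose_below[OF finD] dom_cols_def dominates_def)
  next
    case True
    have d: "card (C \<inter> {..<k}) \<le> card (D \<inter> {..<k})" for k using D by (auto simp: dom_cols_def dominates_def)
    show ?thesis unfolding True card_transpose_at[OF finD]
      using d[of i] d[of "Suc i"] d[of "Suc (Suc i)"] C(2)
      by (cases "i \<in> C"; cases "Suc i \<in> C"; cases "i \<in> D"; cases "Suc i \<in> D")
        (simp_all add: card_below_Suc[OF finD] card_below_Suc[OF C(1)])
  qed
  ultimately show ?thesis by (simp add: dom_cols_def dominates_def)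
qed

text \<open>
  The symmetry of Schur polynomials under exchanging \<open>i\<close> and \<open>i + 1\<close>, in a form that survives
  truncation to the leftmost columns: the columns are added from the right to the left and
  \<open>C\<close> is the column that was added last.
\<close>

lemma col_sum_anti:
  assumes i: "Suc i < N"
  shows "finite C \<Longrightarrow> anti i F \<Longrightarrow> \<not> (i \<in> C \<and> Suc i \<notin> C) \<Longrightarrow> col_sum N ns C F = 0"
    and "finite C \<Longrightarrow> anti i F \<Longrightarrow> i \<in> C \<Longrightarrow> Suc i \<notin> C \<Longrightarrow>
      col_sum N ns C (\<lambda>g. F (addv g {i})) +
      col_sum N ns (transpose i (Suc i) ` C) (\<lambda>g. F (addv g {Suc i})) = 0"
proof (induction ns arbitrary: C F)
  case Nil
  {
    case 1
    then have "F ((\<lambda>_. 0) \<circ> transpose i (Suc i)) = - F (\<lambda>_. 0)" unfolding anti_def by blast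
    moreover have "(\<lambda>_. 0 :: nat) \<circ> transpose i (Suc i) = (\<lambda>_. 0)" by auto
    ultimately show ?case using xseries_double_zero by simp
  next
    case 2
    have "addv (\<lambda>_. 0) {Suc i} = addv (\<lambda>_. 0) {i} \<circ> transpose i (Suc i)"
      by (auto simp: addv_def fun_eq_iff transpose_def)
    then show ?case using 2 by (simp add: anti_def)
  }
next
  case (Cons n ns)
  let ?t = "transpose i (Suc i)"
  have first: "col_sum N (n # ns) C F = 0"
    if C: "finite C" "\<not> (i \<in> C \<and> Suc i \<notin> C)" and F: "anti i F" for C F
  proof -
    define h where "h = (\<lambda>D. col_sum N ns D (\<lambda>g. F (addv g D)))"
    have bij: "bij_betw ((`) ?t) (dom_cols N n C) (dom_cols N n C)"
      by (rule bij_betw_byWitness[where f' = "(`) ?t"])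
        (use transpose_dom_cols[OF _ C i] in \<open>auto simp: image_image\<close>)
    \<comment> \<open>The two columns differ only in \<open>i\<close> against \<open>i + 1\<close>.
      The common part \<open>D - {i}\<close> contains neither, so absorbing it keeps the function
      antisymmetric, and the second claim for the remaining columns applies.\<close>
    have only: "h D + h (?t ` D) = 0" if D: "finite D" "i \<in> D" "Suc i \<notin> D" for D
    proof -
      have e1: "addv g D = addv (addv g {i}) (D - {i})" for g
        using D by (subst addv_disjoint) (auto simp: insert_absorb)
      have e2: "addv g (?t ` D) = addv (addv g {Suc i}) (D - {i})" for g
        using D by (subst addv_disjoint) (auto simp: transpose_image_only)
      have "anti i (\<lambda>g. F (addv g (D - {i})))" using F D by (intro anti_addv) auto
      from Cons.IH(2)[OF D(1) this D(2,3)] show ?thesis unfolding h_def e1 e2 .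
    qed
    have "h D + h (?t ` D) = 0" if D: "D \<in> dom_cols N n C" for D
    proof -
      have finD: "finite D" using D by (auto simp: dom_cols_def intro: finite_subset)
      consider "i \<in> D \<longleftrightarrow> Suc i \<in> D" | "i \<in> D" "Suc i \<notin> D" | "i \<notin> D" "Suc i \<in> D" by blast
      then show ?thesis
      proof cases
        case 1
        then have "h D = 0" unfolding h_def using Cons.IH(1)[OF finD anti_addv[OF F]] by blast
        then show ?thesis by (simp add: transpose_image_neutral[OF 1])
      next
        case 2
        then show ?thesis using only finD by blast
      next
        case 3
        have "i \<in> ?t ` D" "Suc i \<notin> ?t ` D"
          using 3 inj_image_mem_iff[OF inj_on_transpose, of i "Suc i" "Suc i" D]
            inj_image_mem_iff[OF inj_on_transpose, of i "Suc i" i D] by simp_all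
        then have "h (?t ` D) + h (?t ` ?t ` D) = 0" using only finD by simp
        then show ?thesis by (simp add: image_image add.commute)
      qed
    qed
    \<comment> \<open>The exchange permutes the admissible columns, so the two sums are equal and
      the sum is its own negative.\<close>
    then have "(\<Sum>D\<in>dom_cols N n C. h D) + (\<Sum>D\<in>dom_cols N n C. h (?t ` D)) = 0"
      by (simp flip: sum.distrib)
    moreover have "(\<Sum>D\<in>dom_cols N n C. h (?t ` D)) = (\<Sum>D\<in>dom_cols N n C. h D)"
      by (rule sum.reindex_bij_betw[OF bij])
    ultimately have "(\<Sum>D\<in>dom_cols N n C. h D) = 0"
      by (intro xseries_double_zero) (simp add: eq_neg_iff_add_eq_0)
    then show ?thesis by (simp add: h_def)
  qed
  {
    case 1
    then show ?case using first by blast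
  next
    case 2
    let ?C' = "?t ` C"
    define h where "h = (\<lambda>D. col_sum N ns D (\<lambda>g. F (addv (addv g D) {i})))"
    have cnt: "card (?C' \<inter> {..<k}) + of_bool (k = Suc i) = card (C \<inter> {..<k})" for k
      using card_transpose_below[OF 2(1), of k i] card_transpose_at[OF 2(1), of i] card_below_Suc[OF 2(1), of i] 2
      by (cases "k = Suc i") auto
    have sub: "dom_cols N n C \<subseteq> dom_cols N n ?C'"
      unfolding dom_cols_def dominates_def by (auto simp flip: cnt intro: add_leD1)
    \<comment> \<open>A column that is admissible for \<open>?C'\<close> but not for
      \<open>C\<close> violates dominance exactly at \<open>i + 1\<close>; this forces it to contain
      \<open>i + 1\<close> but not \<open>i\<close>. The additional cell \<open>i\<close> completes
      it to a symmetric set, so the first claim makes its contribution vanish, and \<open>C\<close>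
      may be replaced by \<open>?C'\<close>.\<close>
    have special: "h D = 0" if D: "D \<in> dom_cols N n ?C' - dom_cols N n C" for D
    proof -
      have finD: "finite D" using D by (auto simp: dom_cols_def intro: finite_subset)
      have d: "card (?C' \<inter> {..<k}) \<le> card (D \<inter> {..<k})" for k using D by (auto simp: dom_cols_def dominates_def)
      obtain k where k: "card (D \<inter> {..<k}) < card (C \<inter> {..<k})"
        using D by (auto simp: dom_cols_def dominates_def not_le)
      then have "k = Suc i" using d[of k] cnt[of k] by (cases "k = Suc i") auto
      then have lt: "card (D \<inter> {..<Suc i}) < card (C \<inter> {..<Suc i})" using k by simp
      have "i \<notin> D \<and> Suc i \<in> D"
        using lt d[of i] d[of "Suc (Suc i)"] cnt[of i] cnt[of "Suc (Suc i)"] 2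
        by (cases "i \<in> D"; cases "Suc i \<in> D") (simp_all add: card_below_Suc[OF finD] card_below_Suc[OF 2(1)])
      then have D': "i \<notin> D" "Suc i \<in> D" by auto
      have "addv (addv g D) {i} = addv g (insert i D)" for g
        using D' by (subst addv_disjoint) auto
      moreover have "anti i (\<lambda>g. F (addv g (insert i D)))" using 2 D' by (intro anti_addv) auto
      ultimately show ?thesis using Cons.IH(1)[OF finD] D' by (simp add: h_def)
    qed
    have "col_sum N (n # ns) C (\<lambda>g. F (addv g {i})) = (\<Sum>D\<in>dom_cols N n ?C'. h D)"
      unfolding col_sum.simps h_def[symmetric]
      by (rule sum.mono_neutral_left[OF finite_dom_cols sub]) (use special in blast)
    also have "\<dots> = col_sum N (n # ns) ?C' (\<lambda>g. F (addv g {i}))"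
      by (simp add: h_def)
    finally have "col_sum N (n # ns) C (\<lambda>g. F (addv g {i})) + col_sum N (n # ns) ?C' (\<lambda>g. F (addv g {Suc i}))
      = col_sum N (n # ns) ?C' (\<lambda>g. F (addv g {i}) + F (addv g {Suc i}))"
      by (simp only: col_sum_add)
    \<comment> \<open>With the same column \<open>?C'\<close> in both terms their sum is
      antisymmetric, and \<open>?C'\<close> contains \<open>i + 1\<close> but not \<open>i\<close>,
      as the first claim allows.\<close>
    also have "\<dots> = 0"
    proof (rule first)
      show "finite ?C'" using 2 by simp
      show "\<not> (i \<in> ?C' \<and> Suc i \<notin> ?C')" using 2 by (simp add: transpose_image_only)
      show "anti i (\<lambda>g. F (addv g {i}) + F (addv g {Suc i}))"
        using 2 by (simp add: anti_def addv_transpose add.commute)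
    qed
    finally show ?case .
  }
qed

subsection \<open>Antisymmetrization\<close>

definition decr_on :: "nat \<Rightarrow> (nat \<Rightarrow> nat) \<Rightarrow> bool" where
  "decr_on N b \<longleftrightarrow> (\<forall>i j. i < j \<and> j < N \<longrightarrow> b j < b i)"

text \<open>Partitions with at most \<open>N\<close> rows correspond to strictly decreasing vectors
  of length \<open>N\<close> by adding \<open>(N - 1, ..., 1, 0)\<close>. On such vectors the
  truncated subtraction is exact, by \<open>decr_on_ge\<close>.\<close>

definition shape :: "nat \<Rightarrow> (nat \<Rightarrow> nat) \<Rightarrow> nat \<Rightarrow> nat" where
  "shape N b = (\<lambda>i. if i < N then b i - (N - 1 - i) else 0)"

definition shifted :: "nat \<Rightarrow> (nat \<Rightarrow> nat) \<Rightarrow> nat \<Rightarrow> nat" where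
  "shifted N p = (\<lambda>i. p i + (N - 1 - i))"

definition antisymmetrize :: "nat \<Rightarrow> ((nat \<Rightarrow> nat) \<Rightarrow> xseries) \<Rightarrow> (nat \<Rightarrow> nat) \<Rightarrow> xseries" where
  "antisymmetrize N E b = (\<Sum>s | s permutes {..<N}. of_int (sign s) * E (b \<circ> s))"

text \<open>Its antisymmetrization extends \<phi> to arbitrary vectors, as for Schur functions
  defined by alternants: at most one permutation sorts the entries, so the value is \<phi> at the
  sorted shape up to sign, or zero if two entries agree.\<close>

definition on_shape :: "nat \<Rightarrow> ((nat \<Rightarrow> nat) \<Rightarrow> xseries) \<Rightarrow> (nat \<Rightarrow> nat) \<Rightarrow> xseries" where
  "on_shape N \<phi> b = (if decr_on N b then \<phi> (shape N b) else 0)"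

lemma antisym_transpose:
  assumes "i < N" "j < N" "i \<noteq> j"
  shows "antisymmetrize N E (b \<circ> transpose i j) = - antisymmetrize N E b"
proof -
  have t: "transpose i j permutes {..<N}" using assms by (simp add: permutes_swap_id)
  have "antisymmetrize N E b = (\<Sum>s | s permutes {..<N}. of_int (sign (transpose i j \<circ> s)) * E (b \<circ> (transpose i j \<circ> s)))"
    unfolding antisymmetrize_def by (rule setum_permutations_compose_left[OF t])
  also have "\<dots> = (\<Sum>s | s permutes {..<N}. - (of_int (sign s) * E ((b \<circ> transpose i j) \<circ> s)))"
  proof (intro sum.cong refl)
    fix s assume "s \<in> {s. s permutes {..<N}}"
    then have "permutation s" by (auto intro: permutation_permutes[THEN iffD2] )
    then have "sign (transpose i j \<circ> s) = - sign s"
      using assms by (simp add: sign_compose permutation_swap_id sign_swap_id)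
    then show "of_int (sign (transpose i j \<circ> s)) * E (b \<circ> (transpose i j \<circ> s)) =
        - (of_int (sign s) * E ((b \<circ> transpose i j) \<circ> s))" by (simp add: comp_assoc)
  qed
  finally show ?thesis by (simp add: antisymmetrize_def sum_negf)
qed

lemma antisym_not_inj:
  assumes "i < N" "j < N" "i \<noteq> j" "b i = b j"
  shows "antisymmetrize N E b = 0"
proof -
  have "b \<circ> transpose i j = b" using assms(4) by (auto simp: transpose_def fun_eq_iff)
  then show ?thesis using antisym_transpose[OF assms(1-3), of E b] xseries_double_zero by simp
qed

lemma shape_shifted: "(\<And>i. N \<le> i \<Longrightarrow> p i = 0) \<Longrightarrow> shape N (shifted N p) = p"
  by (auto simp: shape_def shifted_def fun_eq_iff)

lemma decr_on_shifted: "ypart p \<Longrightarrow> decr_on N (shifted N p)"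
  unfolding decr_on_def shifted_def
proof (intro allI impI)
  fix i j assume p: "ypart p" and ij: "i < j \<and> j < N"
  then have "p j \<le> p i" by (simp add: ypart_mono)
  then show "p j + (N - 1 - j) < p i + (N - 1 - i)" using ij by linarith
qed

lemma permutes_increasing:
  assumes s: "s permutes {..<N :: nat}" and inc: "\<And>i j. i < j \<Longrightarrow> j < N \<Longrightarrow> s i < s j"
  shows "s = id"
proof -
  have "s i = i" if "i < N" for i
    using that
  proof (induction i rule: less_induct)
    case (less i)
    have "\<not> s i < i"
    proof
      assume "s i < i"
      then have "s (s i) = s i" using less by simp
      then have "s i = i" using permutes_inj[OF s] by (simp add: inj_eq)
      then show False using \<open>s i < i\<close> by simp
    qed
    moreover have "\<not> i < s i"
    proof
      assume gt: "i < s i"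
      obtain k where k: "k < N" "s k = i"
        using permutes_image[OF s] less.prems by (metis image_iff lessThan_iff)
      show False
      proof (cases "k < i")
        case True
        then show False using less.IH[of k] k by simp
      next
        case False
        then have "i \<noteq> k" using k gt by auto
        then show False using inc[of i k] k gt False by simp
      qed
    qed
    ultimately show ?case by simp
  qed
  then have "s i = i" for i using permutes_not_in[OF s, of i] by (cases "i < N") auto
  then show ?thesis by auto
qed

lemma antisym_on_shape:
  assumes b: "decr_on N b"
  shows "antisymmetrize N (on_shape N \<phi>) b = \<phi> (shape N b)"
proof -
  have "on_shape N \<phi> (b \<circ> s) = 0" if s: "s permutes {..<N}" "s \<noteq> id" for s
  proof -
    obtain i j where ij: "i < j" "j < N" "\<not> s i < s j" using permutes_increasing[OF s(1)] s(2) by blast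
    have "s j < N" "s i < N" using permutes_in_image[OF s(1)] ij by auto
    moreover have "s i \<noteq> s j" using permutes_inj[OF s(1)] ij by (auto dest: injD)
    ultimately have "b (s i) < b (s j)" using ij b by (auto simp: decr_on_def)
    then have "\<not> b (s j) < b (s i)" by simp
    then have "\<not> decr_on N (b \<circ> s)" using ij unfolding decr_on_def comp_def by blast
    then show ?thesis by (simp add: on_shape_def)
  qed
  then have "antisymmetrize N (on_shape N \<phi>) b = (\<Sum>s\<in>{id}. of_int (sign s) * on_shape N \<phi> (b \<circ> s))"
    unfolding antisymmetrize_def by (intro sum.mono_neutral_right) (auto simp: finite_permutations permutes_id)
  then show ?thesis using b by (simp add: on_shape_def)
qed

lemma ysize_sum: "ypart p \<Longrightarrow> (\<And>i. N \<le> i \<Longrightarrow> p i = 0) \<Longrightarrow> ysize p = (\<Sum>i<N. p i)"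
proof -
  assume "\<And>i. N \<le> i \<Longrightarrow> p i = 0"
  then have "cells p = (SIGMA i:{..<N}. {..<p i})" by (auto simp: cells_def) (metis not_less not_less0)
  then show ?thesis by (simp add: ysize_def)
qed

lemma decr_on_ge: "decr_on N b \<Longrightarrow> i < N \<Longrightarrow> N - 1 - i \<le> b i"
proof (induction "N - 1 - i" arbitrary: i)
  case (Suc k)
  then have "N - 1 - Suc i \<le> b (Suc i)" "b (Suc i) < b i" by (auto simp: decr_on_def)
  then show ?case by simp
qed simp

text \<open>Permuting the rows permutes the \<open>n\<close>-element sets of rows, so it suffices to
  compare the terms for one permutation. There the sets that do not give a partition contribute
  zero. The bound on the size says that the partition and the strip together have at most
  \<open>N\<close> cells, so no vertical strip leaves the first \<open>N\<close> rows.\<close>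

lemma pieri_antisym:
  assumes \<phi>: "pieri \<phi> c" and size: "(\<Sum>i<N. b i) + n \<le> N + (\<Sum>i<N. N - 1 - i)"
  shows "(\<Sum>S | S \<subseteq> {..<N} \<and> card S = n. antisymmetrize N (on_shape N \<phi>) (addv b S)) =
    fps_nth c n * antisymmetrize N (on_shape N \<phi>) b"
proof -
  let ?A = "{S. S \<subseteq> {..<N} \<and> card S = n}"
  define E where "E = (\<lambda>b. \<Sum>S\<in>?A. on_shape N \<phi> (addv b S))"
  have "(\<Sum>S\<in>?A. antisymmetrize N (on_shape N \<phi>) (addv b S)) =
      (\<Sum>s | s permutes {..<N}. of_int (sign s) * (\<Sum>S\<in>?A. on_shape N \<phi> (addv b S \<circ> s)))"
    unfolding antisymmetrize_def sum_distrib_left by (rule sum.swap)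
  also have "\<dots> = antisymmetrize N E b"
    unfolding antisymmetrize_def
  proof (intro sum.cong refl arg_cong[where f = "(*) _"])
    fix s assume "s \<in> {s. s permutes {..<N}}"
    then have s: "s permutes {..<N}" by simp
    have bij: "bij_betw ((`) s) ?A ?A"
    proof (rule bij_betw_byWitness[where f' = "(`) (inv s)"])
      show "(`) s ` ?A \<subseteq> ?A" using permutes_in_image[OF s] permutes_inj_on[OF s]
        by (auto simp: card_image inj_on_subset)
      show "(`) (inv s) ` ?A \<subseteq> ?A"
        using permutes_in_image[OF permutes_inv[OF s]] permutes_inj_on[OF permutes_inv[OF s]]
        by (auto simp: card_image inj_on_subset)
    qed (auto simp: image_image permutes_inverses[OF s])
    have "addv b (s ` S) \<circ> s = addv (b \<circ> s) S" for S
      by (auto simp: addv_def fun_eq_iff inj_image_mem_iff[OF permutes_inj[OF s]])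
    then have "E (b \<circ> s) = (\<Sum>S\<in>?A. on_shape N \<phi> (addv b (s ` S) \<circ> s))" by (simp add: E_def)
    also have "\<dots> = (\<Sum>S\<in>?A. on_shape N \<phi> (addv b S \<circ> s))" by (rule sum.reindex_bij_betw[OF bij])
    finally show "(\<Sum>S\<in>?A. on_shape N \<phi> (addv b S \<circ> s)) = E (b \<circ> s)" by simp
  qed
  also have "\<dots> = fps_nth c n * antisymmetrize N (on_shape N \<phi>) b"
  proof (cases "inj_on b {..<N}")
    case False
    then obtain i j where "i < N" "j < N" "i \<noteq> j" "b i = b j" by (auto simp: inj_on_def)
    then show ?thesis using antisym_not_inj by simp
  next
    case True
    have "E (b \<circ> s) = fps_nth c n * on_shape N \<phi> (b \<circ> s)" if s: "s permutes {..<N}" for s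
    proof (cases "decr_on N (b \<circ> s)")
      case False
      then obtain i j where ij: "i < j" "j < N" "b (s i) \<le> b (s j)" by (auto simp: decr_on_def not_less)
      have "s j < N" "s i < N" using permutes_in_image[OF s] ij by auto
      moreover have "s i \<noteq> s j" using permutes_inj[OF s] ij by (auto dest: injD)
      ultimately have "b (s i) < b (s j)" using ij True by (auto simp: inj_on_def le_less)
      \<comment> \<open>Distinct integers can be made equal by adding 0 or 1 to each, but their
        order cannot be reversed.\<close>
      then have "addv (b \<circ> s) S i \<le> addv (b \<circ> s) S j" for S by (simp add: addv_def)
      then have "\<not> decr_on N (addv (b \<circ> s) S)" for S using ij unfolding decr_on_def by (meson not_less)
      then show ?thesis using False by (simp add: E_def on_shape_def)
    next
      case decr: True
      define p where "p = shape N (b \<circ> s)"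
      have p0: "p i = 0" if "N \<le> i" for i using that by (simp add: p_def shape_def)
      have bp: "b (s i) = p i + (N - 1 - i)" if "i < N" for i
        using decr_on_ge[OF decr that] that by (simp add: p_def shape_def)
      have "p (Suc i) \<le> p i" for i
      proof (cases "Suc i < N")
        case True
        then have "b (s (Suc i)) < b (s i)" using decr by (auto simp: decr_on_def)
        then show ?thesis using bp[of i] bp[of "Suc i"] True by simp
      qed (simp add: p0)
      then have yp: "ypart p" using p0[of N] by (intro ypartI[of p N]) auto
      have "(\<Sum>i<N. b i) = (\<Sum>i<N. b (s i))"
        using permutes_imp_bij[OF s] by (rule sum.reindex_bij_betw[symmetric])
      also have "\<dots> = (\<Sum>i<N. p i + (N - 1 - i))" by (intro sum.cong) (auto simp: bp)
      also have "\<dots> = (\<Sum>i<N. p i) + (\<Sum>i<N. N - 1 - i)" by (rule sum.distrib)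
      finally have sz: "ysize p + n \<le> N" using size ysize_sum[OF yp p0] by simp
      have iff: "decr_on N (addv (b \<circ> s) S) \<longleftrightarrow> ypart (addv p S)" if S: "S \<subseteq> {..<N}" for S
      proof
        have finS: "finite S" using S finite_subset by auto
        assume d: "decr_on N (addv (b \<circ> s) S)"
        have "addv p S (Suc i) \<le> addv p S i" for i
        proof (cases "Suc i < N")
          case True
          then have "addv (b \<circ> s) S (Suc i) < addv (b \<circ> s) S i" using d by (auto simp: decr_on_def)
          then show ?thesis using bp[of i] bp[of "Suc i"] True by (simp add: addv_def)
        qed (use S p0[of "Suc i"] in \<open>auto simp: addv_def\<close>)
        then show "ypart (addv p S)" using ypart_addv_iff[OF yp finS] by (auto intro: decseq_SucI)
      next
        assume y: "ypart (addv p S)"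
        show "decr_on N (addv (b \<circ> s) S)"
          unfolding decr_on_def
        proof (intro allI impI)
          fix i j assume ij: "i < j \<and> j < N"
          then show "addv (b \<circ> s) S j < addv (b \<circ> s) S i"
            using ypart_mono[OF y, of i j] bp[of i] bp[of j] unfolding addv_def comp_def by linarith
        qed
      qed
      have sh: "shape N (addv (b \<circ> s) S) = addv p S" if S: "S \<subseteq> {..<N}" for S
      proof (rule ext)
        fix i show "shape N (addv (b \<circ> s) S) i = addv p S i"
          using S bp[of i] p0[of i] by (cases "i < N") (auto simp: shape_def addv_def)
      qed
      have "{S. finite S \<and> card S = n \<and> ypart (addv p S)} = {S \<in> ?A. ypart (addv p S)}"
      proof (intro equalityI subsetI)
        fix S assume S: "S \<in> {S. finite S \<and> card S = n \<and> ypart (addv p S)}"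
        have "S \<subseteq> {..<N}"
        proof
          fix i assume "i \<in> S"
          then have "addv p S i \<noteq> 0" by (simp add: addv_def)
          then have "i < ysize (addv p S)" using S by (intro ysize_gt_length) auto
          then show "i \<in> {..<N}" using S sz ysize_addv[OF yp, of S] by simp
        qed
        then show "S \<in> {S \<in> ?A. ypart (addv p S)}" using S by simp
      qed (auto intro: finite_subset)
      then have "fps_nth c n * \<phi> p = (\<Sum>S | S \<in> ?A \<and> ypart (addv p S). \<phi> (addv p S))"
        using \<phi> yp by (simp add: pieri_def sum_vstrips)
      also have "\<dots> = E (b \<circ> s)"
        unfolding E_def by (rule sum.mono_neutral_cong_left) (auto simp: on_shape_def iff sh)
      finally show ?thesis using decr by (simp add: on_shape_def p_def)
    qed
    then show ?thesis unfolding antisymmetrize_def by (simp add: sum_distrib_left mult.left_commute)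
  qed
  finally show ?thesis .
qed

text \<open>Monomials are linearly independent, so the two families of exponents agree as multisets.
  An identity of Schur polynomials therefore stays true when each monomial is replaced by an
  arbitrary function of its exponents.\<close>

lemma xmon_sum_transfer:
  assumes "finite I" "finite J" and eq: "(\<Sum>i\<in>I. xmon (A i)) = (\<Sum>j\<in>J. xmon (B j))"
  shows "(\<Sum>i\<in>I. f (A i)) = (\<Sum>j\<in>J. f (B j) :: 'a :: comm_monoid_add)"
proof -
  have cnt: "int (count (image_mset A (mset_set I)) M) = xcoeff (\<Sum>i\<in>I. xmon (A i)) M"
    if "finite I" for A M and I :: "'i set"
    using that by (induction I rule: finite_induct) (auto simp: xcoeff_0 xcoeff_add xcoeff_xmon)
  have "image_mset A (mset_set I) = image_mset B (mset_set J)"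
  proof (rule multiset_eqI)
    fix M show "count (image_mset A (mset_set I)) M = count (image_mset B (mset_set J)) M"
      using cnt[OF assms(1), of A M] cnt[OF assms(2), of B M] eq by simp
  qed
  then have "image_mset f (image_mset A (mset_set I)) = image_mset f (image_mset B (mset_set J))" by simp
  then show ?thesis by (simp add: sum_unfold_sum_mset multiset.map_comp comp_def)
qed

lemma bschur_column:
  "bschur N (addv (\<lambda>_. 0) {..<n}) = (\<Sum>S | S \<subseteq> {..<N} \<and> card S = n. xmon (mset_set S))"
proof (rule xseries_eqI)
  fix M
  let ?c = "addv (\<lambda>_. 0) {..<n}"
  let ?A = "{S. S \<subseteq> {..<N} \<and> card S = n}"
  have finA: "finite ?A" by simp
  have fin: "finite S" if "S \<in> ?A" for S using that finite_subset by auto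
  have R: "xcoeff (\<Sum>S\<in>?A. xmon (mset_set S)) M = (\<Sum>S\<in>?A. of_bool (M = mset_set S))"
    by (simp add: xcoeff_sum xcoeff_xmon)
  show "xcoeff (bschur N ?c) M = xcoeff (\<Sum>S\<in>?A. xmon (mset_set S)) M"
  proof (cases "set_mset M \<subseteq> {..<N}")
    case True
    have L: "xcoeff (bschur N ?c) M = (if size M = n \<and> (\<forall>i. count M i \<le> 1) then 1 else 0)"
      unfolding xcoeff_yschur[OF ypart_column True, symmetric] elem_sym_yschur[symmetric]
      by (simp add: elem_sym_def)
    show ?thesis
    proof (cases "size M = n \<and> (\<forall>i. count M i \<le> 1)")
      case cond: True
      have M: "M = mset_set (set_mset M)"
      proof (rule multiset_eqI)
        fix i have "count M i \<le> 1" using cond by blast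
        then show "count M i = count (mset_set (set_mset M)) i"
          by (cases "i \<in># M") (auto simp: not_in_iff le_less simp flip: count_greater_zero_iff)
      qed
      then have "card (set_mset M) = n" using cond by (metis size_mset_set)
      then have mem: "set_mset M \<in> ?A" using True by simp
      have "M = mset_set S \<longleftrightarrow> S = set_mset M" if "S \<in> ?A" for S
        using M fin[OF that] by (metis finite_set_mset_mset_set)
      then have "(\<Sum>S\<in>?A. of_bool (M = mset_set S)) = (\<Sum>S\<in>?A. if S = set_mset M then 1 else 0)"
        by (intro sum.cong) auto
      also have "\<dots> = 1" using mem finA by (simp only: sum.delta if_True)
      finally have "(\<Sum>S\<in>?A. of_bool (M = mset_set S)) = (1 :: int)" .
      moreover have "xcoeff (bschur N ?c) M = 1" unfolding L by (rule if_P[OF cond])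
      ultimately show ?thesis using R by (simp only:)
    next
      case False
      have "M \<noteq> mset_set S" if "S \<in> ?A" for S
      proof
        assume M: "M = mset_set S"
        then have "size M = n" "count M i \<le> 1" for i
          using that fin[OF that] by (simp_all add: count_mset_set')
        then show False using False by blast
      qed
      then have "(\<Sum>S\<in>?A. of_bool (M = mset_set S)) = (0 :: int)" by simp
      moreover have "xcoeff (bschur N ?c) M = 0" unfolding L by (rule if_not_P[OF False])
      ultimately show ?thesis using R by (simp only:)
    qed
  next
    case False
    have "{T \<in> btableaux N ?c. tcontent ?c T = M} = {}"
      using False finite_cells[OF ypart_column, of n] by (auto simp: btableaux_def tcontent_def)
    moreover have "M \<noteq> mset_set S" if "S \<in> ?A" for S
      using False that fin[OF that] by auto
    then have "(\<Sum>S\<in>?A. of_bool (M = mset_set S)) = (0 :: int)" by simp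
    ultimately show ?thesis unfolding R xcoeff_bschur[OF ypart_column] by (simp only: card.empty of_nat_0)
  qed
qed

subsection \<open>Tableaux as sequences of columns\<close>

text \<open>The last column is compared with \<open>C\<close>, its neighbour on the right, which
  makes the family match the recursion of \<open>col_sum\<close>.\<close>

definition col_chains :: "nat \<Rightarrow> (nat \<Rightarrow> nat) \<Rightarrow> nat \<Rightarrow> nat set \<Rightarrow> (nat \<Rightarrow> nat set) set" where
  "col_chains N l m C = {X \<in> extensional {..<m}. \<forall>j<m. X j \<subseteq> {..<N} \<and> card (X j) = l j \<and>
     dominates (X j) (if Suc j < m then X (Suc j) else C)}"

lemma finite_col_chains: "finite (col_chains N l m C)"
proof (rule finite_subset)
  show "col_chains N l m C \<subseteq> PiE {..<m} (\<lambda>_. Pow {..<N})"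
  proof
    fix X assume "X \<in> col_chains N l m C"
    then have "X \<in> extensional {..<m}" "\<And>j. j < m \<Longrightarrow> X j \<subseteq> {..<N}" unfolding col_chains_def by blast+
    then show "X \<in> PiE {..<m} (\<lambda>_. Pow {..<N})" by (simp add: PiE_iff)
  qed
qed (simp add: finite_PiE)

lemma col_sum_chains:
  "col_sum N (rev (map l [0..<m])) C F = (\<Sum>X\<in>col_chains N l m C. F (\<lambda>i. card {j. j < m \<and> i \<in> X j}))"
proof (induction m arbitrary: C F)
  case 0
  have "col_chains N l 0 C = {\<lambda>_. undefined}" by (auto simp: col_chains_def)
  then show ?case by simp
next
  case (Suc m)
  let ?S = "SIGMA D:dom_cols N (l m) C. col_chains N l m D"
  have bij: "bij_betw (\<lambda>(D, X). X(m := D)) ?S (col_chains N l (Suc m) C)"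
  proof (rule bij_betw_byWitness[where f' = "\<lambda>X. (X m, restrict X {..<m})"])
    show "\<forall>DX\<in>?S. (\<lambda>X. (X m, restrict X {..<m})) ((\<lambda>(D, X). X(m := D)) DX) = DX"
      by (auto simp: col_chains_def extensional_def restrict_def fun_eq_iff)
    show "\<forall>X\<in>col_chains N l (Suc m) C. (\<lambda>(D, X). X(m := D)) (X m, restrict X {..<m}) = X"
      by (auto simp: col_chains_def extensional_def restrict_def fun_eq_iff)
    show "(\<lambda>(D, X). X(m := D)) ` ?S \<subseteq> col_chains N l (Suc m) C"

    proof
      fix Y assume "Y \<in> (\<lambda>(D, X). X(m := D)) ` ?S"
      then obtain D X where Y: "Y = X(m := D)" and D: "D \<in> dom_cols N (l m) C" and X: "X \<in> col_chains N l m D"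
        by auto
      have "Y \<in> extensional {..<Suc m}" using X by (auto simp: Y col_chains_def extensional_def)
      moreover have "Y j \<subseteq> {..<N} \<and> card (Y j) = l j \<and> dominates (Y j) (if Suc j < Suc m then Y (Suc j) else C)"
        if "j < Suc m" for j
      proof (cases "j = m")
        case False
        then have j: "j < m" using that by simp
        have *: "X j \<subseteq> {..<N} \<and> card (X j) = l j \<and> dominates (X j) (if Suc j < m then X (Suc j) else D)"
          using X j unfolding col_chains_def by blast
        show ?thesis
        proof (cases "Suc j = m")
          case True
          then show ?thesis using * j by (auto simp: Y)
        qed (use * j in \<open>auto simp: Y\<close>)
      qed (use D in \<open>simp add: Y dom_cols_def\<close>)
      ultimately show "Y \<in> col_chains N l (Suc m) C" unfolding col_chains_def by blast
    qed
    show "(\<lambda>X. (X m, restrict X {..<m})) ` col_chains N l (Suc m) C \<subseteq> ?S"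
    proof
      fix Y assume "Y \<in> (\<lambda>X. (X m, restrict X {..<m})) ` col_chains N l (Suc m) C"
      then obtain X where Y: "Y = (X m, restrict X {..<m})" and X: "X \<in> col_chains N l (Suc m) C" by auto
      have "X m \<in> dom_cols N (l m) C" using X by (auto simp: col_chains_def dom_cols_def)
      moreover have "restrict X {..<m} \<in> col_chains N l m (X m)"
      proof -
        have dom: "dominates (X j) (if Suc j < m then X (Suc j) else X m)" if "j < m" for j
        proof -
          have "dominates (X j) (X (Suc j))"
          proof -
            have "dominates (X j) (if Suc j < Suc m then X (Suc j) else C)"
              using X that unfolding col_chains_def by (blast intro: less_SucI)
            then show ?thesis using that by simp
          qed
          moreover have "Suc j = m" if "\<not> Suc j < m" using \<open>j < m\<close> that by simp
          ultimately show ?thesis by auto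
        qed
        have "X j \<subseteq> {..<N} \<and> card (X j) = l j" if "j < m" for j
          using X less_SucI[OF that] unfolding col_chains_def by blast
        then have "restrict X {..<m} j \<subseteq> {..<N} \<and> card (restrict X {..<m} j) = l j \<and>
            dominates (restrict X {..<m} j) (if Suc j < m then restrict X {..<m} (Suc j) else X m)" if "j < m" for j
          using dom[OF that] that by (cases "Suc j < m") auto
        then show ?thesis unfolding col_chains_def using restrict_extensional by blast
      qed
      ultimately show "Y \<in> ?S" using Y by simp
    qed
  qed
  have "col_sum N (rev (map l [0..<Suc m])) C F =
      (\<Sum>D\<in>dom_cols N (l m) C. \<Sum>X\<in>col_chains N l m D. F (addv (\<lambda>i. card {j. j < m \<and> i \<in> X j}) D))"
    by (simp add: Suc.IH)
  also have "\<dots> = (\<Sum>(D, X)\<in>?S. F (addv (\<lambda>i. card {j. j < m \<and> i \<in> X j}) D))"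
    by (rule sum.Sigma) (auto simp: finite_dom_cols finite_col_chains)
  also have "\<dots> = (\<Sum>DX\<in>?S. F (\<lambda>i. card {j. j < Suc m \<and> i \<in> (\<lambda>(D, X). X(m := D)) DX j}))"
  proof (intro sum.cong refl)
    fix DX assume "DX \<in> ?S"
    obtain D X where DX: "DX = (D, X)" by (cases DX)
    have "addv (\<lambda>i. card {j. j < m \<and> i \<in> X j}) D i = card {j. j < Suc m \<and> i \<in> (X(m := D)) j}" for i
    proof -
      have "{j. j < Suc m \<and> i \<in> (X(m := D)) j} = {j. j < m \<and> i \<in> X j} \<union> (if i \<in> D then {m} else {})"
        by (auto simp: less_Suc_eq split: if_splits)
      then show ?thesis by (simp add: addv_def)
    qed
    then have "addv (\<lambda>i. card {j. j < m \<and> i \<in> X j}) D = (\<lambda>i. card {j. j < Suc m \<and> i \<in> (X(m := D)) j})" by blast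
    then show "(case DX of (D, X) \<Rightarrow> F (addv (\<lambda>i. card {j. j < m \<and> i \<in> X j}) D)) =
        F (\<lambda>i. card {j. j < Suc m \<and> i \<in> (\<lambda>(D, X). X(m := D)) DX j})" by (simp only: DX case_prod_conv)
  qed
  also have "\<dots> = (\<Sum>X\<in>col_chains N l (Suc m) C. F (\<lambda>i. card {j. j < Suc m \<and> i \<in> X j}))"
    by (rule sum.reindex_bij_betw[OF bij])
  finally show ?case .
qed

text \<open>The indices of the values below \<open>k\<close> form an initial segment. This
  translates dominance of columns, a comparison of counts, into a comparison of entries in the same
  row.\<close>

lemma strict_mono_count:
  fixes f :: "nat \<Rightarrow> nat"
  assumes "\<And>i j. i < j \<Longrightarrow> j < n \<Longrightarrow> f i < f j" "i < n"
  shows "f i < k \<longleftrightarrow> i < card (f ` {..<n} \<inter> {..<k})"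
proof -
  have inj: "inj_on f {..<n}" using assms(1) by (intro linorder_inj_onI') (auto simp: less_imp_neq)
  define A where "A = {i. i < n \<and> f i < k}"
  have down: "j \<in> A" if "i \<in> A" "j \<le> i" for i j
    using that assms(1)[of j i] by (cases "j = i") (auto simp: A_def)
  have fin: "finite A" by (simp add: A_def)
  have "\<exists>m. A = {..<m}"
  proof (cases "A = {}")
    case False
    have "A = {..<Suc (Max A)}"
      using down[OF Max_in[OF fin False]] Max_ge[OF fin] by (auto simp: less_Suc_eq_le)
    then show ?thesis ..
  qed (auto intro: exI[of _ 0])
  then have "A = {..<card A}" by auto
  moreover have "f ` {..<n} \<inter> {..<k} = f ` A" by (auto simp: A_def)
  moreover have "card (f ` A) = card A"
    by (rule card_image, rule inj_on_subset[OF inj]) (auto simp: A_def)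
  moreover have "i \<in> A \<longleftrightarrow> i < card A" using \<open>A = {..<card A}\<close> by blast
  moreover have "i \<in> A \<longleftrightarrow> f i < k" using assms(2) by (simp add: A_def)
  ultimately show ?thesis by simp
qed

lemma sorted_list_of_image:
  fixes f :: "nat \<Rightarrow> nat"
  assumes "\<And>i j. i < j \<Longrightarrow> j < n \<Longrightarrow> f i < f j"
  shows "sorted_list_of_set (f ` {..<n}) = map f [0..<n]"
proof -
  have "sorted_wrt (<) (map f [0..<n])" using assms by (simp add: sorted_wrt_iff_nth_less)
  then have "sorted_list_of_set (set (map f [0..<n])) = map f [0..<n]"
    by (intro sorted_list_of_set.idem_if_sorted_distinct) (auto simp: strict_sorted_iff)
  then show ?thesis by (simp add: atLeast0LessThan)
qed

lemma tableaux_col_less: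
  assumes T: "T \<in> tableaux p" and p: "ypart p" and "i < i'" "j < p i'"
  shows "T (i, j) < T (i', j)"
  using assms(3,4)
proof (induction i' rule: less_Suc_induct)
  case (1 i)
  then show ?case using T by (simp add: tableaux_def)
next
  case (2 i i' i'')
  then have "j < p i'" using ypart_mono[OF p, of i' i''] by simp
  then show ?case using 2 by (auto intro: less_trans)
qed

text \<open>A strictly increasing column is determined by its set of entries, and for neighbouring
  columns weakly increasing rows amount to dominance.\<close>

lemma bij_btableaux_cols:
  fixes N :: nat
  assumes p: "ypart p"
  shows "bij_betw (\<lambda>T. \<lambda>j\<in>{..<p 0}. (\<lambda>i. T (i, j)) ` {..<yconj p j}) (btableaux N p) (col_chains N (yconj p) (p 0) {})"
proof (rule bij_betw_byWitness[where f' = "\<lambda>X. \<lambda>(i, j)\<in>cells p. sorted_list_of_set (X j) ! i"])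
  have cell: "i < yconj p j \<longleftrightarrow> j < p i" for i j by (rule less_yconj_iff[OF p])
  have p0: "j < p 0" if "j < p i" for i j using that ypart_mono[OF p, of 0 i] by simp
  have incr: "T (i, j) < T (i', j)" if "T \<in> tableaux p" "i < i'" "i' < yconj p j" for T i i' j
    using tableaux_col_less[OF that(1) p that(2)] that(3) cell by blast
  let ?col = "\<lambda>T. \<lambda>j\<in>{..<p 0}. (\<lambda>i. T (i, j)) ` {..<yconj p j}"
  let ?tab = "\<lambda>X. \<lambda>(i, j)\<in>cells p. sorted_list_of_set (X j) ! i"
  show "\<forall>T\<in>btableaux N p. ?tab (?col T) = T"
  proof
    fix T assume "T \<in> btableaux N p"
    then have T: "T \<in> tableaux p" by (simp add: btableaux_def)
    show "?tab (?col T) = T"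
    proof (rule ext)
      fix x :: "nat \<times> nat" obtain i j where x: "x = (i, j)" by (cases x)
      show "?tab (?col T) x = T x"
      proof (cases "j < p i")
        case True
        then have "sorted_list_of_set ((\<lambda>i. T (i, j)) ` {..<yconj p j}) ! i = T (i, j)"
          using sorted_list_of_image[of "yconj p j" "\<lambda>i. T (i, j)"] incr[OF T] cell by simp
        then show ?thesis using True p0 by (simp add: x)
      next
        case False
        then have "x \<notin> cells p" by (simp add: x)
        moreover have "T \<in> extensional (cells p)" using T by (simp add: tableaux_def)
        ultimately have "T x = undefined" by (intro extensional_arb)
        then show ?thesis using \<open>x \<notin> cells p\<close> by (simp only: restrict_apply if_False)
      qed
    qed
  qed
  have X: "finite (X j)" "length (sorted_list_of_set (X j)) = yconj p j" "set (sorted_list_of_set (X j)) = X j"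
    if "X \<in> col_chains N (yconj p) (p 0) {}" "j < p 0" for X j
    using that finite_subset[of "X j" "{..<N}"] by (auto simp: col_chains_def)
  have colX: "(\<lambda>i. sorted_list_of_set (X j) ! i) ` {..<yconj p j} = X j"
    if "X \<in> col_chains N (yconj p) (p 0) {}" "j < p 0" for X j
    using X[OF that] by (metis atLeast_upt list.set_map map_nth)
  show "\<forall>X\<in>col_chains N (yconj p) (p 0) {}. ?col (?tab X) = X"
  proof
    fix X assume XX: "X \<in> col_chains N (yconj p) (p 0) {}"
    show "?col (?tab X) = X"
    proof (rule ext)
      fix j show "?col (?tab X) j = X j"
      proof (cases "j < p 0")
        case True
        have "(\<lambda>i. ?tab X (i, j)) ` {..<yconj p j} = (\<lambda>i. sorted_list_of_set (X j) ! i) ` {..<yconj p j}"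
          by (rule image_cong) (auto simp: cell)
        then show ?thesis using colX[OF XX True] True by simp
      qed (use XX in \<open>simp add: col_chains_def extensional_def\<close>)
    qed
  qed
  show "?col ` btableaux N p \<subseteq> col_chains N (yconj p) (p 0) {}"
  proof
    fix Y assume "Y \<in> ?col ` btableaux N p"
    then obtain T where Y: "Y = ?col T" and TN: "T \<in> btableaux N p" by auto
    then have T: "T \<in> tableaux p" by (simp add: btableaux_def)
    have inj: "inj_on (\<lambda>i. T (i, j)) {..<yconj p j}" for j
      using incr[OF T] by (intro linorder_inj_onI') (auto simp: less_imp_neq)
    have "dominates ((\<lambda>i. T (i, j)) ` {..<yconj p j}) ((\<lambda>i. T (i, Suc j)) ` {..<yconj p (Suc j)})" for j
      unfolding dominates_def
    proof
      fix k
      let ?A = "\<lambda>j. {i. i < yconj p j \<and> T (i, j) < k}"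
      have im: "(\<lambda>i. T (i, j)) ` {..<yconj p j} \<inter> {..<k} = (\<lambda>i. T (i, j)) ` ?A j" for j by auto
      have card: "card ((\<lambda>i. T (i, j)) ` {..<yconj p j} \<inter> {..<k}) = card (?A j)" for j
        unfolding im by (rule card_image, rule inj_on_subset[OF inj]) auto
      have "?A (Suc j) \<subseteq> ?A j"
      proof
        fix i assume "i \<in> ?A (Suc j)"
        then have i: "Suc j < p i" "T (i, Suc j) < k" by (auto simp: cell)
        then have "T (i, j) \<le> T (i, Suc j)" using T by (simp add: tableaux_def)
        then show "i \<in> ?A j" using i by (simp add: cell)
      qed
      then show "card ((\<lambda>i. T (i, Suc j)) ` {..<yconj p (Suc j)} \<inter> {..<k}) \<le>
          card ((\<lambda>i. T (i, j)) ` {..<yconj p j} \<inter> {..<k})"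
        unfolding card by (intro card_mono) auto
    qed
    moreover have "(\<lambda>i. T (i, j)) ` {..<yconj p j} \<subseteq> {..<N}" for j
      using TN by (auto simp: btableaux_def cell)
    moreover have "dominates D {}" for D by (simp add: dominates_def)
    ultimately show "Y \<in> col_chains N (yconj p) (p 0) {}"
      using inj by (simp add: Y col_chains_def card_image)
  qed
  show "?tab ` col_chains N (yconj p) (p 0) {} \<subseteq> btableaux N p"
  proof
    fix T assume "T \<in> ?tab ` col_chains N (yconj p) (p 0) {}"
    then obtain Y where T: "T = ?tab Y" and Y: "Y \<in> col_chains N (yconj p) (p 0) {}" by auto
    define e where "e = (\<lambda>j i. sorted_list_of_set (Y j) ! i)"
    have Te: "T (i, j) = e j i" if "j < p i" for i j using that by (simp add: T e_def)
    have e1: "e j i < e j i'" if "i < i'" "i' < yconj p j" "j < p 0" for i i' j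
      using X(2)[OF Y that(3)] that strict_sorted_list_of_set[of "Y j"]
      unfolding e_def sorted_wrt_iff_nth_less by auto
    have e2: "e j i < N" if "j < p i" for i j
    proof -
      have "e j i \<in> Y j" using X[OF Y p0[OF that]] that cell nth_mem unfolding e_def by metis
      then show ?thesis using Y p0[OF that] by (auto simp: col_chains_def)
    qed
    have e3: "e j i \<le> e (Suc j) i" if "Suc j < p i" for i j
    proof -
      \<comment> \<open>Column \<open>j + 1\<close> has more than \<open>i\<close> entries below
        this \<open>k\<close>, so by dominance column \<open>j\<close> has as well, and its
        \<open>i\<close>-th entry is among them.\<close>
      define k where "k = Suc (e (Suc j) i)"
      have j: "Suc j < p 0" "j < p i" "j < p 0" using p0[OF that] that by auto
      have i: "i < yconj p (Suc j)" "i < yconj p j" using that j cell by auto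
      have im: "e j ` {..<yconj p j} = Y j" if "j < p 0" for j using colX[OF Y that] by (simp add: e_def)
      have "i < card (Y (Suc j) \<inter> {..<k})"
        using strict_mono_count[of "yconj p (Suc j)" "e (Suc j)" i k] e1 i j im[OF j(1)] by (simp add: k_def)
      also have "\<dots> \<le> card (Y j \<inter> {..<k})"

      proof -
        have "dominates (Y j) (if Suc j < p 0 then Y (Suc j) else {})"
          using Y j(3) unfolding col_chains_def by blast
        then show ?thesis using j(1) by (simp add: dominates_def)
      qed
      finally have "e j i < k"
        using strict_mono_count[of "yconj p j" "e j" i k] e1 i j im[OF j(3)] by simp
      then show ?thesis by (simp add: k_def)
    qed
    have "T (i, j) \<le> T (i, Suc j)" if "Suc j < p i" for i j
      using Te[of j i] Te[of "Suc j" i] e3[OF that] that by simp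
    moreover have "T (i, j) < T (Suc i, j)" if "j < p (Suc i)" for i j
    proof -
      have "j < p i" using that ypart_mono_Suc[OF p, of i] by simp
      then show ?thesis using Te[OF that] Te[of j i] e1[of i "Suc i" j] that cell p0 by simp
    qed
    moreover have "T x < N" if "x \<in> cells p" for x
      using that Te e2 by (cases x) auto
    moreover have "T \<in> extensional (cells p)" by (simp add: T)
    ultimately show "T \<in> btableaux N p" by (simp add: btableaux_def tableaux_def)
  qed
qed

lemma tableaux_sum_cols:
  assumes p: "ypart p"
  shows "(\<Sum>T\<in>btableaux N p. F (count (tcontent p T))) = col_sum N (rev (map (yconj p) [0..<p 0])) {} F"
proof -
  let ?col = "\<lambda>T. \<lambda>j\<in>{..<p 0}. (\<lambda>i. T (i, j)) ` {..<yconj p j}"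
  have "count (tcontent p T) k = card {j. j < p 0 \<and> k \<in> ?col T j}" if T: "T \<in> btableaux N p" for T k
  proof -
    have T': "T \<in> tableaux p" using T by (simp add: btableaux_def)
    have inj: "inj_on snd {x \<in> cells p. T x = k}"
    proof (rule inj_onI, clarsimp)
      fix i i' j assume a: "j < p i" "j < p i'" "T (i', j) = T (i, j)"
      then show "i = i'"
        using tableaux_col_less[OF T' p, of i i' j] tableaux_col_less[OF T' p, of i' i j] by (metis nat_neq_iff)
    qed
    have "snd ` {x \<in> cells p. T x = k} = {j. j < p 0 \<and> k \<in> ?col T j}"
    proof (intro equalityI subsetI)
      fix j assume "j \<in> snd ` {x \<in> cells p. T x = k}"
      then obtain i where i: "j < p i" "T (i, j) = k" by auto
      then have "j < p 0" using ypart_mono[OF p, of 0 i] by simp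
      then show "j \<in> {j. j < p 0 \<and> k \<in> ?col T j}" using i less_yconj_iff[OF p, of i j] by auto
    next
      fix j assume "j \<in> {j. j < p 0 \<and> k \<in> ?col T j}"
      then obtain i where "i < yconj p j" "k = T (i, j)" by auto
      then show "j \<in> snd ` {x \<in> cells p. T x = k}"
        using less_yconj_iff[OF p, of i j] by (intro image_eqI[of _ _ "(i, j)"]) auto
    qed
    then show ?thesis using card_image[OF inj] by (simp only: count_tcontent[OF p])
  qed
  then have "count (tcontent p T) = (\<lambda>k. card {j. j < p 0 \<and> k \<in> ?col T j})" if "T \<in> btableaux N p" for T
    using that by blast
  then have "(\<Sum>T\<in>btableaux N p. F (count (tcontent p T))) =
      (\<Sum>T\<in>btableaux N p. F (\<lambda>k. card {j. j < p 0 \<and> k \<in> ?col T j}))" by (intro sum.cong) auto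
  also have "\<dots> = (\<Sum>X\<in>col_chains N (yconj p) (p 0) {}. F (\<lambda>k. card {j. j < p 0 \<and> k \<in> X j}))"
    by (rule sum.reindex_bij_betw[OF bij_btableaux_cols[OF p]])
  finally show ?thesis by (simp add: col_sum_chains)
qed

subsection \<open>Products of Schur functions are Schur-positive\<close>

definition straighten :: "nat \<Rightarrow> ((nat \<Rightarrow> nat) \<Rightarrow> xseries) \<Rightarrow> (nat \<Rightarrow> nat) \<Rightarrow> (nat \<Rightarrow> nat) \<Rightarrow> xseries" where
  "straighten N \<phi> p g = antisymmetrize N (on_shape N \<phi>) (\<lambda>i. shifted N p i + g i)"

text \<open>
  Brauer and Klimyk's formula: adding the weights of all tableaux and straightening is compatible
  with the Pieri rule, and the Pieri rule determines the product.
\<close>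

lemma straighten_tableaux:
  assumes \<phi>: "pieri \<phi> c" and q: "ypart q" and p: "ypart p" and N: "ysize p + ysize q \<le> N"
  shows "(\<Sum>T\<in>btableaux N q. straighten N \<phi> p (count (tcontent q T))) = \<phi> p * \<phi> q"
  using q N
proof (induction q rule: ypart_induct)
  case zero
  have p0: "p i = 0" if "N \<le> i" for i using ysize_gt_length[OF p, of i] that zero by force
  have c: "cells (\<lambda>_. 0) = {}" by (auto simp: cells_def)
  have "btableaux N (\<lambda>_. 0) = {\<lambda>_. undefined}" by (auto simp: btableaux_def tableaux_def c)
  then have "(\<Sum>T\<in>btableaux N (\<lambda>_. 0). straighten N \<phi> p (count (tcontent (\<lambda>_. 0) T))) =
      antisymmetrize N (on_shape N \<phi>) (shifted N p)"
    by (simp add: tcontent_def c straighten_def)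
  also have "\<dots> = \<phi> p" using antisym_on_shape[OF decr_on_shifted[OF p]] shape_shifted[OF p0] by simp
  finally show ?case using \<phi> by (simp add: pieri_def)
next
  case (add n q)
  note N = add.prems
  have q: "ypart q" by fact
  let ?col = "addv (\<lambda>_. 0) {..<n}"
  let ?A = "{S. S \<subseteq> {..<N} \<and> card S = n}"
  let ?F = "straighten N \<phi> p"
  define \<Psi> where "\<Psi> = (\<lambda>q. \<Sum>T\<in>btableaux N q. ?F (count (tcontent q T)))"
  have size: "ysize (addv q {..<n}) = ysize q + n" using ysize_addv[OF q, of "{..<n}"] by simp
  have yv: "ypart r" if "r \<in> vstrips n q" for r using that by (simp add: vstrips_def)
  obtain d where d: "pieri (bschur N) d" using ex_pieri_bschur by blast
  have "(\<Sum>r\<in>vstrips n q. bschur N r) = bschur N ?col * bschur N q"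
    unfolding pieri_nth[OF d, of n, symmetric] using d q unfolding pieri_def by simp
  then have "(\<Sum>(r, T)\<in>(SIGMA r:vstrips n q. btableaux N r). xmon (tcontent r T)) =
      (\<Sum>(S, T)\<in>?A \<times> btableaux N q. xmon (mset_set S + tcontent q T))"
    unfolding bschur_column unfolding bschur_def sum_product xmon_add
    by (subst (asm) sum.Sigma[OF finite_vstrips[OF q]]) (auto simp: yv finite_btableaux sum.cartesian_product)
  then have "(\<Sum>x\<in>(SIGMA r:vstrips n q. btableaux N r). xmon ((\<lambda>(r, T). tcontent r T) x)) =
      (\<Sum>x\<in>?A \<times> btableaux N q. xmon ((\<lambda>(S, T). mset_set S + tcontent q T) x))"
    by (simp add: case_prod_beta)
  \<comment> \<open>The Pieri rule for Schur polynomials is an equality of sums of monomials and so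
    remains true with the straightened values in their place.\<close>
  then have "(\<Sum>x\<in>(SIGMA r:vstrips n q. btableaux N r). ?F (count ((\<lambda>(r, T). tcontent r T) x))) =
      (\<Sum>x\<in>?A \<times> btableaux N q. ?F (count ((\<lambda>(S, T). mset_set S + tcontent q T) x)))"
  proof (rule xmon_sum_transfer[where f = "\<lambda>M. ?F (count M)", rotated 2])
    show "finite (SIGMA r:vstrips n q. btableaux N r)"
      by (rule finite_SigmaI[OF finite_vstrips[OF q]]) (auto simp: vstrips_def finite_btableaux)
    show "finite (?A \<times> btableaux N q)" using finite_btableaux[OF q] by simp
  qed
  then have "(\<Sum>r\<in>vstrips n q. \<Psi> r) = (\<Sum>S\<in>?A. \<Sum>T\<in>btableaux N q. ?F (count (mset_set S + tcontent q T)))"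
    unfolding \<Psi>_def
    by (subst sum.Sigma[OF finite_vstrips[OF q]]) (auto simp: yv finite_btableaux sum.cartesian_product case_prod_beta)
  also have "\<dots> = (\<Sum>T\<in>btableaux N q. \<Sum>S\<in>?A. ?F (count (mset_set S + tcontent q T)))"
    by (rule sum.swap)
  also have "\<dots> = (\<Sum>T\<in>btableaux N q. fps_nth c n * ?F (count (tcontent q T)))"
  proof (intro sum.cong refl)
    fix T assume T: "T \<in> btableaux N q"
    let ?b = "\<lambda>i. shifted N p i + count (tcontent q T) i"
    have sub: "set_mset (tcontent q T) \<subseteq> {..<N}"
      using T finite_cells[OF q] by (auto simp: btableaux_def tcontent_def)
    have "(\<Sum>i<N. count (tcontent q T) i) = size (tcontent q T)"
      unfolding size_multiset_overloaded_eq using sub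
      by (intro sum.mono_neutral_right) (auto simp: not_in_iff)
    also have "\<dots> = ysize q" by (simp add: tcontent_def ysize_def)
    finally have sT: "(\<Sum>i<N. count (tcontent q T) i) = ysize q" .
    have p0: "p i = 0" if "N \<le> i" for i using ysize_gt_length[OF p, of i] that N by force
    have le: "(\<Sum>i<N. ?b i) + n \<le> N + (\<Sum>i<N. N - 1 - i)"
      unfolding shifted_def sum.distrib using N size sT ysize_sum[of p N, OF p p0] by linarith
    have "(\<Sum>S\<in>?A. ?F (count (mset_set S + tcontent q T))) =
        (\<Sum>S\<in>?A. antisymmetrize N (on_shape N \<phi>) (addv ?b S))"
    proof (intro sum.cong refl)
      fix S assume "S \<in> ?A"
      then have "finite S" using finite_subset by auto
      then have "(\<lambda>i. shifted N p i + count (mset_set S + tcontent q T) i) = addv ?b S"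
        by (auto simp: addv_def count_mset_set')
      then show "?F (count (mset_set S + tcontent q T)) = antisymmetrize N (on_shape N \<phi>) (addv ?b S)"
        by (simp only: straighten_def)
    qed
    also have "\<dots> = fps_nth c n * ?F (count (tcontent q T))"
      unfolding straighten_def by (rule pieri_antisym[OF \<phi> le])
    finally show "(\<Sum>S\<in>?A. ?F (count (mset_set S + tcontent q T))) = \<dots>" .
  qed
  also have "\<dots> = fps_nth c n * \<Psi> q" by (simp add: \<Psi>_def sum_distrib_left)
  also have "\<Psi> q = \<phi> p * \<phi> q" unfolding \<Psi>_def using add.IH(1)[OF q] add N size by simp
  finally have sum: "(\<Sum>r\<in>vstrips n q. \<Psi> r) = fps_nth c n * (\<phi> p * \<phi> q)" .
  let ?B = "vstrips n q - {addv q {..<n}}"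
  have mem: "addv q {..<n} \<in> vstrips n q" by (rule addv_initial_in_vstrips) fact+
  have "\<Psi> (addv q {..<n}) = (\<Sum>r\<in>vstrips n q. \<Psi> r) - (\<Sum>r\<in>?B. \<Psi> r)"
    using mem finite_vstrips[OF q] by (simp add: sum_diff1)
  also have "(\<Sum>r\<in>?B. \<Psi> r) = (\<Sum>r\<in>?B. \<phi> p * \<phi> r)"
    unfolding \<Psi>_def using add.IH(2) N size by (intro sum.cong) (auto simp: vstrips_def)
  also have "(\<Sum>r\<in>vstrips n q. \<Psi> r) - \<dots> = \<phi> p * \<phi> (addv q {..<n})"
    unfolding sum pieri_column_eq[OF \<phi> q \<open>q n = 0\<close>] by (simp add: algebra_simps sum_distrib_left)
  finally show ?case by (simp add: \<Psi>_def)
qed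

lemma sum_list_family:
  assumes "finite A" "\<And>D. D \<in> A \<Longrightarrow> \<exists>xs. (\<forall>q\<in>set xs. ypart q) \<and> (\<forall>\<phi>. G D \<phi> = (\<Sum>q\<leftarrow>xs. \<phi> q))"
  shows "\<exists>xs. (\<forall>q\<in>set xs. ypart q) \<and> (\<forall>\<phi>. (\<Sum>D\<in>A. G D \<phi>) = (\<Sum>q\<leftarrow>xs. \<phi> q :: xseries))"
  using assms
proof (induction A rule: finite_induct)
  case (insert D A)
  obtain xs where xs: "\<forall>q\<in>set xs. ypart q" "\<And>\<phi>. (\<Sum>D\<in>A. G D \<phi>) = (\<Sum>q\<leftarrow>xs. \<phi> q)"
    using insert.IH insert.prems by (meson insertI2)
  obtain ys where ys: "\<forall>q\<in>set ys. ypart q" "\<And>\<phi>. G D \<phi> = (\<Sum>q\<leftarrow>ys. \<phi> q)"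
    using insert.prems[OF insertI1] by blast
  have "(\<Sum>D\<in>insert D A. G D \<phi>) = (\<Sum>q\<leftarrow>ys @ xs. \<phi> q)" for \<phi>
    unfolding sum.insert[OF insert.hyps] xs(2) ys(2) map_append sum_list_append ..
  moreover have "\<forall>q\<in>set (ys @ xs). ypart q" using xs(1) ys(1) by auto
  ultimately show ?case by blast
qed (auto intro: exI[of _ "[]"])

text \<open>Add the columns to \<open>p\<close> one by one. If \<open>p\<close> with the column
  \<open>D\<close> is no longer a partition, then two equal neighbouring rows have received a cell
  only in the lower one; after the shift these entries coincide, what remains is antisymmetric, and
  \<open>col_sum_anti\<close> makes all continuations vanish together. The fillings that survive
  stay partitions at every stage and contribute with sign +1. The choice of the list does not
  involve \<phi>.\<close>

lemma straighten_positive: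
  assumes "ypart p" "\<And>i. N \<le> i \<Longrightarrow> p i = 0"
  shows "\<exists>xs. (\<forall>q\<in>set xs. ypart q) \<and> (\<forall>\<phi>. col_sum N ns C (straighten N \<phi> p) = (\<Sum>q\<leftarrow>xs. \<phi> q))"
  using assms
proof (induction ns arbitrary: C p)
  case Nil
  have "straighten N \<phi> p (\<lambda>_. 0) = \<phi> p" for \<phi>
    using antisym_on_shape[OF decr_on_shifted[OF Nil(1)]] shape_shifted[of N p] Nil(2)
    by (simp add: straighten_def)
  then show ?case using Nil by (intro exI[of _ "[p]"]) simp
next
  case (Cons n ns)
  have p: "ypart p" and p0: "\<And>i. N \<le> i \<Longrightarrow> p i = 0" by fact+
  have "\<exists>xs. (\<forall>q\<in>set xs. ypart q) \<and>
      (\<forall>\<phi>. col_sum N ns D (\<lambda>g. straighten N \<phi> p (addv g D)) = (\<Sum>q\<leftarrow>xs. \<phi> q))"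
    if D: "D \<in> dom_cols N n C" for D
  proof -
    have sub: "D \<subseteq> {..<N}" and finD: "finite D" using D by (auto simp: dom_cols_def intro: finite_subset)
    have st: "straighten N \<phi> p (addv g D) = antisymmetrize N (on_shape N \<phi>) (\<lambda>i. addv (shifted N p) D i + g i)" for \<phi> g
      by (simp add: straighten_def addv_def add_ac)
    show ?thesis
    proof (cases "ypart (addv p D)")
      case True
      have "addv (shifted N p) D = shifted N (addv p D)" by (auto simp: addv_def shifted_def)
      then have "(\<lambda>g. straighten N \<phi> p (addv g D)) = straighten N \<phi> (addv p D)" for \<phi>
        by (simp only: st) (simp add: straighten_def[abs_def])
      moreover have "addv p D i = 0" if "N \<le> i" for i using that sub p0 by (auto simp: addv_def)
      ultimately show ?thesis using Cons.IH[OF True, of D] by simp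
    next
      case False
      then have "\<not> (\<forall>i. addv p D (Suc i) \<le> addv p D i)" using ypart_addv_iff[OF p finD] decseq_SucI by blast
      then obtain i where i: "addv p D i < addv p D (Suc i)" by (auto simp: not_le)
      have iD: "i \<notin> D" "Suc i \<in> D" "p (Suc i) = p i"
        using i ypart_mono_Suc[OF p, of i] by (auto simp: addv_def of_bool_def split: if_splits)
      then have N: "Suc i < N" using sub by auto
      define b where "b = addv (shifted N p) D"
      have "b i = b (Suc i)" using iD N by (simp add: b_def addv_def shifted_def)
      then have bt: "b (transpose i (Suc i) x) = b x" for x by (auto simp: transpose_def)
      have "anti i (\<lambda>g. straighten N \<phi> p (addv g D))" for \<phi>
        unfolding anti_def st b_def[symmetric]
      proof
        fix g
        have "(\<lambda>x. b x + (g \<circ> transpose i (Suc i)) x) = (\<lambda>x. b x + g x) \<circ> transpose i (Suc i)"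
          by (auto simp: bt)
        then show "antisymmetrize N (on_shape N \<phi>) (\<lambda>x. b x + (g \<circ> transpose i (Suc i)) x) =
            - antisymmetrize N (on_shape N \<phi>) (\<lambda>x. b x + g x)"
          using antisym_transpose[of i N "Suc i" "on_shape N \<phi>"] N by simp
      qed
      then have "col_sum N ns D (\<lambda>g. straighten N \<phi> p (addv g D)) = 0" for \<phi>
        using col_sum_anti(1)[OF N finD] iD by blast
      then show ?thesis by (intro exI[of _ "[]"]) simp
    qed
  qed
  then show ?case unfolding col_sum.simps by (rule sum_list_family[OF finite_dom_cols])
qed

theorem littlewood_richardson_positive:
  assumes p: "ypart p" and q: "ypart q"
  shows "\<exists>xs. (\<forall>r\<in>set xs. ypart r) \<and>
    (\<forall>(\<phi> :: (nat \<Rightarrow> nat) \<Rightarrow> xseries) c. pieri \<phi> c \<longrightarrow> \<phi> p * \<phi> q = (\<Sum>r\<leftarrow>xs. \<phi> r))"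
proof -
  define N where "N = ysize p + ysize q"
  have "p i = 0" if "N \<le> i" for i using ysize_gt_length[OF p, of i] that by (force simp: N_def)
  then obtain xs where xs: "\<forall>r\<in>set xs. ypart r"
    "\<And>\<phi>. col_sum N (rev (map (yconj q) [0..<q 0])) {} (straighten N \<phi> p) = (\<Sum>r\<leftarrow>xs. \<phi> r)"
    using straighten_positive[OF p] by meson
  have "\<phi> p * \<phi> q = (\<Sum>r\<leftarrow>xs. \<phi> r)" if "pieri \<phi> c" for \<phi> :: "(nat \<Rightarrow> nat) \<Rightarrow> xseries" and c
    using straighten_tableaux[OF that q p, where N = N] tableaux_sum_cols[OF q, where N = N and F = "straighten N \<phi> p"] xs(2)
    by (simp add: N_def)
  then show ?thesis using xs(1) by blast
qed

section \<open>Total positivity\<close>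

subsection \<open>Nonnegative functionals\<close>

definition nonneg :: "((nat \<Rightarrow> nat) \<Rightarrow> real) \<Rightarrow> bool" where
  "nonneg \<phi> \<longleftrightarrow> (\<forall>p. ypart p \<longrightarrow> 0 \<le> \<phi> p)"

text \<open>A cell can be added in the first row where the two differ, since the rows above already
  agree with those of \<open>q\<close>.\<close>

lemma ypart_between:
  assumes p: "ypart p" and q: "ypart q" and le: "\<And>i. p i \<le> q i" and ne: "p \<noteq> q"
  obtains i where "ypart (addv p {i})" "\<And>j. addv p {i} j \<le> q j"
proof -
  define i where "i = (LEAST i. p i < q i)"
  have ex: "\<exists>i. p i < q i" using le ne by (metis ext le_neq_implies_less)
  have i: "p i < q i" unfolding i_def by (rule LeastI_ex[OF ex])
  have eq: "p j = q j" if "j < i" for j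
    using not_less_Least[of j "\<lambda>i. p i < q i"] that le[of j] unfolding i_def by simp
  have "addv p {i} (Suc j) \<le> addv p {i} j" for j
  proof (cases "Suc j = i")
    case True
    then have "Suc (p i) \<le> p j" using i eq[of j] ypart_mono_Suc[OF q, of j] by auto
    then show ?thesis using True by (simp add: addv_def)
  qed (use ypart_mono_Suc[OF p, of j] in \<open>simp add: addv_def\<close>)
  then have "ypart (addv p {i})" using ypart_addv_iff[OF p] by (auto intro: decseq_SucI)
  moreover have "addv p {i} j \<le> q j" for j using le[of j] i by (auto simp: addv_def)
  ultimately show ?thesis by (rule that)
qed

text \<open>The zeros of a nonnegative functional are closed under adding cells: by the rule for
  \<open>n = 1\<close> the values at all partitions with one more cell sum to a multiple of
  \<open>\<phi> p\<close>.\<close>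

lemma pieri_zero_mono:
  assumes \<phi>: "pieri \<phi> c" and nn: "nonneg \<phi>"
    and p: "ypart p" and q: "ypart q" and le: "\<And>i. p i \<le> q i" and zero: "\<phi> p = 0"
  shows "\<phi> q = 0"
  using p le zero
proof (induction "ysize q - ysize p" arbitrary: p rule: less_induct)
  case less
  show ?case
  proof (cases "p = q")
    case False
    then obtain i where i: "ypart (addv p {i})" "\<And>j. addv p {i} j \<le> q j"
      using ypart_between[OF less.prems(1) q less.prems(2)] by blast
    have s: "ysize (addv p {i}) = Suc (ysize p)" using ysize_addv[OF less.prems(1), of "{i}"] by simp
    have "ysize (addv p {i}) \<le> ysize q" by (rule ysize_mono[OF q i(2)])
    then have "ysize q - ysize (addv p {i}) < ysize q - ysize p" using s by simp
    moreover have "\<phi> (addv p {i}) = 0"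
    proof -
      have "(\<Sum>r\<in>vstrips 1 p. \<phi> r) = fps_nth c 1 * \<phi> p" using \<phi> less.prems(1) by (simp add: pieri_def)
      then have "(\<Sum>r\<in>vstrips 1 p. \<phi> r) = 0" using less.prems by simp
      moreover have "\<forall>r\<in>vstrips 1 p. 0 \<le> \<phi> r" using nn by (auto simp: nonneg_def vstrips_def)
      ultimately have "\<forall>r\<in>vstrips 1 p. \<phi> r = 0"
        using sum_nonneg_eq_0_iff[OF finite_vstrips[OF less.prems(1)]] by blast
      moreover have "addv p {i} \<in> vstrips 1 p" using i less.prems(1) by (auto simp: vstrips_eq)
      ultimately show ?thesis by blast
    qed
    ultimately show ?thesis using less.hyps[of "addv p {i}"] i by blast
  qed (use less.prems in simp)
qed

text \<open>Each of the rows \<open>0, ..., k\<close> can receive a cell independently of the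
  others, and all of them together give the next staircase.\<close>

definition stair :: "nat \<Rightarrow> nat \<Rightarrow> nat" where
  "stair k = (\<lambda>i. k - i)"

lemma ypart_stair: "ypart (stair k)"
proof (rule ypartI)
  show "stair k (Suc i) \<le> stair k i" for i unfolding stair_def by linarith
  show "stair k k = 0" by (simp add: stair_def)
qed

lemma ypart_addv_stair:
  assumes "S \<subseteq> {..k}"
  shows "ypart (addv (stair k) S)"
proof (rule ypartI)
  show "addv (stair k) S (Suc i) \<le> addv (stair k) S i" for i
    using assms by (cases "i < k") (auto simp: addv_def stair_def)
  show "addv (stair k) S (Suc k) = 0" using assms by (auto simp: addv_def stair_def)
qed

lemma addv_stair_full: "addv (stair k) {..k} = stair (Suc k)"
proof (rule ext)
  fix i show "addv (stair k) {..k} i = stair (Suc k) i"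
    by (cases "i \<le> k") (simp_all add: addv_def stair_def Suc_diff_le)
qed

text \<open>There are \<open>(k + 1)!\<close> ways to fill the corners of the staircase one by one.\<close>

lemma stair_step:
  assumes \<phi>: "pieri \<phi> c" and nn: "nonneg \<phi>" and c1: "0 \<le> fps_nth c 1"
  shows "T \<subseteq> {..k} \<Longrightarrow> card ({..k} - T) = m \<Longrightarrow>
    fact m * \<phi> (stair (Suc k)) \<le> fps_nth c 1 ^ m * \<phi> (addv (stair k) T)"
proof (induction m arbitrary: T)
  case 0
  then have "T = {..k}" by auto
  then show ?case by (simp add: addv_stair_full)
next
  case (Suc m)
  let ?U = "{..k} - T"
  have y: "ypart (addv (stair k) T)" using Suc.prems by (intro ypart_addv_stair)
  have ins: "addv (addv (stair k) T) {s} = addv (stair k) (insert s T)" if "s \<in> ?U" for s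
    using that by (auto simp: addv_def fun_eq_iff)
  have sub: "(\<lambda>s. addv (addv (stair k) T) {s}) ` ?U \<subseteq> vstrips 1 (addv (stair k) T)"
  proof
    fix q assume "q \<in> (\<lambda>s. addv (addv (stair k) T) {s}) ` ?U"
    then obtain s where s: "s \<in> ?U" "q = addv (addv (stair k) T) {s}" by auto
    have "ypart q" unfolding s(2) ins[OF s(1)] using s Suc.prems by (intro ypart_addv_stair) auto
    then show "q \<in> vstrips 1 (addv (stair k) T)" using s(2) vstrips_eq[OF y, of 1] by auto
  qed
  have inj: "inj_on (\<lambda>s. addv (addv (stair k) T) {s}) ?U"
    by (rule inj_onI) (use inj_addv in \<open>auto dest: injD\<close>)
  have "fact (Suc m) * \<phi> (stair (Suc k)) = (\<Sum>s\<in>?U. fact m * \<phi> (stair (Suc k)))"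
    using Suc.prems(2) by (simp add: algebra_simps)
  also have "\<dots> \<le> (\<Sum>s\<in>?U. fps_nth c 1 ^ m * \<phi> (addv (stair k) (insert s T)))"
  proof (rule sum_mono)
    fix s assume s: "s \<in> ?U"
    have "{..k} - insert s T = ?U - {s}" by auto
    then have "card ({..k} - insert s T) = m" using s Suc.prems(2) by simp
    then show "fact m * \<phi> (stair (Suc k)) \<le> fps_nth c 1 ^ m * \<phi> (addv (stair k) (insert s T))"
      using s Suc.prems by (intro Suc.IH) auto
  qed
  also have "\<dots> = fps_nth c 1 ^ m * (\<Sum>s\<in>?U. \<phi> (addv (addv (stair k) T) {s}))"
    unfolding sum_distrib_left by (intro sum.cong refl) (simp only: ins)
  also have "(\<Sum>s\<in>?U. \<phi> (addv (addv (stair k) T) {s})) = (\<Sum>q\<in>(\<lambda>s. addv (addv (stair k) T) {s}) ` ?U. \<phi> q)"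
    by (simp add: sum.reindex[OF inj])
  also have "\<dots> \<le> (\<Sum>q\<in>vstrips 1 (addv (stair k) T). \<phi> q)"
    using nn by (intro sum_mono2[OF finite_vstrips[OF y] sub]) (auto simp: nonneg_def vstrips_def)
  also have "\<dots> = fps_nth c 1 * \<phi> (addv (stair k) T)" using \<phi> y by (simp add: pieri_def)
  finally show ?case using c1 by (simp add: mult_left_mono mult.assoc power_Suc2 del: fact_Suc power_Suc)
qed

definition vanishes :: "((nat \<Rightarrow> nat) \<Rightarrow> real) \<Rightarrow> nat \<Rightarrow> nat \<Rightarrow> bool" where
  "vanishes \<phi> k n \<longleftrightarrow> (\<forall>p. ypart p \<longrightarrow> (\<forall>i<k. n \<le> p i) \<longrightarrow> \<phi> p = 0)"

lemma nonneg_nth: "pieri \<phi> c \<Longrightarrow> nonneg \<phi> \<Longrightarrow> 0 \<le> fps_nth c n"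
proof -
  assume "pieri \<phi> c" "nonneg \<phi>"
  then have "0 \<le> \<phi> (addv (\<lambda>_. 0) {..<n})" using ypart_column unfolding nonneg_def by blast
  then show ?thesis using pieri_nth[OF \<open>pieri \<phi> c\<close>, of n] by simp
qed

text \<open>By \<open>stair_step\<close>, passing from one staircase to the next multiplies the
  bound by \<open>x ^ (k + 1) / (k + 1)!\<close>, which eventually is less than one half. A
  nonnegative integer below 1 is 0, and a square contains the staircase of the same side.\<close>

lemma integral_vanishes:
  assumes \<phi>: "pieri \<phi> c" and nn: "nonneg \<phi>" and int: "\<And>p. ypart p \<Longrightarrow> \<phi> p \<in> \<int>"
  shows "\<exists>k. vanishes \<phi> k k"
proof -
  define x where "x = fps_nth c 1"
  have x: "0 \<le> x" unfolding x_def by (rule nonneg_nth[OF \<phi> nn])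
  have "(\<lambda>n. x ^ n / fact n) \<longlonglongrightarrow> 0"
    using summable_LIMSEQ_zero[OF summable_exp[of x]] by (simp add: divide_inverse mult.commute)
  then have "eventually (\<lambda>n. x ^ n / fact n < 1 / 2) sequentially" by (rule order_tendstoD) simp
  then obtain K where K: "\<And>n. n \<ge> K \<Longrightarrow> x ^ n / fact n < 1 / 2" by (auto simp: eventually_at_top_linorder)
  have half: "\<phi> (stair (Suc k)) \<le> \<phi> (stair k) / 2" if "k \<ge> K" for k
  proof -
    have "fact (Suc k) * \<phi> (stair (Suc k)) \<le> x ^ Suc k * \<phi> (stair k)"
      using stair_step[OF \<phi> nn x[unfolded x_def], of "{}" k "Suc k"] by (simp add: x_def del: fact_Suc)
    then have "\<phi> (stair (Suc k)) \<le> x ^ Suc k / fact (Suc k) * \<phi> (stair k)"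
      by (simp add: field_simps del: fact_Suc)
    also have "\<dots> \<le> 1 / 2 * \<phi> (stair k)"
      using K[of "Suc k"] that nn ypart_stair by (intro mult_right_mono) (auto simp: nonneg_def)
    finally show ?thesis by simp
  qed
  have bound: "\<phi> (stair (K + m)) \<le> \<phi> (stair K) * (1 / 2) ^ m" for m
  proof (induction m)
    case (Suc m)
    then show ?case using half[of "K + m"] by simp
  qed simp
  have "(\<lambda>m. \<phi> (stair K) * (1 / 2) ^ m) \<longlonglongrightarrow> \<phi> (stair K) * 0"
    by (intro tendsto_mult_left LIMSEQ_realpow_zero) auto
  then have "eventually (\<lambda>m. \<phi> (stair K) * (1 / 2) ^ m < 1) sequentially"
    by (rule order_tendstoD) simp
  then obtain m where "\<phi> (stair K) * (1 / 2) ^ m < 1" by (auto simp: eventually_at_top_linorder)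
  then have "\<phi> (stair (K + m)) < 1" using bound[of m] by simp
  moreover have "0 \<le> \<phi> (stair (K + m))" "\<phi> (stair (K + m)) \<in> \<int>"
    using nn int ypart_stair by (auto simp: nonneg_def)
  ultimately have zero: "\<phi> (stair (K + m)) = 0" by (auto elim!: Ints_cases)
  have "vanishes \<phi> (K + m) (K + m)"
    unfolding vanishes_def
  proof (intro allI impI)
    fix p assume p: "ypart p" "\<forall>i<K + m. K + m \<le> p i"
    have "stair (K + m) i \<le> p i" for i
    proof (cases "i < K + m")
      case True
      then have "K + m \<le> p i" using p(2) by blast
      then show ?thesis unfolding stair_def by linarith
    qed (simp add: stair_def)
    then show "\<phi> p = 0" by (rule pieri_zero_mono[OF \<phi> nn, of "stair (K + m)" p, OF ypart_stair p(1) _ zero])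
  qed
  then show ?thesis ..
qed

subsection \<open>Removing a pole\<close>

text \<open>Log-concavity of the coefficients: every shape in the product of the columns of lengths
  \<open>n\<close> and \<open>n + 2\<close> also occurs in the square of the column of length
  \<open>n + 1\<close>.\<close>

lemma two_column_inequality:
  assumes \<phi>: "pieri \<phi> c" and nn: "nonneg \<phi>"
  shows "fps_nth c n * fps_nth c (Suc (Suc n)) \<le> fps_nth c (Suc n) ^ 2"
proof -
  let ?col = "\<lambda>m. addv (\<lambda>_. 0) {..<m}"
  have size: "ysize (?col m) = m" for m using ysize_addv[OF ypart_zero, of "{..<m}"] by simp
  have "vstrips n (?col (Suc (Suc n))) \<subseteq> vstrips (Suc n) (?col (Suc n))"
  proof
    fix q assume q: "q \<in> vstrips n (?col (Suc (Suc n)))"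
    then have yq: "ypart q" and v: "\<And>i. ?col (Suc (Suc n)) i \<le> q i \<and> q i \<le> Suc (?col (Suc (Suc n)) i)"
      and s: "ysize q = 2 * n + 2" by (auto simp: vstrips_def vstrip_def size)
    \<comment> \<open>Two cells in each of the first \<open>n + 2\<close> rows would be
      \<open>2 * n + 4\<close> cells, but there are only \<open>2 * n + 2\<close>.\<close>
    have "q (Suc n) \<le> 1"
    proof (rule ccontr)
      assume "\<not> q (Suc n) \<le> 1"
      then have "2 \<le> q i" if "i \<le> Suc n" for i using ypart_mono[OF yq that] by simp
      then have "{..Suc n} \<times> {..<2} \<subseteq> cells q" by (auto simp: cells_def intro: less_le_trans)
      from card_mono[OF finite_cells[OF yq] this] show False using s by (simp add: ysize_def)
    qed
    then have "?col (Suc n) i \<le> q i \<and> q i \<le> Suc (?col (Suc n) i)" for i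
      using v[of i] by (cases "i = Suc n") (auto simp: addv_def split: if_splits)
    then show "q \<in> vstrips (Suc n) (?col (Suc n))" using yq s by (simp add: vstrips_def vstrip_def size)
  qed
  then have "(\<Sum>q\<in>vstrips n (?col (Suc (Suc n))). \<phi> q) \<le> (\<Sum>q\<in>vstrips (Suc n) (?col (Suc n)). \<phi> q)"
    using nn by (intro sum_mono2 finite_vstrips ypart_column) (auto simp: nonneg_def vstrips_def)
  moreover have "(\<Sum>q\<in>vstrips n (?col m). \<phi> q) = fps_nth c n * fps_nth c m" for n m
    using \<phi> ypart_column pieri_nth[OF \<phi>, of m] by (simp add: pieri_def)
  ultimately show ?thesis by (simp add: power2_eq_square)
qed

text \<open>If the first column is much longer than the rest, then a vertical strip splits into
  \<open>j\<close> cells at its end and a strip on the remaining columns. The bound on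
  \<open>N\<close> keeps the latter from reaching the end of the long column.\<close>

lemma bij_vstrips_long_column:
  assumes p: "ypart p" and L: "p L = 0" and N: "L + n \<le> N"
  shows "bij_betw (\<lambda>(j, q). addv q {..<N + j}) (SIGMA j:{..n}. vstrips (n - j) p) (vstrips n (addv p {..<N}))"
proof -
  have pN: "p i = 0" if "N \<le> i" for i using ypart_vanish[OF p L, of i] that N by simp
  have qN: "q i = 0" if "q \<in> vstrips (n - j) p" "N \<le> i" for q i j
  proof -
    have "q \<in> addv p ` {S. finite S \<and> card S = n - j \<and> ypart (addv p S)}"
      using that(1) by (simp only: vstrips_eq[OF p])
    then obtain S where S: "finite S" "card S = n - j" "ypart (addv p S)" "q = addv p S" by (elim imageE) blast
    have "S \<subseteq> {..<L + card S}" by (rule vstrips_sets_subset[OF p L S(3,1)])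
    then have "i \<notin> S" using S(2) N that by auto
    then show ?thesis using S(4) pN[OF that(2)] by (simp add: addv_def)
  qed
  have yN: "ypart (addv p {..<N})" by (rule ypart_addv_initial[OF p]) (simp add: pN)
  have sN: "ysize (addv p {..<N}) = ysize p + N" using ysize_addv[OF p, of "{..<N}"] by simp
  have len: "{i. 0 < addv q {..<N + j} i} = {..<N + j}" if "q \<in> vstrips (n - j) p" for q j
  proof -
    have "0 < addv q {..<N + j} i \<longleftrightarrow> i < N + j" for i
      using qN[OF that, of i] by (cases "i < N + j") (auto simp: addv_def)
    then show ?thesis by blast
  qed
  let ?g = "\<lambda>r. (card {i. 0 < r i} - N, \<lambda>i. r i - 1)"
  show ?thesis
  proof (rule bij_betw_byWitness[where f' = ?g])
    show "\<forall>x\<in>(SIGMA j:{..n}. vstrips (n - j) p). ?g ((\<lambda>(j, q). addv q {..<N + j}) x) = x"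
    proof
      fix x assume "x \<in> (SIGMA j:{..n}. vstrips (n - j) p)"
      then obtain j q where x: "x = (j, q)" "q \<in> vstrips (n - j) p" by auto
      have "addv q {..<N + j} i - 1 = q i" for i
        using qN[OF x(2), of i] by (cases "i < N + j") (auto simp: addv_def)
      then show "?g ((\<lambda>(j, q). addv q {..<N + j}) x) = x" using len[OF x(2)] by (simp add: x(1))
    qed
    show "(\<lambda>(j, q). addv q {..<N + j}) ` (SIGMA j:{..n}. vstrips (n - j) p) \<subseteq> vstrips n (addv p {..<N})"
    proof
      fix r assume "r \<in> (\<lambda>(j, q). addv q {..<N + j}) ` (SIGMA j:{..n}. vstrips (n - j) p)"
      then obtain j q where r: "r = addv q {..<N + j}" and j: "j \<le> n" and q: "q \<in> vstrips (n - j) p" by auto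
      have yq: "ypart q" using q by (simp add: vstrips_def)
      have "ypart r" unfolding r by (rule ypart_addv_initial[OF yq]) (simp add: qN[OF q])
      moreover have "addv p {..<N} i \<le> r i \<and> r i \<le> Suc (addv p {..<N} i)" for i
      proof -
        have "p i \<le> q i \<and> q i \<le> Suc (p i)" using q by (simp add: vstrips_def vstrip_def)
        then show ?thesis using qN[OF q, of i] pN[of i] by (auto simp: r addv_def not_less)
      qed
      moreover have "ysize r = ysize (addv p {..<N}) + n"
        using ysize_addv[OF yq, of "{..<N + j}"] q j sN by (simp add: r vstrips_def)
      ultimately show "r \<in> vstrips n (addv p {..<N})" by (simp add: vstrips_def vstrip_def)
    qed
    have shorten: "\<exists>j q. j \<le> n \<and> q \<in> vstrips (n - j) p \<and> ?g r = (j, q) \<and> addv q {..<N + j} = r"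
      if r: "r \<in> vstrips n (addv p {..<N})" for r
    proof -
      have yr: "ypart r" and v: "\<And>i. addv p {..<N} i \<le> r i \<and> r i \<le> Suc (addv p {..<N} i)"
        and s: "ysize r = ysize p + N + n" using r sN by (auto simp: vstrips_def vstrip_def)
      define q where "q = (\<lambda>i. r i - 1)"
      define l where "l = yconj r 0"
      have l: "i < l \<longleftrightarrow> 0 < r i" for i unfolding l_def by (rule less_yconj_iff[OF yr])
      have card: "card {i. 0 < r i} = l" by (simp add: l_def yconj_def)
      have "N \<le> l"
      proof (rule ccontr)
        assume "\<not> N \<le> l"
        then have "r l \<ge> 1" using v[of l] by (simp add: addv_def)
        then show False using l[of l] by simp
      qed
      then obtain j where j: "l = N + j" by (auto simp: le_iff_add)
      have rq: "r = addv q {..<l}"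
      proof (rule ext)
        fix i show "r i = addv q {..<l} i" using l[of i] by (cases "i < l") (auto simp: q_def addv_def)
      qed
      have yq: "ypart q"
      proof -
        obtain M where "r M = 0" using yr by (auto simp: ypart_def)
        then show ?thesis using ypart_mono_Suc[OF yr] by (intro ypartI[of q M]) (auto simp: q_def diff_le_mono)
      qed
      have vq: "p i \<le> q i \<and> q i \<le> Suc (p i)" for i
        using v[of i] pN[of i] by (cases "i < N") (auto simp: q_def addv_def)
      have "ysize r = ysize q + l" unfolding rq using ysize_addv[OF yq, of "{..<l}"] by simp
      moreover have "ysize p \<le> ysize q" using vq by (intro ysize_mono[OF yq]) auto
      ultimately have "j \<le> n" "ysize q = ysize p + (n - j)" using s j by auto
      moreover have "?g r = (j, q)" using card j by (simp add: q_def)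
      ultimately show ?thesis using yq vq rq j by (auto simp: vstrips_def vstrip_def)
    qed
    show "\<forall>r\<in>vstrips n (addv p {..<N}). (\<lambda>(j, q). addv q {..<N + j}) (?g r) = r"
    proof
      fix r assume "r \<in> vstrips n (addv p {..<N})"
      from shorten[OF this] obtain j q where "?g r = (j, q)" "addv q {..<N + j} = r" by blast
      then show "(\<lambda>(j, q). addv q {..<N + j}) (?g r) = r" by simp
    qed
    show "?g ` vstrips n (addv p {..<N}) \<subseteq> (SIGMA j:{..n}. vstrips (n - j) p)"
    proof
      fix x assume "x \<in> ?g ` vstrips n (addv p {..<N})"
      then obtain r where r: "r \<in> vstrips n (addv p {..<N})" "x = ?g r" by blast
      from shorten[OF r(1)] obtain j q where "j \<le> n" "q \<in> vstrips (n - j) p" "x = (j, q)"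
        unfolding r(2) by blast
      then show "x \<in> (SIGMA j:{..n}. vstrips (n - j) p)" by simp
    qed
  qed
qed

text \<open>
  With \<open>c\<^sub>N\<close> the \<open>N\<close>-th coefficient of \<open>c\<close>, the functional \<open>\<psi> p\<close> is the limit of \<open>\<phi> q / c\<^sub>N\<close>, where
  \<open>q\<close> arises from \<open>p\<close> by putting a column of length \<open>N\<close> in front, and \<open>\<beta>\<close> is the limit of the
  decreasing sequence \<open>c\<^bsub>N + 1\<^esub> / c\<^sub>N\<close>.
\<close>

lemma pieri_strip:
  assumes \<phi>: "pieri \<phi> c" and nn: "nonneg \<phi>" and pos: "\<And>n. 0 < fps_nth c n" and van: "vanishes \<phi> k (Suc n)"
  shows "\<exists>\<beta> \<psi>. 0 \<le> \<beta> \<and> pieri \<psi> ((1 - fps_const \<beta> * fps_X) * c) \<and> nonneg \<psi> \<and> vanishes \<psi> k n"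
proof -
  define a where "a = fps_nth c"
  have a: "0 < a m" for m using pos by (simp add: a_def)
  have dec: "decseq (\<lambda>m. a (Suc m) / a m)"
  proof (rule decseq_SucI)
    fix m show "a (Suc (Suc m)) / a (Suc m) \<le> a (Suc m) / a m"
      using two_column_inequality[OF \<phi> nn, of m] a[of m] a[of "Suc m"]
      by (simp add: a_def divide_simps power2_eq_square mult.commute)
  qed
  have "0 \<le> a (Suc m) / a m" for m using a[of m] a[of "Suc m"] by simp
  then obtain \<beta> where \<beta>: "(\<lambda>m. a (Suc m) / a m) \<longlonglongrightarrow> \<beta>"
    using decseq_convergent[OF dec, of 0] by blast
  have \<beta>0: "0 \<le> \<beta>" using a by (intro LIMSEQ_le_const[OF \<beta>]) (auto intro!: less_imp_le)
  have ratio: "(\<lambda>m. a (m + j) / a m) \<longlonglongrightarrow> \<beta> ^ j" for j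
  proof (induction j)
    case (Suc j)
    have "(\<lambda>m. a (Suc (m + j)) / a (m + j)) \<longlonglongrightarrow> \<beta>" using LIMSEQ_ignore_initial_segment[OF \<beta>, of j] by simp
    from tendsto_mult[OF this Suc] have "(\<lambda>m. a (Suc (m + j)) / a (m + j) * (a (m + j) / a m)) \<longlonglongrightarrow> \<beta> ^ Suc j" by simp
    moreover have "(\<lambda>m. a (Suc (m + j)) / a (m + j) * (a (m + j) / a m)) = (\<lambda>m. a (m + Suc j) / a m)"
    proof (rule ext)
      fix m show "a (Suc (m + j)) / a (m + j) * (a (m + j) / a m) = a (m + Suc j) / a m"
        using a[of "m + j"] by simp
    qed
    ultimately show ?case by (simp only:)
  next
    case 0
    have "a (m + 0) / a m = 1" for m using a[of m] by simp
    then show ?case by simp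
  qed
  define \<Psi> where "\<Psi> = (\<lambda>N p. \<phi> (addv p {..<N}) / a N)"
  \<comment> \<open>The Pieri rule for \<open>p\<close> behind a long column, grouped by the growth
    \<open>j\<close> of that column and normalized by \<open>a N\<close>.\<close>
  have rec: "a n * \<Psi> N p = (\<Sum>j\<le>n. \<Sum>q\<in>vstrips (n - j) p. \<Psi> (N + j) q * (a (N + j) / a N))"
    if p: "ypart p" "p L = 0" "L + n \<le> N" for n N L p
  proof -
    have "p N = 0" using ypart_vanish[OF p(1,2), of N] p(3) by simp
    then have "ypart (addv p {..<N})" by (rule ypart_addv_initial[OF p(1)])
    then have "a n * \<phi> (addv p {..<N}) = (\<Sum>q\<in>vstrips n (addv p {..<N}). \<phi> q)"
      using \<phi> by (simp add: pieri_def a_def)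
    also have "\<dots> = (\<Sum>x\<in>(SIGMA j:{..n}. vstrips (n - j) p). \<phi> ((\<lambda>(j, q). addv q {..<N + j}) x))"
      by (rule sum.reindex_bij_betw[OF bij_vstrips_long_column[OF p], symmetric])
    also have "\<dots> = (\<Sum>j\<le>n. \<Sum>q\<in>vstrips (n - j) p. \<phi> (addv q {..<N + j}))"
      by (subst sum.Sigma) (auto simp: finite_vstrips[OF p(1)] case_prod_beta)
    finally have "a n * \<Psi> N p = (\<Sum>j\<le>n. \<Sum>q\<in>vstrips (n - j) p. \<phi> (addv q {..<N + j})) / a N"
      by (simp add: \<Psi>_def)
    also have "\<dots> = (\<Sum>j\<le>n. \<Sum>q\<in>vstrips (n - j) p. \<Psi> (N + j) q * (a (N + j) / a N))"
      unfolding sum_divide_distrib \<Psi>_def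
    proof (intro sum.cong refl)
      fix j q
      show "\<phi> (addv q {..<N + j}) / a N = \<phi> (addv q {..<N + j}) / a (N + j) * (a (N + j) / a N)"
        using a[of "N + j"] by simp
    qed
    finally show ?thesis .
  qed
  \<comment> \<open>Only the ratios are known to converge. Solving \<open>rec\<close> for its
    shortest term with \<open>j = 0\<close> expresses it by terms that converge by induction: those
    with \<open>j = 0\<close> are longer at the same size, those with \<open>j > 0\<close> are
    smaller.\<close>
  have conv: "convergent (\<lambda>N. \<Psi> N p)" if "ypart p" for p
    using that
  proof (induction rule: ypart_induct)
    case zero
    have "\<Psi> N (\<lambda>_. 0) = 1" for N using a[of N] pieri_nth[OF \<phi>, of N] by (simp add: \<Psi>_def a_def)
    then show ?case by (simp add: convergent_const)
  next
    case (add n p)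
    have p: "ypart p" "p n = 0" by fact+
    let ?B = "vstrips n p - {addv p {..<n}}"
    let ?R = "\<lambda>N. a n * \<Psi> N p - (\<Sum>q\<in>?B. \<Psi> N q) -
      (\<Sum>j\<in>{1..n}. \<Sum>q\<in>vstrips (n - j) p. \<Psi> (N + j) q * (a (N + j) / a N))"
    have "\<Psi> N (addv p {..<n}) = ?R N" if "N \<ge> n + n" for N
    proof -
      have "a n * \<Psi> N p = (\<Sum>j\<le>n. \<Sum>q\<in>vstrips (n - j) p. \<Psi> (N + j) q * (a (N + j) / a N))"
        by (rule rec[OF p that])
      also have "{..n} = insert 0 {1..n}" by auto
      also have "(\<Sum>j\<in>insert 0 {1..n}. \<Sum>q\<in>vstrips (n - j) p. \<Psi> (N + j) q * (a (N + j) / a N)) =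
          (\<Sum>q\<in>vstrips n p. \<Psi> N q) + (\<Sum>j\<in>{1..n}. \<Sum>q\<in>vstrips (n - j) p. \<Psi> (N + j) q * (a (N + j) / a N))"
        using a[of N] by (subst sum.insert) auto
      also have "(\<Sum>q\<in>vstrips n p. \<Psi> N q) = \<Psi> N (addv p {..<n}) + (\<Sum>q\<in>?B. \<Psi> N q)"
        by (rule sum.remove[OF finite_vstrips[OF p(1)] addv_initial_in_vstrips[OF p]])
      finally show ?thesis by simp
    qed
    then have ev: "eventually (\<lambda>N. ?R N = \<Psi> N (addv p {..<n})) sequentially"
      by (auto simp: eventually_at_top_linorder intro!: exI[of _ "n + n"])
    have "convergent (\<lambda>N. \<Psi> N p)" using add by simp
    moreover have "convergent (\<lambda>N. \<Sum>q\<in>?B. \<Psi> N q)" using add by (intro convergent_sum) auto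
    moreover have "convergent (\<lambda>N. \<Sum>j\<in>{1..n}. \<Sum>q\<in>vstrips (n - j) p. \<Psi> (N + j) q * (a (N + j) / a N))"
    proof (intro convergent_sum convergent_mult)
      fix j q assume j: "j \<in> {1..n}" and q: "q \<in> vstrips (n - j) p"
      then have "convergent (\<lambda>N. \<Psi> N q)" using add.IH(1)[of q] by (auto simp: vstrips_def)
      then show "convergent (\<lambda>N. \<Psi> (N + j) q)"
        using LIMSEQ_ignore_initial_segment unfolding convergent_def by blast
      show "convergent (\<lambda>N. a (N + j) / a N)" using ratio convergentI by blast
    qed
    ultimately have "convergent ?R"
      by (intro convergent_diff convergent_mult convergent_const)
    then show ?case by (simp only: convergent_cong[OF ev])
  qed
  define \<psi> where "\<psi> = (\<lambda>p. lim (\<lambda>N. \<Psi> N p))"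
  have lim: "(\<lambda>N. \<Psi> N p) \<longlonglongrightarrow> \<psi> p" if "ypart p" for p
    unfolding \<psi>_def using conv[OF that] by (simp add: convergent_LIMSEQ_iff)
  have ev0: "eventually (\<lambda>N. 0 \<le> \<Psi> N p \<and> (\<forall>i<k. N > i)) sequentially" if p: "ypart p" for p
  proof -
    obtain L where L: "p L = 0" using p by (auto simp: ypart_def)
    have "0 \<le> \<Psi> N p \<and> (\<forall>i<k. N > i)" if "N \<ge> L + k" for N
    proof -
      have "ypart (addv p {..<N})" using ypart_vanish[OF p L, of N] that by (intro ypart_addv_initial[OF p]) simp
      then show ?thesis using nn a[of N] that by (auto simp: \<Psi>_def nonneg_def intro!: divide_nonneg_pos)
    qed
    then show ?thesis unfolding eventually_at_top_linorder by blast
  qed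
  have "nonneg \<psi>"
    unfolding nonneg_def
  proof (intro allI impI)
    fix p assume p: "ypart p"
    show "0 \<le> \<psi> p" by (rule tendsto_lowerbound[OF lim[OF p]]) (use ev0[OF p] in \<open>auto elim: eventually_mono\<close>)
  qed
  moreover have "vanishes \<psi> k n"
    unfolding vanishes_def
  proof (intro allI impI)
    fix p assume p: "ypart p" and le: "\<forall>i<k. n \<le> p i"
    obtain L where L: "p L = 0" using p by (auto simp: ypart_def)
    have "\<Psi> N p = 0" if "N \<ge> L + k" for N
    proof -
      have "ypart (addv p {..<N})" using ypart_vanish[OF p L, of N] that by (intro ypart_addv_initial[OF p]) simp
      moreover have "\<forall>i<k. Suc n \<le> addv p {..<N} i" using le that by (auto simp: addv_def)
      ultimately show ?thesis using van by (simp add: \<Psi>_def vanishes_def)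
    qed
    then have "eventually (\<lambda>N. \<Psi> N p = 0) sequentially" unfolding eventually_at_top_linorder by blast
    then have "(\<lambda>N. \<Psi> N p) \<longlonglongrightarrow> 0" by (simp add: tendsto_eventually)
    then show "\<psi> p = 0" using lim[OF p] LIMSEQ_unique by blast
  qed
  moreover have "pieri \<psi> ((1 - fps_const \<beta> * fps_X) * c)"
    unfolding pieri_def
  proof (intro conjI allI impI)
    have "\<Psi> N (\<lambda>_. 0) = 1" for N using a[of N] pieri_nth[OF \<phi>, of N] by (simp add: \<Psi>_def a_def)
    then show "\<psi> (\<lambda>_. 0) = 1" by (simp add: \<psi>_def)
    fix p :: "nat \<Rightarrow> nat" and n assume p: "ypart p"
    obtain L where L: "p L = 0" using p by (auto simp: ypart_def)
    define A where "A = (\<lambda>m. \<Sum>q\<in>vstrips m p. \<psi> q)"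
    \<comment> \<open>In the limit \<open>c * \<psi> p\<close> is the series of the
      \<open>A n\<close> times the geometric series in \<open>\<beta>\<close>. Multiplying by
      \<open>1 - \<beta> X\<close> gives the Pieri rule for the new series.\<close>
    have conv: "a n * \<psi> p = (\<Sum>j\<le>n. \<beta> ^ j * A (n - j))" for n
    proof -
      have "(\<lambda>N. \<Sum>j\<le>n. \<Sum>q\<in>vstrips (n - j) p. \<Psi> (N + j) q * (a (N + j) / a N)) \<longlonglongrightarrow>
          (\<Sum>j\<le>n. \<Sum>q\<in>vstrips (n - j) p. \<psi> q * \<beta> ^ j)"
        by (intro tendsto_sum tendsto_mult ratio LIMSEQ_ignore_initial_segment lim) (auto simp: vstrips_def)
      moreover have "eventually (\<lambda>N. a n * \<Psi> N p =
          (\<Sum>j\<le>n. \<Sum>q\<in>vstrips (n - j) p. \<Psi> (N + j) q * (a (N + j) / a N))) sequentially"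
        unfolding eventually_at_top_linorder using rec[OF p L] by blast
      ultimately have "(\<lambda>N. a n * \<Psi> N p) \<longlonglongrightarrow> (\<Sum>j\<le>n. \<Sum>q\<in>vstrips (n - j) p. \<psi> q * \<beta> ^ j)"
        by (simp only: tendsto_cong)
      moreover have "(\<lambda>N. a n * \<Psi> N p) \<longlonglongrightarrow> a n * \<psi> p" by (intro tendsto_mult_left lim p)
      ultimately have "a n * \<psi> p = (\<Sum>j\<le>n. \<Sum>q\<in>vstrips (n - j) p. \<psi> q * \<beta> ^ j)" using LIMSEQ_unique by blast
      then show ?thesis by (simp add: A_def sum_distrib_left mult.commute)
    qed
    have "A n = a n * \<psi> p - (if n = 0 then 0 else \<beta> * (a (n - 1) * \<psi> p))"
    proof (cases n)
      case (Suc m)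
      have "a (Suc m) * \<psi> p = A (Suc m) + (\<Sum>j\<le>m. \<beta> ^ Suc j * A (m - j))"
        unfolding conv by (subst sum.atMost_Suc_shift) simp
      also have "(\<Sum>j\<le>m. \<beta> ^ Suc j * A (m - j)) = \<beta> * (a m * \<psi> p)"
        unfolding conv by (simp add: sum_distrib_left mult.assoc)
      finally show ?thesis using Suc by simp
    qed (simp add: conv)
    then show "fps_nth ((1 - fps_const \<beta> * fps_X) * c) n * \<psi> p = (\<Sum>q\<in>vstrips n p. \<psi> q)"
      by (simp add: A_def a_def left_diff_distrib mult.assoc)
  qed
  ultimately show ?thesis using \<beta>0 by blast
qed

subsection \<open>Functionals vanishing on a rectangle\<close>

definition poly_at :: "'a :: comm_ring_1 list \<Rightarrow> 'a fps" where
  "poly_at xs = (\<Prod>x\<leftarrow>xs. 1 + fps_const x * fps_X)"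

lemma poly_at_simps [simp]:
  "poly_at [] = 1"
  "poly_at (x # xs) = (1 + fps_const x * fps_X) * poly_at xs"
  by (simp_all add: poly_at_def)

lemma vanishes_mono: "vanishes \<phi> k n \<Longrightarrow> n \<le> m \<Longrightarrow> vanishes \<phi> k m"
  unfolding vanishes_def by (meson le_trans)

text \<open>A step requires all coefficients to be positive, so the process halts only at a zero
  coefficient. It must halt, since a rectangle of width 0 would make the functional vanish at the
  empty partition, where it is 1.\<close>

lemma pieri_strip_all:
  assumes "pieri \<phi> c" "nonneg \<phi>" "vanishes \<phi> k n"
  shows "\<exists>bs \<psi>. (\<forall>b\<in>set bs. 0 \<le> b) \<and> pieri \<psi> (poly_at (map uminus bs) * c) \<and> nonneg \<psi> \<and>
    vanishes \<psi> k n \<and> (\<exists>N. fps_nth (poly_at (map uminus bs) * c) N = 0)"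
  using assms
proof (induction n arbitrary: \<phi> c)
  case 0
  then have "\<phi> (\<lambda>_. 0) = 0" by (simp add: vanishes_def)
  then show ?case using 0 by (simp add: pieri_def)
next
  case (Suc n)
  show ?case
  proof (cases "\<exists>N. fps_nth c N = 0")
    case True
    then show ?thesis using Suc.prems by (intro exI[of _ "[]"] exI[of _ \<phi>]) simp
  next
    case False
    then have "0 < fps_nth c N" for N using nonneg_nth[OF Suc.prems(1,2), of N] by (simp add: le_less)
    then obtain b \<psi> where b: "0 \<le> b" and \<psi>: "pieri \<psi> ((1 - fps_const b * fps_X) * c)" "nonneg \<psi>" "vanishes \<psi> k n"
      using pieri_strip[OF Suc.prems(1,2) _ Suc.prems(3)] by blast
    from Suc.IH[OF \<psi>] obtain bs \<chi> where bs: "\<forall>b\<in>set bs. 0 \<le> b"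
      and \<chi>: "pieri \<chi> (poly_at (map uminus bs) * ((1 - fps_const b * fps_X) * c))" "nonneg \<chi>" "vanishes \<chi> k n"
      and N: "\<exists>N. fps_nth (poly_at (map uminus bs) * ((1 - fps_const b * fps_X) * c)) N = 0" by blast
    have eq: "poly_at (map uminus bs) * ((1 - fps_const b * fps_X) * c) = poly_at (map uminus (b # bs)) * c"
    proof -
      have "(1 - fps_const b * fps_X) = (1 + fps_const (- b) * fps_X)"
        by (simp flip: fps_const_neg)
      then show ?thesis by (simp only: list.map poly_at_simps mult_ac)
    qed
    have "vanishes \<chi> k (Suc n)" by (rule vanishes_mono[OF \<chi>(3)]) simp
    then show ?thesis using bs b \<chi> N unfolding eq by (intro exI[of _ "b # bs"] exI[of _ \<chi>]) auto
  qed
qed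

lemma fps_alt_mult: "fps_alt (f * g) = fps_alt f * fps_alt g"
proof (rule fps_ext)
  fix n
  have "(- 1 :: 'a) ^ n = (- 1) ^ i * (- 1) ^ (n - i)" if "i \<le> n" for i
    using that by (simp flip: power_add)
  then show "fps_nth (fps_alt (f * g)) n = fps_nth (fps_alt f * fps_alt g) n"
    unfolding fps_alt_def fps_mult_nth fps_nth_Abs_fps sum_distrib_left
    by (intro sum.cong refl) (simp add: mult_ac)
qed

lemma fps_alt_alt: "fps_alt (fps_alt f) = f"
  by (rule fps_ext) (simp add: fps_alt_def flip: mult.assoc power_mult_distrib)

lemma fps_alt_1: "fps_alt 1 = 1"
  by (rule fps_ext) (simp add: fps_alt_def)

lemma fps_alt_poly_at: "fps_alt (poly_at xs) = poly_at (map uminus xs)"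
proof (induction xs)
  case (Cons x xs)
  have "fps_alt (1 + fps_const x * fps_X) = 1 + fps_const (- x) * fps_X"
    by (rule fps_ext) (auto simp: fps_alt_def le_Suc_eq)
  then show ?case using Cons by (simp only: poly_at_simps fps_alt_mult list.map)
qed (simp add: fps_alt_1)

text \<open>A zero coefficient bounds the number of rows and the hypothesis bounds the number of
  columns, so \<phi> is nonzero at only finitely many partitions. At one of largest size the rule
  for \<open>n = 1\<close> gives \<open>c\<^sub>1 = 0\<close>; then \<phi> vanishes at a single cell
  and hence at every nonempty column.\<close>

lemma vanishing_trivial:
  assumes \<phi>: "pieri \<phi> c" and nn: "nonneg \<phi>" and van: "vanishes \<phi> 1 N" and M: "fps_nth c M = 0"
  shows "c = 1"
proof -
  have colM: "\<phi> (addv (\<lambda>_. 0) {..<M}) = 0" using M pieri_nth[OF \<phi>, of M] by simp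
  have small: "p 0 < N \<and> (\<forall>i\<ge>M. p i = 0)" if p: "ypart p" and ne: "\<phi> p \<noteq> 0" for p
  proof -
    have "p 0 < N" using van p ne by (force simp: vanishes_def not_less)
    moreover have "p i = 0" if "M \<le> i" for i
    proof (rule ccontr)
      assume "p i \<noteq> 0"
      then have "1 \<le> p j" if "j < M" for j using ypart_mono[OF p, of j i] that \<open>M \<le> i\<close> by simp
      then have "addv (\<lambda>_. 0) {..<M} j \<le> p j" for j by (simp add: addv_def)
      then have "\<phi> p = 0" by (rule pieri_zero_mono[OF \<phi> nn, of "addv (\<lambda>_. 0) {..<M}" p, OF ypart_column p _ colM])
      then show False using ne by simp
    qed
    ultimately show ?thesis by blast
  qed
  define P where "P = {p. ypart p \<and> \<phi> p \<noteq> 0}"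
  have "P \<subseteq> {p. cells p \<subseteq> {..<M} \<times> {..<N}}"
  proof
    fix p assume "p \<in> P"
    then have p: "ypart p" "p 0 < N" "\<And>i. i \<ge> M \<Longrightarrow> p i = 0" using small by (auto simp: P_def)
    have "i < M \<and> j < N" if "j < p i" for i j
      using that p(3)[of i] p(2) ypart_mono[OF p(1), of 0 i] by (cases "i < M") auto
    then show "p \<in> {p. cells p \<subseteq> {..<M} \<times> {..<N}}" by (auto simp: cells_def)
  qed
  then have finP: "finite P" by (rule finite_subset) (rule finite_cells_subset, simp)
  have "(\<lambda>_. 0) \<in> P" using \<phi> by (simp add: P_def pieri_def)
  then obtain p where p: "p \<in> P" "\<And>q. q \<in> P \<Longrightarrow> ysize q \<le> ysize p"
    using Max_in[of "ysize ` P"] Max_ge[of "ysize ` P"] finP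
    by (metis (no_types, lifting) empty_iff finite_imageI image_eqI image_iff)
  have "q \<notin> P" if "q \<in> vstrips 1 p" for q using p(2)[of q] that by (auto simp: vstrips_def)
  then have "(\<Sum>q\<in>vstrips 1 p. \<phi> q) = 0" by (intro sum.neutral) (auto simp: P_def vstrips_def)
  moreover have "fps_nth c 1 * \<phi> p = (\<Sum>q\<in>vstrips 1 p. \<phi> q)" using \<phi> p(1) by (simp add: pieri_def P_def)
  ultimately have "fps_nth c 1 = 0" using p(1) by (simp add: P_def)
  then have col1: "\<phi> (addv (\<lambda>_. 0) {..<1}) = 0" using pieri_nth[OF \<phi>, of 1] by simp
  have "fps_nth c n = 0" if "n > 0" for n
  proof -
    have "addv (\<lambda>_. 0) {..<1} i \<le> addv (\<lambda>_. 0) {..<n} i" for i using that by (simp add: addv_def)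
    then show ?thesis
      unfolding pieri_nth[OF \<phi>, of n] by (rule pieri_zero_mono[OF \<phi> nn, of "addv (\<lambda>_. 0) {..<1}" "addv (\<lambda>_. 0) {..<n}", OF ypart_column ypart_column _ col1])
  qed
  moreover have "fps_nth c 0 = 1"
    using pieri_nth[OF \<phi>, of 0] \<phi> by (simp add: pieri_def)
  ultimately show ?thesis by (intro fps_ext) (simp add: fps_one_nth)
qed

lemma poly_at_filter: "poly_at xs = poly_at (filter (\<lambda>x. x \<noteq> 0) xs)"
  by (induction xs) auto

theorem pieri_rational:
  assumes \<phi>: "pieri \<phi> c" and nn: "nonneg \<phi>" and van: "vanishes \<phi> k n"
  shows "\<exists>as bs. (\<forall>a\<in>set as. 0 < a) \<and> (\<forall>b\<in>set bs. 0 < b) \<and> c * poly_at (map uminus bs) = poly_at as"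
proof -
  obtain bs \<psi> N where bs: "\<forall>b\<in>set bs. 0 \<le> b" and \<psi>: "pieri \<psi> (poly_at (map uminus bs) * c)" "nonneg \<psi>"
    and N: "fps_nth (poly_at (map uminus bs) * c) N = 0"
    using pieri_strip_all[OF \<phi> nn van] by blast
  define d where "d = poly_at (map uminus bs) * c"
  note \<psi>' = \<psi>(1)[folded d_def] and N' = N[folded d_def]
  have colN: "\<psi> (addv (\<lambda>_. 0) {..<N}) = 0" using N' pieri_nth[OF \<psi>', of N] by simp
  have d0: "fps_nth d 0 = 1" using pieri_nth[OF \<psi>', of 0] \<psi>' by (simp add: pieri_def)
  define h where "h = inverse (fps_alt d)"
  have h: "h * fps_alt d = 1"
    unfolding h_def by (rule inverse_mult_eq_1) (simp add: fps_alt_def d0)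
  have \<chi>: "pieri (\<lambda>p. \<psi> (yconj p)) h" by (rule pieri_yconj[OF \<psi>' h])
  have nn\<chi>: "nonneg (\<lambda>p. \<psi> (yconj p))" using \<psi>(2) ypart_yconj by (simp add: nonneg_def)
  \<comment> \<open>A zero at a column becomes a zero at a row, that is, at a rectangle of height 1.
    The second round of removals preserves this height, as \<open>vanishing_trivial\<close>
    demands.\<close>
  have "vanishes (\<lambda>p. \<psi> (yconj p)) 1 N"
    unfolding vanishes_def
  proof (intro allI impI)
    fix p assume p: "ypart p" and "\<forall>i<1. N \<le> p i"
    then have "0 < yconj p i" if "i < N" for i using less_yconj_iff[OF p, of 0 i] that by simp
    then have "addv (\<lambda>_. 0) {..<N} i \<le> yconj p i" for i by (simp add: addv_def Suc_leI)
    then show "\<psi> (yconj p) = 0"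
      by (rule pieri_zero_mono[OF \<psi>' \<psi>(2), of "addv (\<lambda>_. 0) {..<N}" "yconj p", OF ypart_column ypart_yconj[OF p] _ colN])
  qed
  from pieri_strip_all[OF \<chi> nn\<chi> this] obtain as \<omega> M where as: "\<forall>a\<in>set as. 0 \<le> a"
    and \<omega>: "pieri \<omega> (poly_at (map uminus as) * h)" "nonneg \<omega>" "vanishes \<omega> 1 N"
    and M: "fps_nth (poly_at (map uminus as) * h) M = 0" by blast
  have one: "poly_at (map uminus as) * h = 1" by (rule vanishing_trivial[OF \<omega> M])
  have "fps_alt d = poly_at (map uminus as) * h * fps_alt d" by (simp add: one)
  also have "\<dots> = poly_at (map uminus as)" using h by (simp add: mult.assoc)
  finally have "fps_alt (fps_alt d) = fps_alt (poly_at (map uminus as))" by simp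
  then have "d = poly_at as" by (simp add: fps_alt_alt fps_alt_poly_at comp_def)
  \<comment> \<open>A limit of ratios may be 0; such a parameter contributes a trivial factor and is
    dropped to obtain strict positivity.\<close>
  let ?f = "filter (\<lambda>x :: real. x \<noteq> 0)"
  have fm: "?f (map uminus bs) = map uminus (?f bs)" by (induction bs) auto
  have "c * poly_at (map uminus (?f bs)) = poly_at (?f as)"
    using \<open>d = poly_at as\<close> unfolding d_def poly_at_filter[of as] poly_at_filter[of "map uminus bs"] fm
    by (simp add: mult.commute)
  then show ?thesis using as bs by (intro exI[of _ "?f as"] exI[of _ "?f bs"]) (auto simp: le_less)
qed

section \<open>Rational power series\<close>

subsection \<open>Change of coefficients\<close>

definition ring_map :: "('a :: comm_ring_1 \<Rightarrow> 'b :: comm_ring_1) \<Rightarrow> bool" where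
  "ring_map r \<longleftrightarrow> r 0 = 0 \<and> r 1 = 1 \<and> (\<forall>x y. r (x + y) = r x + r y) \<and> (\<forall>x y. r (x * y) = r x * r y)"

definition fps_map :: "('a \<Rightarrow> 'b) \<Rightarrow> 'a fps \<Rightarrow> 'b fps" where
  "fps_map r f = Abs_fps (\<lambda>n. r (fps_nth f n))"

lemma fps_map_nth [simp]: "fps_nth (fps_map r f) n = r (fps_nth f n)"
  by (simp add: fps_map_def)

lemma ring_map_simps:
  assumes "ring_map r"
  shows "r 0 = 0" "r 1 = 1" "r (x + y) = r x + r y" "r (x * y) = r x * r y"
  using assms by (auto simp: ring_map_def)

lemma ring_map_of_int: "ring_map of_int"
  by (simp add: ring_map_def)

lemma ring_map_of_real: "ring_map complex_of_real"
  by (simp add: ring_map_def)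

lemma ring_map_sum: "ring_map r \<Longrightarrow> r (\<Sum>i\<in>A. f i) = (\<Sum>i\<in>A. r (f i))"
  by (induction A rule: infinite_finite_induct) (auto simp: ring_map_simps)

lemma fps_map_mult: "ring_map r \<Longrightarrow> fps_map r (f * g) = fps_map r f * fps_map r g"
  by (rule fps_ext) (simp add: fps_mult_nth ring_map_sum ring_map_simps)

lemma fps_map_1: "ring_map r \<Longrightarrow> fps_map r 1 = 1"
  by (rule fps_ext) (simp add: ring_map_simps)

lemma fps_map_of_poly: "r 0 = 0 \<Longrightarrow> fps_map r (fps_of_poly p) = fps_of_poly (map_poly r p)"
  by (rule fps_ext) (simp add: coeff_map_poly)

lemma fps_map_poly_at:
  assumes "ring_map r"
  shows "fps_map r (poly_at xs) = poly_at (map r xs)"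
proof (induction xs)
  case (Cons x xs)
  have "fps_map r (1 + fps_const x * fps_X) = 1 + fps_const (r x) * fps_X"
    by (rule fps_ext) (auto simp: ring_map_simps[OF assms])
  then show ?case using Cons by (simp add: fps_map_mult[OF assms])
qed (simp add: fps_map_1[OF assms])

lemma fps_map_eq_iff: "inj r \<Longrightarrow> fps_map r f = fps_map r g \<longleftrightarrow> f = g"
  by (auto simp: fps_eq_iff inj_eq)

lemma fps_map_compose: "fps_map r (fps_map s f) = fps_map (\<lambda>x. r (s x)) f"
  by (rule fps_ext) simp

lemma map_poly_mult:
  assumes "ring_map r"
  shows "map_poly r (p * q) = map_poly r p * map_poly r q"
  by (rule poly_eqI) (simp add: coeff_map_poly coeff_mult ring_map_sum[OF assms] ring_map_simps[OF assms])

lemma map_poly_plus: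
  assumes "ring_map r"
  shows "map_poly r (p + q) = map_poly r p + map_poly r q"
  by (rule poly_eqI) (simp add: coeff_map_poly ring_map_simps[OF assms])

lemma map_poly_of_int_eq_iff:
  "map_poly (of_int :: int \<Rightarrow> 'a :: {comm_ring_1, ring_char_0}) p = map_poly of_int q \<longleftrightarrow> p = q"
  by (auto simp: poly_eq_iff coeff_map_poly)

lemma pieri_ring_map:
  assumes "ring_map r" "pieri \<phi> c"
  shows "pieri (\<lambda>p. r (\<phi> p)) (fps_map r c)"
  using assms(2) unfolding pieri_def
  by (auto simp: ring_map_simps[OF assms(1)] simp flip: ring_map_sum[OF assms(1)] ring_map_simps(4)[OF assms(1)])

lemma fps_of_poly_prod: "fps_of_poly (\<Prod>x\<leftarrow>xs. [:1, x:]) = poly_at xs"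
proof (induction xs)
  case (Cons x xs)
  have "fps_of_poly [:1, x:] = 1 + fps_const x * fps_X"
    by (rule fps_ext) (auto simp: coeff_pCons split: nat.split)
  then show ?case using Cons by (simp only: list.map prod_list.Cons fps_of_poly_mult poly_at_simps)
qed simp

lemma poly_prod_root:
  fixes z :: "'a :: field"
  shows "poly (\<Prod>x\<leftarrow>xs. [:1, x:]) z = 0 \<Longrightarrow> \<exists>x\<in>set xs. 1 + x * z = 0"
proof (induction xs)
  case (Cons x xs)
  then have "poly [:1, x:] z = 0 \<or> poly (\<Prod>x\<leftarrow>xs. [:1, x:]) z = 0"
    by (simp only: list.map prod_list.Cons poly_mult mult_eq_0_iff)
  then show ?case using Cons.IH by (auto simp: mult.commute)
qed simp

subsection \<open>Rational integral power series\<close>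

text \<open>
  Applying a \<open>\<rat>\<close>-linear projection \<open>\<real> \<rightarrow> \<rat>\<close> to a linear recurrence with
  real coefficients gives one with rational coefficients.
\<close>

lemma real_to_rational:
  fixes F :: "int fps"
  assumes "fps_map real_of_int F * fps_of_poly H = fps_of_poly G" "coeff H 0 = 1"
  shows "\<exists>H' G'. coeff H' 0 = 1 \<and> fps_map rat_of_int F * fps_of_poly H' = fps_of_poly G'"
proof -
  interpret vector_space_pair "\<lambda>(q :: rat) (x :: real). of_rat q * x" "(*) :: rat \<Rightarrow> rat \<Rightarrow> rat"
    by unfold_locales (auto simp: algebra_simps of_rat_add of_rat_mult)
  \<comment> \<open>Prescribing the value 1 at 1 keeps the constant term of the denominator equal to
    1.\<close>
  have "vs1.independent {1}" by simp
  then obtain l where l: "Vector_Spaces.linear (\<lambda>(q :: rat) (x :: real). of_rat q * x) ((*) :: rat \<Rightarrow> rat \<Rightarrow> rat) l" and l1: "l 1 = (1 :: rat)"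
    using linear_independent_extend[of "{1}" "\<lambda>_. 1"] by auto
  interpret l: Vector_Spaces.linear "\<lambda>(q :: rat) (x :: real). of_rat q * x" "(*) :: rat \<Rightarrow> rat \<Rightarrow> rat" l
    by (rule l)
  have add: "l (x + y) = l x + l y" and scale: "l (of_rat q * x) = q * l x" for x y q
    by (rule l.add, rule l.scale)
  have l0: "l 0 = 0" using scale[of 0 0] by simp
  have lsum: "l (\<Sum>i\<in>A. f i) = (\<Sum>i\<in>A. l (f i))" for f :: "nat \<Rightarrow> real" and A
    by (induction A rule: infinite_finite_induct) (auto simp: l0 add)
  have "fps_map rat_of_int F * fps_of_poly (map_poly l H) = fps_of_poly (map_poly l G)"
  proof (rule fps_ext)
    fix n
    have "fps_nth (fps_map rat_of_int F * fps_of_poly (map_poly l H)) n =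
        (\<Sum>i=0..n. of_int (fps_nth F i) * l (coeff H (n - i)))"
      by (simp add: fps_mult_nth coeff_map_poly l0)
    also have "\<dots> = (\<Sum>i=0..n. l (real_of_int (fps_nth F i) * coeff H (n - i)))"
      using scale[of "of_int _"] by simp
    also have "\<dots> = l (fps_nth (fps_map real_of_int F * fps_of_poly H) n)"
      by (simp add: fps_mult_nth lsum)
    finally show "fps_nth (fps_map rat_of_int F * fps_of_poly (map_poly l H)) n =
        fps_nth (fps_of_poly (map_poly l G)) n"
      by (simp add: assms(1) coeff_map_poly l0)
  qed
  moreover have "coeff (map_poly l H) 0 = 1" by (simp add: coeff_map_poly l0 l1 assms(2))
  ultimately show ?thesis by blast
qed

lemma clear_denominators:
  fixes p :: "rat poly"
  shows "\<exists>d q. d \<noteq> (0 :: int) \<and> smult (of_int d) p = map_poly of_int q"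
proof (induction p)
  case 0
  then show ?case by (intro exI[of _ 1] exI[of _ 0]) simp
next
  case (pCons a p)
  then obtain d q where d: "d \<noteq> 0" "smult (of_int d) p = map_poly rat_of_int q" by blast
  obtain n m where a: "a = of_int n / of_int m" "m \<noteq> 0"
    by (cases a) (auto simp: Fract_of_int_quotient)
  have "smult (of_int (m * d)) (pCons a p) = pCons (of_int (n * d)) (smult (of_int m) (map_poly of_int q))"
    using a(2) by (simp add: a(1) flip: d(2))
  also have "\<dots> = map_poly of_int (pCons (n * d) (smult m q))"
    by (rule poly_eqI) (simp add: coeff_map_poly coeff_pCons split: nat.split)
  finally show ?case using a d by (intro exI[of _ "m * d"]) auto
qed

text \<open>Power series modulo a prime form a domain: the product of the two lowest coefficients
  not divisible by \<open>p\<close> survives in degree \<open>i + j\<close>.\<close>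

lemma prime_dvd_fps_mult:
  fixes p :: int and F G :: "int fps"
  assumes p: "prime p" and FG: "\<And>n. p dvd fps_nth (F * G) n"
  shows "(\<forall>n. p dvd fps_nth F n) \<or> (\<forall>n. p dvd fps_nth G n)"
proof (rule ccontr)
  assume "\<not> ?thesis"
  then have ex: "\<exists>n. \<not> p dvd fps_nth F n" "\<exists>n. \<not> p dvd fps_nth G n" by auto
  define i j where "i = (LEAST n. \<not> p dvd fps_nth F n)" and "j = (LEAST n. \<not> p dvd fps_nth G n)"
  have i: "\<not> p dvd fps_nth F i" and j: "\<not> p dvd fps_nth G j"
    unfolding i_def j_def by (rule LeastI_ex[OF ex(1)], rule LeastI_ex[OF ex(2)])
  have i': "p dvd fps_nth F k" if "k < i" for k using not_less_Least that unfolding i_def by blast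
  have j': "p dvd fps_nth G k" if "k < j" for k using not_less_Least that unfolding j_def by blast
  have "fps_nth (F * G) (i + j) = fps_nth F i * fps_nth G j + (\<Sum>k\<in>{0..i+j} - {i}. fps_nth F k * fps_nth G (i + j - k))"
    unfolding fps_mult_nth by (subst sum.remove[of _ i]) auto
  moreover have "p dvd (\<Sum>k\<in>{0..i+j} - {i}. fps_nth F k * fps_nth G (i + j - k))"
  proof (rule dvd_sum)
    fix k assume k: "k \<in> {0..i+j} - {i}"
    show "p dvd fps_nth F k * fps_nth G (i + j - k)"
      using i'[of k] j'[of "i + j - k"] k by (cases "k < i") auto
  qed
  ultimately have "p dvd fps_nth F i * fps_nth G j"
    using FG[of "i + j"] by (simp add: dvd_add_left_iff)
  then show False using p i j by (simp add: prime_dvd_mult_iff)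
qed

text \<open>Otherwise a prime factor of \<open>m\<close> could be cancelled from \<open>w\<close>, by Gauss's lemma for power series.\<close>

lemma primitive_unit:
  fixes h :: "int poly"
  assumes h: "content h = 1"
  shows "m \<noteq> 0 \<Longrightarrow> fps_of_poly h * w = fps_const m \<Longrightarrow> is_unit (coeff h 0)"
proof (induction "nat \<bar>m\<bar>" arbitrary: m w rule: less_induct)
  case less
  show ?case
  proof (cases "is_unit m")
    case True
    have "coeff h 0 * fps_nth w 0 = m"
      using arg_cong[OF less.prems(2), of "\<lambda>f. fps_nth f 0"] by simp
    then show ?thesis using True by (metis dvd_mult_left)
  next
    case False
    then obtain p where p: "p dvd m" "prime p" using less.prems(1) prime_divisor_exists by blast
    have "p dvd fps_nth (fps_of_poly h * w) n" for n using p by (simp add: less.prems(2))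
    then have "(\<forall>n. p dvd coeff h n) \<or> (\<forall>n. p dvd fps_nth w n)"
      using prime_dvd_fps_mult[OF p(2)] by fastforce
    moreover have "\<not> (\<forall>n. p dvd coeff h n)"
    proof
      assume "\<forall>n. p dvd coeff h n"
      then have "[:p:] dvd h" by (simp add: const_poly_dvd_iff)
      then have "p dvd content h" by (simp add: const_poly_dvd_iff_dvd_content)
      then show False using p(2) h by (simp add: not_prime_unit)
    qed
    ultimately have w: "p dvd fps_nth w n" for n by blast
    define w' where "w' = Abs_fps (\<lambda>n. fps_nth w n div p)"
    have pw: "w = fps_const p * w'" by (rule fps_ext) (simp add: w'_def w)
    obtain m' where m': "m = p * m'" using p(1) by blast
    have p0: "p \<noteq> 0" "1 < \<bar>p\<bar>" using p(2) prime_gt_1_int[of p] by auto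
    have "fps_const p * (fps_of_poly h * w') = fps_const p * fps_const m'"
      using less.prems(2) by (simp add: pw m' mult_ac)
    then have "fps_of_poly h * w' = fps_const m'"
      using p0(1) mult_left_cancel[of "fps_const p"] by (metis fps_const_eq_0_iff)
    moreover have "m' \<noteq> 0" using less.prems(1) m' by simp
    moreover have "nat \<bar>m'\<bar> < nat \<bar>m\<bar>"
    proof -
      have "\<bar>m'\<bar> * 1 < \<bar>m'\<bar> * \<bar>p\<bar>" using \<open>m' \<noteq> 0\<close> p0(2) by (intro mult_strict_left_mono) auto
      then show ?thesis by (simp add: m' abs_mult mult.commute)
    qed
    ultimately show ?thesis using less.hyps by blast
  qed
qed

text \<open>In lowest terms, with a primitive denominator \<open>h\<close>, clearing denominators in
  a Bezout relation gives \<open>u g + v h = m\<close> with a nonzero integer \<open>m\<close>.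
  Hence \<open>h (F u + v) = m\<close>, and \<open>primitive_unit\<close> makes the constant term of
  \<open>h\<close> a unit. The relation is part of the conclusion because it later excludes common
  roots of \<open>g\<close> and \<open>h\<close>.\<close>

lemma fatou:
  fixes F :: "int fps"
  assumes eq: "fps_map rat_of_int F * fps_of_poly H = fps_of_poly G" and H: "H \<noteq> 0"
  shows "\<exists>g h u v m. coeff h 0 = 1 \<and> F * fps_of_poly h = fps_of_poly g \<and> m \<noteq> 0 \<and> u * g + v * h = [:m:]"
proof -
  let ?F = "fps_map rat_of_int F"
  define d where "d = gcd G H"
  have d0: "d \<noteq> 0" using H by (simp add: d_def)
  obtain G' H' where G': "G = d * G'" and H': "H = d * H'"
    unfolding d_def by (meson dvdE gcd_dvd1 gcd_dvd2)
  have "fps_of_poly d * (?F * fps_of_poly H') = fps_of_poly d * fps_of_poly G'"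
    using eq unfolding G' H' by (simp add: fps_of_poly_mult mult_ac)
  then have FH: "?F * fps_of_poly H' = fps_of_poly G'" using d0 by simp
  obtain x y where "x * G + y * H = d" unfolding d_def using bezout_coefficients_fst_snd by metis
  then have "d * (x * G' + y * H') = d * 1" unfolding G' H' by (simp add: algebra_simps)
  then have bez: "x * G' + y * H' = 1" using d0 mult_left_cancel[of d] by blast
  obtain k q where k: "k \<noteq> 0" "smult (of_int k) H' = map_poly rat_of_int q" using clear_denominators by blast
  have "H' \<noteq> 0" using H H' by auto
  then have q0: "q \<noteq> 0" using k by auto
  define h where "h = primitive_part q"
  have ch: "content h = 1" using q0 by (simp add: h_def)
  define r where "r = rat_of_int k / of_int (content q)"
  have r0: "r \<noteq> 0" using k q0 by (simp add: r_def)
  have msm: "map_poly rat_of_int (smult c p) = smult (of_int c) (map_poly of_int p)" for c p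
    by (rule poly_eqI) (simp add: coeff_map_poly)
  have mh: "map_poly of_int h = smult r H'"
  proof -
    have "map_poly rat_of_int q = smult (of_int (content q)) (map_poly of_int h)"
      using msm[of "content q" h] by (simp add: h_def)
    then have "smult (of_int k) H' = smult (of_int (content q)) (map_poly of_int h)" using k by simp
    then have "smult (1 / of_int (content q)) (smult (of_int k) H') = map_poly of_int h" using q0 by simp
    then show ?thesis by (simp add: r_def)
  qed
  define P where "P = F * fps_of_poly h"
  have mP: "fps_map rat_of_int P = fps_of_poly (smult r G')"
    unfolding P_def fps_map_mult[OF ring_map_of_int] fps_map_of_poly[of of_int, OF of_int_0] mh
    by (simp add: fps_of_poly_smult FH[symmetric] mult_ac)
  have P0: "fps_nth P n = 0" if "degree G' < n" for n
    using arg_cong[OF mP, of "\<lambda>f. fps_nth f n"] that by (simp add: coeff_eq_0)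
  \<comment> \<open>\<open>P\<close> has integral coefficients by construction and is a polynomial
    by comparison with \<open>G'\<close> over the rationals.\<close>
  define g where "g = (\<Sum>n\<le>degree G'. monom (fps_nth P n) n)"
  have cg: "coeff g n = fps_nth P n" for n
    using P0[of n] by (cases "n \<le> degree G'") (auto simp: g_def coeff_sum)
  have Fh: "F * fps_of_poly h = fps_of_poly g" by (rule fps_ext) (simp add: cg flip: P_def)
  have mg: "map_poly of_int g = smult r G'"
  proof (rule poly_eqI)
    fix n show "coeff (map_poly of_int g) n = coeff (smult r G') n"
      using arg_cong[OF mP, of "\<lambda>f. fps_nth f n"] by (simp add: coeff_map_poly cg)
  qed
  obtain kx u where u: "kx \<noteq> 0" "smult (of_int kx) x = map_poly rat_of_int u" using clear_denominators by blast
  obtain ky v where v: "ky \<noteq> 0" "smult (of_int ky) y = map_poly rat_of_int v" using clear_denominators by blast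
  define W where "W = smult ky u * g + smult kx v * h"
  have "map_poly rat_of_int W = smult (of_int kx * of_int ky * r) (x * G' + y * H')"
    unfolding W_def map_poly_plus[OF ring_map_of_int] map_poly_mult[OF ring_map_of_int] msm mg mh u(2)[symmetric] v(2)[symmetric]
    by (simp add: smult_add_right mult_ac)
  then have mW: "map_poly rat_of_int W = [:of_int kx * of_int ky * r:]" by (simp add: bez)
  define m where "m = coeff W 0"
  have "of_int m = of_int kx * of_int ky * r"
    using arg_cong[OF mW, of "\<lambda>p. coeff p 0"] by (simp add: coeff_map_poly m_def)
  then have m0: "m \<noteq> 0" using u v r0 by auto
  have W: "W = [:m:]"
  proof (rule poly_eqI)
    fix n show "coeff W n = coeff [:m:] n"
      using arg_cong[OF mW, of "\<lambda>p. coeff p n"] by (cases n) (auto simp: coeff_map_poly m_def)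
  qed
  have "fps_of_poly h * (F * fps_of_poly (smult ky u) + fps_of_poly (smult kx v)) = fps_of_poly W"
    unfolding W_def by (simp only: fps_of_poly_add fps_of_poly_mult Fh[symmetric] algebra_simps)
  also have "\<dots> = fps_const m" by (simp add: W)
  finally have "is_unit (coeff h 0)" by (rule primitive_unit[OF ch m0])
  then consider "coeff h 0 = 1" | "coeff h 0 = -1" by (auto simp: zdvd1_eq abs_if split: if_splits)
  then show ?thesis
  proof cases
    case 1
    then show ?thesis using Fh m0 W unfolding W_def by blast
  next
    case 2
    have "coeff (- h) 0 = 1" using 2 by simp
    moreover have "F * fps_of_poly (- h) = fps_of_poly (- g)" by (simp add: Fh fps_of_poly_uminus)
    moreover have "(- smult ky u) * (- g) + (- smult kx v) * (- h) = [:m:]" using W unfolding W_def by simp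
    ultimately show ?thesis using m0 by blast
  qed
qed

text \<open>Cross-multiplication gives \<open>GC h = HC g\<close> over the complex numbers. Since
  \<open>g\<close> and \<open>h\<close> have no common root, the roots of \<open>g\<close> are among
  those of \<open>GC\<close> and the roots of \<open>h\<close> among those of \<open>HC\<close>, so
  the signs carry over.\<close>

lemma integral_quotient:
  fixes f :: "int fps"
  assumes eq: "fps_map real_of_int f * poly_at (map uminus bs) = poly_at as"
    and as: "\<forall>a\<in>set as. 0 < a" and bs: "\<forall>b\<in>set bs. 0 < b"
  shows "\<exists>g h. neg_pos_quotient f g h"
proof -
  define G H where "G = (\<Prod>x\<leftarrow>as. [:1, x:])" and "H = (\<Prod>x\<leftarrow>map uminus bs. [:1, x:])"
  have GH: "fps_map real_of_int f * fps_of_poly H = fps_of_poly G"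
    unfolding G_def H_def fps_of_poly_prod by (rule eq)
  have c0: "fps_nth (poly_at xs) 0 = 1" for xs :: "real list" by (induction xs) auto
  have "coeff H 0 = 1" using c0[of "map uminus bs"] unfolding H_def fps_of_poly_prod[symmetric] by simp
  from real_to_rational[OF GH this] obtain H' G' where H': "coeff H' 0 = 1" "fps_map rat_of_int f * fps_of_poly H' = fps_of_poly G'"
    by blast
  then have "H' \<noteq> 0" by auto
  from fatou[OF H'(2) this] obtain g h u v m where h0: "coeff h 0 = 1" and fh: "f * fps_of_poly h = fps_of_poly g"
    and m: "m \<noteq> 0" and bez: "u * g + v * h = [:m:]" by blast
  let ?c = "map_poly (of_int :: int \<Rightarrow> complex)"
  have f0: "fps_nth f 0 = 1"
    using arg_cong[OF eq, of "\<lambda>f. fps_nth f 0"] by (simp add: c0)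
  have g0: "coeff g 0 = 1" using arg_cong[OF fh, of "\<lambda>f. fps_nth f 0"] f0 h0 by simp
  have "?c (u * g + v * h) = [:of_int m:]" unfolding bez by (rule poly_eqI) (simp add: coeff_map_poly coeff_pCons split: nat.split)
  then have "?c u * ?c g + ?c v * ?c h = [:of_int m:]"
    by (simp only: map_poly_plus[OF ring_map_of_int] map_poly_mult[OF ring_map_of_int])
  then have "poly (?c u * ?c g + ?c v * ?c h) z = of_int m" for z by simp
  then have nocommon: "poly (?c g) z \<noteq> 0 \<or> poly (?c h) z \<noteq> 0" for z
    using m by (metis add_0 mult_zero_right of_int_eq_0_iff poly_add poly_mult)
  define GC HC where "GC = (\<Prod>x\<leftarrow>map complex_of_real as. [:1, x:])"
    and "HC = (\<Prod>x\<leftarrow>map complex_of_real (map uminus bs). [:1, x:])"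
  have ceq: "fps_map of_int f * fps_of_poly HC = fps_of_poly GC"
    using arg_cong[OF eq, of "fps_map complex_of_real"]
    unfolding GC_def HC_def fps_of_poly_prod fps_map_mult[OF ring_map_of_real] fps_map_poly_at[OF ring_map_of_real] fps_map_compose
    by simp
  have cfh: "fps_map of_int f * fps_of_poly (?c h) = fps_of_poly (?c g)"
    using arg_cong[OF fh, of "fps_map (of_int :: int \<Rightarrow> complex)"]
    by (simp add: fps_map_mult[OF ring_map_of_int] fps_map_of_poly)
  have "fps_of_poly (GC * ?c h) = fps_of_poly (HC * ?c g)"
    unfolding fps_of_poly_mult cfh[symmetric] ceq[symmetric] by (simp add: mult_ac)
  then have "GC * ?c h = HC * ?c g" by simp
  then have ev: "poly GC z * poly (?c h) z = poly HC z * poly (?c g) z" for z by (metis poly_mult)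
  have "z \<in> \<real> \<and> Re z < 0" if z: "poly (?c g) z = 0" for z
  proof -
    have "poly GC z = 0" using ev[of z] nocommon[of z] z by simp
    then obtain a where a: "a \<in> set as" "1 + complex_of_real a * z = 0"
      using poly_prod_root[of "map complex_of_real as" z] unfolding GC_def by auto
    then have "a > 0" using as by blast
    have "complex_of_real a * z = -1" using a(2) by (simp add: add_eq_0_iff)
    then have "z = complex_of_real (- 1 / a)" using \<open>a > 0\<close> by (simp add: field_simps)
    then show ?thesis using \<open>a > 0\<close> by simp
  qed
  moreover have "z \<in> \<real> \<and> Re z > 0" if z: "poly (?c h) z = 0" for z
  proof -
    have "poly HC z = 0" using ev[of z] nocommon[of z] z by simp
    then obtain b where b: "b \<in> set bs" "1 + complex_of_real (- b) * z = 0"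
      using poly_prod_root[of "map complex_of_real (map uminus bs)" z] unfolding HC_def by auto
    then have "b > 0" using bs by blast
    have "complex_of_real b * z = 1" using b(2) by simp
    then have "z = complex_of_real (1 / b)" using \<open>b > 0\<close> by (simp add: field_simps)
    then show ?thesis using \<open>b > 0\<close> by simp
  qed
  ultimately show ?thesis using h0 g0 fh unfolding neg_pos_quotient_def by blast
qed

subsection \<open>Uniqueness of the quotient\<close>

lemma coprime_no_common_root:
  fixes p q :: "complex poly"
  assumes "\<And>z. poly p z = 0 \<Longrightarrow> poly q z \<noteq> 0" "p \<noteq> 0"
  shows "coprime p q"
proof (rule coprimeI)
  fix d assume d: "d dvd p" "d dvd q"
  show "is_unit d"
  proof (cases "degree d = 0")
    case True
    then obtain c where "d = [:c:]" by (metis degree_eq_zeroE)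
    moreover have "c \<noteq> 0" using d(1) assms(2) calculation by auto
    ultimately show ?thesis by (simp add: is_unit_const_poly_iff dvd_field_iff)
  next
    case False
    then obtain z where "poly d z = 0"
      using fundamental_theorem_of_algebra[of d] constant_degree[of d] by auto
    then show ?thesis using d assms(1)[of z] by (metis dvdE mult_zero_left poly_mult)
  qed
qed

lemma eq_if_dvd_each_other:
  fixes p q :: "complex poly"
  assumes "p dvd q" "q dvd p" "coeff p 0 = 1" "coeff q 0 = 1"
  shows "p = q"
proof -
  obtain k where k: "q = p * k" using assms(1) by blast
  have nz: "p \<noteq> 0" "q \<noteq> 0" using assms by auto
  then have "degree q = degree p + degree k" using k by (auto simp: degree_mult_eq)
  moreover have "degree q \<le> degree p" using assms(2) nz by (simp add: dvd_imp_degree_le)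
  ultimately have "degree k = 0" by simp
  then obtain c where c: "k = [:c:]" by (metis degree_eq_zeroE)
  then have "c = 1" using assms(3,4) k by simp
  then show ?thesis using k c by simp
qed

text \<open>The signs of the roots make numerator and denominator coprime over the complex numbers,
  so both fractions are in lowest terms; the constant terms fix the remaining scalar.\<close>

lemma neg_pos_quotient_unique:
  assumes "neg_pos_quotient f g h" "neg_pos_quotient f g' h'"
  shows "g = g' \<and> h = h'"
proof -
  let ?c = "map_poly (of_int :: int \<Rightarrow> complex)"
  have q: "coeff g 0 = 1" "coeff g' 0 = 1" "f * fps_of_poly h = fps_of_poly g" "f * fps_of_poly h' = fps_of_poly g'"
    and neg: "poly (?c g) z = 0 \<Longrightarrow> Re z < 0" "poly (?c g') z = 0 \<Longrightarrow> Re z < 0"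
    and pos: "poly (?c h) z = 0 \<Longrightarrow> Re z > 0" "poly (?c h') z = 0 \<Longrightarrow> Re z > 0" for z
    using assms unfolding neg_pos_quotient_def by blast+
  have c1: "coeff (?c g) 0 = 1" "coeff (?c g') 0 = 1" using q by (simp_all add: coeff_map_poly)
  have nz: "?c g \<noteq> 0" "?c g' \<noteq> 0" using c1 by (metis coeff_0 zero_neq_one)+
  have "fps_of_poly (g * h') = fps_of_poly (g' * h)"
    unfolding fps_of_poly_mult q(3,4)[symmetric] by (simp add: mult_ac)
  then have "g * h' = g' * h" by simp
  then have eq: "?c g * ?c h' = ?c g' * ?c h" by (metis map_poly_mult[OF ring_map_of_int])
  have "coprime (?c g) (?c h)" using neg(1) pos(1) nz by (intro coprime_no_common_root) force+
  moreover have "?c g dvd ?c g' * ?c h" using eq by (metis dvd_triv_left)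
  ultimately have "?c g dvd ?c g'" by (simp only: coprime_dvd_mult_left_iff)
  moreover have "coprime (?c g') (?c h')" using neg(2) pos(2) nz by (intro coprime_no_common_root) force+
  then have "?c g' dvd ?c g" using eq by (metis coprime_dvd_mult_left_iff dvd_triv_left)
  ultimately have "?c g = ?c g'" using c1 by (intro eq_if_dvd_each_other)
  then have g: "g = g'" by (simp add: map_poly_of_int_eq_iff)
  have "g \<noteq> 0" using q(1) by auto
  then have "f \<noteq> 0" using q(3) by auto
  moreover have "f * fps_of_poly h = f * fps_of_poly h'" using q g by simp
  ultimately show ?thesis using g by simp
qed

section \<open>Schur--Witt vectors\<close>

subsection \<open>The image of \<open>\<sigma>\<close>\<close>

lemma pieri_int_quotient:
  assumes \<phi>: "pieri \<phi> f" and nn: "\<And>p. ypart p \<Longrightarrow> (0 :: int) \<le> \<phi> p"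
  shows "\<exists>g h. neg_pos_quotient f g h"
proof -
  have p: "pieri (\<lambda>p. real_of_int (\<phi> p)) (fps_map of_int f)" by (rule pieri_ring_map[OF ring_map_of_int \<phi>])
  have n: "nonneg (\<lambda>p. real_of_int (\<phi> p))" using nn by (simp add: nonneg_def)
  obtain k where "vanishes (\<lambda>p. real_of_int (\<phi> p)) k k" using integral_vanishes[OF p n] by auto
  from pieri_rational[OF p n this] show ?thesis using integral_quotient by blast
qed

text \<open>The constant term 1 excludes the root 0 and allows factors \<open>1 + x t\<close> with
  \<open>x = - 1 / r\<close> for a root \<open>r\<close>. The roots are recorded so that the signs
  of the \<open>x\<close> can be read off.\<close>

lemma complex_poly_factor:
  fixes P :: "complex poly"
  assumes "coeff P 0 = 1" "\<And>z. poly P z = 0 \<Longrightarrow> z \<in> \<real>"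
  shows "\<exists>xs. fps_of_poly P = poly_at (map complex_of_real xs) \<and> (\<forall>x\<in>set xs. x \<noteq> 0 \<and> poly P (complex_of_real (- 1 / x)) = 0)"
  using assms
proof (induction "degree P" arbitrary: P rule: less_induct)
  case less
  show ?case
  proof (cases "degree P = 0")
    case True
    then obtain c where "P = [:c:]" by (metis degree_eq_zeroE)
    then have "P = 1" using less.prems(1) by simp
    then show ?thesis by (intro exI[of _ "[]"]) simp
  next
    case False
    then obtain z where z: "poly P z = 0"
      using fundamental_theorem_of_algebra[of P] constant_degree[of P] by auto
    obtain r where r: "z = complex_of_real r" using less.prems(2)[OF z] by (auto elim: Reals_cases)
    have "r \<noteq> 0" using z less.prems(1) by (auto simp: r poly_0_coeff_0)
    define x where "x = - 1 / r"
    have x0: "x \<noteq> 0" and rx: "- 1 / x = r" using \<open>r \<noteq> 0\<close> by (simp_all add: x_def)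
    obtain Q where Q: "P = [:- z, 1:] * Q" using z poly_eq_0_iff_dvd by blast
    define R where "R = smult (- z) Q"
    have lin: "[:- z, 1:] = smult (- z) [:1, complex_of_real x:]"
      using \<open>r \<noteq> 0\<close> by (simp add: r x_def flip: of_real_mult)
    have P: "P = [:1, complex_of_real x:] * R" unfolding Q lin R_def by (simp only: mult_smult_left mult_smult_right)
    have "Q \<noteq> 0" using Q less.prems(1) by auto
    then have deg: "degree P = Suc (degree Q)" unfolding Q by (subst degree_mult_eq) auto
    have "degree R = degree Q" using \<open>r \<noteq> 0\<close> by (simp add: R_def r)
    then have "degree R < degree P" using deg by simp
    moreover have "coeff R 0 = 1" using less.prems(1) by (simp add: P coeff_mult)
    moreover have "z \<in> \<real>" if "poly R z = 0" for z using less.prems(2)[of z] that by (simp add: P)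
    ultimately obtain xs where xs: "fps_of_poly R = poly_at (map complex_of_real xs)"
      "\<forall>x\<in>set xs. x \<noteq> 0 \<and> poly R (complex_of_real (- 1 / x)) = 0" using less.hyps[of R] by blast
    have "fps_of_poly [:1, complex_of_real x:] = 1 + fps_const (complex_of_real x) * fps_X"
      by (rule fps_ext) (auto simp: coeff_pCons split: nat.split)
    then have "fps_of_poly P = poly_at (map complex_of_real (x # xs))"
      unfolding P fps_of_poly_mult xs by simp
    moreover have "\<forall>y\<in>set (x # xs). y \<noteq> 0 \<and> poly P (complex_of_real (- 1 / y)) = 0"
    proof
      fix y assume "y \<in> set (x # xs)"
      then consider "y = x" | "y \<in> set xs" by auto
      then show "y \<noteq> 0 \<and> poly P (complex_of_real (- 1 / y)) = 0"
      proof cases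
        case 1
        then show ?thesis using x0 z unfolding 1 rx r by simp
      next
        case 2
        then have "poly R (complex_of_real (- 1 / y)) = 0" "y \<noteq> 0" using xs(2) by auto
        then show ?thesis unfolding P poly_mult by simp
      qed
    qed
    ultimately show ?thesis by blast
  qed
qed

lemma int_poly_factor:
  fixes g :: "int poly"
  assumes "coeff g 0 = 1" "\<And>z :: complex. poly (map_poly of_int g) z = 0 \<Longrightarrow> z \<in> \<real>"
  shows "\<exists>xs. fps_map real_of_int (fps_of_poly g) = poly_at xs \<and>
    (\<forall>x\<in>set xs. x \<noteq> 0 \<and> poly (map_poly of_int g) (complex_of_real (- 1 / x)) = 0)"
proof -
  have "coeff (map_poly (of_int :: int \<Rightarrow> complex) g) 0 = 1" using assms(1) by (simp add: coeff_map_poly)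
  from complex_poly_factor[OF this assms(2)] obtain xs
    where xs: "fps_of_poly (map_poly of_int g) = poly_at (map complex_of_real xs)"
      "\<forall>x\<in>set xs. x \<noteq> 0 \<and> poly (map_poly of_int g) (complex_of_real (- 1 / x)) = 0" by blast
  have "fps_map complex_of_real (fps_map real_of_int (fps_of_poly g)) = fps_map complex_of_real (poly_at xs)"
    unfolding fps_map_compose fps_map_poly_at[OF ring_map_of_real] xs(1)[symmetric]
    by (simp add: fps_map_of_poly)
  then have "fps_map real_of_int (fps_of_poly g) = poly_at xs"
    by (simp add: fps_map_eq_iff inj_def)
  then show ?thesis using xs(2) by blast
qed

lemma pieri_trivial: "pieri (\<lambda>p. of_bool (p = (\<lambda>_. 0))) (1 :: 'a :: comm_ring_1 fps)"
  unfolding pieri_def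
proof (intro conjI allI impI)
  fix p :: "nat \<Rightarrow> nat" and n assume p: "ypart p"
  show "fps_nth 1 n * of_bool (p = (\<lambda>_. 0)) = (\<Sum>q\<in>vstrips n p. of_bool (q = (\<lambda>_. 0)) :: 'a)"
  proof (cases "n = 0")
    case False
    then have "q \<noteq> (\<lambda>_. 0)" if "q \<in> vstrips n p" for q using that by (auto simp: vstrips_def)
    then show ?thesis using False by simp
  qed (simp add: vstrips_0[OF p])
qed simp

lemma pieri_poly_at:
  assumes "pieri \<phi> c" "nonneg \<phi>" "\<forall>x\<in>set xs. 0 \<le> x"
  shows "\<exists>\<psi>. pieri \<psi> (poly_at xs * c) \<and> nonneg \<psi>"
  using assms
proof (induction xs)
  case (Cons x xs)
  then obtain \<psi> where \<psi>: "pieri \<psi> (poly_at xs * c)" "nonneg \<psi>" by auto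
  have "pieri (hstep x \<psi>) (poly_at (x # xs) * c)"
    using pieri_hstep[OF \<psi>(1), of x] by (simp add: mult.assoc)
  moreover have "nonneg (hstep x \<psi>)"
    using \<psi>(2) Cons.prems by (auto simp: nonneg_def hstep_def intro!: sum_nonneg mult_nonneg_nonneg)
  ultimately show ?case by blast
qed auto

lemma pieri_integral:
  assumes \<phi>: "pieri \<phi> (fps_map real_of_int f)" and p: "ypart p"
  shows "\<phi> p \<in> \<int>"
  using p
proof (induction rule: ypart_induct)
  case zero
  then show ?case using \<phi> by (simp add: pieri_def)
next
  case (add n p)
  show ?case
    unfolding pieri_column_eq[OF \<phi> add(1,2)] using add by (intro Ints_diff Ints_mult Ints_sum) auto
qed

lemma quotient_pieri:
  assumes "neg_pos_quotient f g h"
  shows "\<exists>\<phi> :: (nat \<Rightarrow> nat) \<Rightarrow> nat. pieri (\<lambda>p. int (\<phi> p)) f"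
proof -
  have g: "coeff g 0 = 1" "\<And>z. poly (map_poly of_int g) z = 0 \<Longrightarrow> z \<in> \<real> \<and> Re z < 0"
    and h: "coeff h 0 = 1" "\<And>z. poly (map_poly of_int h) z = 0 \<Longrightarrow> z \<in> \<real> \<and> Re z > 0"
    and fh: "f * fps_of_poly h = fps_of_poly g"
    using assms unfolding neg_pos_quotient_def by blast+
  obtain as where as: "fps_map real_of_int (fps_of_poly g) = poly_at as"
    "\<forall>x\<in>set as. x \<noteq> 0 \<and> poly (map_poly of_int g) (complex_of_real (- 1 / x)) = 0"
    using int_poly_factor[of g] g by blast
  obtain ys where ys: "fps_map real_of_int (fps_of_poly h) = poly_at ys"
    "\<forall>x\<in>set ys. x \<noteq> 0 \<and> poly (map_poly of_int h) (complex_of_real (- 1 / x)) = 0"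
    using int_poly_factor[of h] h by blast
  have as0: "0 \<le> a" if "a \<in> set as" for a
  proof -
    have "Re (complex_of_real (- 1 / a)) < 0" using as(2) that g(2) by blast
    then show ?thesis by (simp add: less_imp_le)
  qed
  define bs where "bs = map uminus ys"
  have bs0: "0 \<le> b" if "b \<in> set bs" for b
  proof -
    have "Re (complex_of_real (- 1 / (- b))) > 0" using ys(2) that h(2) unfolding bs_def by fastforce
    then show ?thesis by (simp add: less_imp_le)
  qed
  have ysb: "ys = map uminus bs" by (simp add: bs_def comp_def)
  have nn0: "nonneg (\<lambda>p. of_bool (p = (\<lambda>_. 0)))" by (simp add: nonneg_def)
  obtain \<phi>1 where \<phi>1: "pieri \<phi>1 (poly_at bs)" "nonneg \<phi>1"
    using pieri_poly_at[OF pieri_trivial nn0, of bs] bs0 by auto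
  define k where "k = inverse (poly_at ys)"
  have c0: "fps_nth (poly_at xs) 0 = 1" for xs :: "real list" by (induction xs) auto
  have k: "k * poly_at ys = 1" unfolding k_def by (rule inverse_mult_eq_1) (simp add: c0)
  then have "k * fps_alt (poly_at bs) = 1" by (simp add: fps_alt_poly_at ysb)
  from pieri_yconj[OF \<phi>1(1) this] have \<phi>2: "pieri (\<lambda>p. \<phi>1 (yconj p)) k" .
  have nn2: "nonneg (\<lambda>p. \<phi>1 (yconj p))" using \<phi>1(2) ypart_yconj by (simp add: nonneg_def)
  obtain \<phi> where \<phi>: "pieri \<phi> (poly_at as * k)" "nonneg \<phi>"
    using pieri_poly_at[OF \<phi>2 nn2, of as] as0 by auto
  have "fps_map real_of_int f * poly_at ys = poly_at as"
    unfolding as(1)[symmetric] ys(1)[symmetric] fps_map_mult[OF ring_map_of_int, symmetric] fh ..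
  then have "poly_at as * k = fps_map real_of_int f" using k by (metis mult.assoc mult.commute mult_1)
  then have pf: "pieri \<phi> (fps_map real_of_int f)" using \<phi>(1) by simp
  \<comment> \<open>On partitions the values are nonnegative integers and rounding changes nothing;
    on other functions \<phi> is uncontrolled.\<close>
  define A where "A = (\<lambda>p. nat \<lfloor>\<phi> p\<rfloor>)"
  have A: "real_of_int (int (A p)) = \<phi> p" if "ypart p" for p
    using pieri_integral[OF pf that] \<phi>(2) that by (auto simp: A_def nonneg_def elim!: Ints_cases)
  have "pieri (\<lambda>p. int (A p)) f"
    unfolding pieri_def
  proof (intro conjI allI impI)
    have "real_of_int (int (A (\<lambda>_. 0))) = 1" using A[OF ypart_zero] pf by (simp add: pieri_def)
    then show "int (A (\<lambda>_. 0)) = 1" by linarith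
    fix p :: "nat \<Rightarrow> nat" and n assume p: "ypart p"
    have "real_of_int (fps_nth f n * int (A p)) = (\<Sum>q\<in>vstrips n p. \<phi> q)"
      using pf p A[OF p] by (simp add: pieri_def)
    also have "\<dots> = real_of_int (\<Sum>q\<in>vstrips n p. int (A q))"
      unfolding of_int_sum using A by (intro sum.cong) (auto simp: vstrips_def)
    finally show "fps_nth f n * int (A p) = (\<Sum>q\<in>vstrips n p. int (A q))" by linarith
  qed
  then show ?thesis by blast
qed

subsection \<open>Homomorphisms from multiplicative functionals\<close>

text \<open>Natural coefficients are encoded by repetitions in the list, so that the same list can
  be evaluated in \<open>xseries\<close> and in the natural numbers.\<close>

definition ysum :: "((nat \<Rightarrow> nat) \<Rightarrow> 'a :: comm_monoid_add) \<Rightarrow> (nat \<Rightarrow> nat) list \<Rightarrow> 'a" where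
  "ysum \<phi> ps = (\<Sum>p\<leftarrow>ps. \<phi> p)"

lemma ysum_simps [simp]:
  "ysum \<phi> [] = 0" "ysum \<phi> (p # ps) = \<phi> p + ysum \<phi> ps" "ysum \<phi> (ps @ qs) = ysum \<phi> ps + ysum \<phi> qs"
  by (simp_all add: ysum_def)

lemma ysum_count:
  fixes \<phi> :: "(nat \<Rightarrow> nat) \<Rightarrow> 'a :: comm_ring_1"
  shows "finite P \<Longrightarrow> set ps \<subseteq> P \<Longrightarrow> ysum \<phi> ps = (\<Sum>p\<in>P. of_int (int (count (mset ps) p)) * \<phi> p)"
proof (induction ps)
  case (Cons p ps)
  have "(\<Sum>q\<in>P. of_int (int (count (mset (p # ps)) q)) * \<phi> q) =
      (\<Sum>q\<in>P. (if q = p then \<phi> q else 0) + of_int (int (count (mset ps) q)) * \<phi> q)"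
    by (intro sum.cong) (auto simp: algebra_simps)
  then show ?case using Cons by (simp add: sum.distrib)
qed simp

lemma yschur_ysum_inject:
  assumes "\<forall>p\<in>set ps. ypart p" "\<forall>p\<in>set qs. ypart p" "ysum yschur ps = ysum yschur qs"
  shows "mset ps = mset qs"
proof (rule multiset_eqI)
  fix p
  let ?P = "set ps \<union> set qs"
  let ?z = "\<lambda>p. int (count (mset ps) p) - int (count (mset qs) p)"
  have "(\<Sum>p\<in>?P. of_int (?z p) * yschur p) = 0"
    using ysum_count[of ?P ps yschur] ysum_count[of ?P qs yschur] assms(3)
    by (simp add: left_diff_distrib sum_subtractf)
  then have "?z p = 0" if "p \<in> ?P"
    using yschur_independent[of ?P ?z p] that assms by blast
  moreover have "?z p = 0" if "p \<notin> ?P" using that by (simp add: count_eq_zero_iff[THEN iffD2])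
  ultimately show "count (mset ps) p = count (mset qs) p" by force
qed

lemma Lambda_Sch_ysum: "x \<in> Lambda_Sch \<longleftrightarrow> (\<exists>ps. (\<forall>p\<in>set ps. ypart p) \<and> x = ysum yschur ps)"
proof
  assume "x \<in> Lambda_Sch"
  then show "\<exists>ps. (\<forall>p\<in>set ps. ypart p) \<and> x = ysum yschur ps"
  proof (induction rule: Lambda_Sch_induct)
    case zero
    show ?case by (intro exI[of _ "[]"]) simp
  next
    case (add p y)
    then obtain ps where "\<forall>p\<in>set ps. ypart p" "y = ysum yschur ps" by blast
    then show ?case using add by (intro exI[of _ "p # ps"]) simp
  qed
next
  assume "\<exists>ps. (\<forall>p\<in>set ps. ypart p) \<and> x = ysum yschur ps"
  then obtain ps where "\<forall>p\<in>set ps. ypart p" "x = ysum yschur ps" by blast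
  then show "x \<in> Lambda_Sch"
    by (induction ps arbitrary: x) (auto simp: Lambda_Sch_0 intro: Lambda_Sch_add yschur_in_Lambda_Sch)
qed

text \<open>Expressions that one list evaluates for all functionals are closed under sums, which
  reduces the claim to two Schur functions.\<close>

lemma ysum_mult:
  assumes "\<forall>p\<in>set ps. ypart p" "\<forall>p\<in>set qs. ypart p"
  shows "\<exists>rs. (\<forall>r\<in>set rs. ypart r) \<and>
    (\<forall>(\<phi> :: (nat \<Rightarrow> nat) \<Rightarrow> xseries) c. pieri \<phi> c \<longrightarrow> ysum \<phi> ps * ysum \<phi> qs = ysum \<phi> rs)"
proof -
  define pos where "pos = (\<lambda>G :: ((nat \<Rightarrow> nat) \<Rightarrow> xseries) \<Rightarrow> xseries.
    \<exists>rs. (\<forall>r\<in>set rs. ypart r) \<and> (\<forall>\<phi> c. pieri \<phi> c \<longrightarrow> G \<phi> = ysum \<phi> rs))"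
  have zero: "pos (\<lambda>_. 0)" unfolding pos_def by (intro exI[of _ "[]"]) simp
  have add: "pos (\<lambda>\<phi>. G \<phi> + G' \<phi>)" if pos: "pos G" "pos G'" for G G'
  proof -
    obtain rs where rs: "\<forall>r\<in>set rs. ypart r" "\<forall>\<phi> c. pieri \<phi> c \<longrightarrow> G \<phi> = ysum \<phi> rs"
      using pos(1) unfolding pos_def by blast
    obtain ss where ss: "\<forall>r\<in>set ss. ypart r" "\<forall>\<phi> c. pieri \<phi> c \<longrightarrow> G' \<phi> = ysum \<phi> ss"
      using pos(2) unfolding pos_def by blast
    have "\<forall>\<phi> c. pieri \<phi> c \<longrightarrow> G \<phi> + G' \<phi> = ysum \<phi> (rs @ ss)" using rs(2) ss(2) by simp
    moreover have "\<forall>r\<in>set (rs @ ss). ypart r" using rs(1) ss(1) by auto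
    ultimately show ?thesis unfolding pos_def by blast
  qed
  have mult: "pos (\<lambda>\<phi>. \<phi> p * \<phi> q)" if "ypart p" "ypart q" for p q
    using littlewood_richardson_positive[OF that] unfolding pos_def ysum_def .
  have row: "pos (\<lambda>\<phi>. \<phi> p * ysum \<phi> qs)" if p: "ypart p" for p
    using assms(2) by (induction qs) (auto simp: zero distrib_left intro!: add mult p)
  have "pos (\<lambda>\<phi>. ysum \<phi> ps * ysum \<phi> qs)"
    using assms(1) by (induction ps) (auto simp: zero distrib_right intro!: add row)
  then show ?thesis unfolding pos_def .
qed

lemma of_int_xseries_inject: "(of_int a :: xseries) = of_int b \<Longrightarrow> a = b"
  using xcoeff_of_int_mult[of a 1 "{#}"] xcoeff_of_int_mult[of b 1 "{#}"] by (simp add: xcoeff_1)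

theorem pieri_extends:
  fixes A :: "(nat \<Rightarrow> nat) \<Rightarrow> nat"
  assumes A: "pieri (\<lambda>p. int (A p)) f"
  shows "\<exists>a\<in>W_Sch. sigma a = f"
proof -
  define a where "a = (\<lambda>x. if x \<in> Lambda_Sch then
    ysum A (SOME ps. (\<forall>p\<in>set ps. ypart p) \<and> x = ysum yschur ps) else undefined)"
  have a: "a (ysum yschur ps) = ysum A ps" if ps: "\<forall>p\<in>set ps. ypart p" for ps
  proof -
    \<comment> \<open>Linear independence makes the chosen list a rearrangement of any other one, so
      the value is well defined.\<close>
    define qs where "qs = (SOME qs. (\<forall>p\<in>set qs. ypart p) \<and> ysum yschur ps = ysum yschur qs)"
    have "(\<forall>p\<in>set qs. ypart p) \<and> ysum yschur ps = ysum yschur qs"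
      unfolding qs_def by (rule someI[of _ ps]) (use ps in simp)
    then have "mset qs = mset ps" using ps by (metis yschur_ysum_inject)
    then have "ysum A qs = ysum A ps" unfolding ysum_def by (metis mset_map sum_mset_sum_list)
    moreover have "ysum yschur ps \<in> Lambda_Sch" using ps Lambda_Sch_ysum by blast
    ultimately show ?thesis by (simp add: a_def qs_def)
  qed
  have aS: "a (yschur p) = A p" if "ypart p" for p using a[of "[p]"] that by simp
  \<comment> \<open>The values are regarded as constant series, so that the list which expands a
    product of Schur functions also evaluates the corresponding product of values.\<close>
  define \<phi> where "\<phi> = (\<lambda>p. of_int (int (A p)) :: xseries)"
  have \<phi>: "pieri \<phi> (fps_map of_int f)" unfolding \<phi>_def by (rule pieri_ring_map[OF ring_map_of_int A])
  have \<phi>A: "ysum \<phi> ps = of_int (int (ysum A ps))" for ps by (induction ps) (auto simp: \<phi>_def)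
  have "a \<in> W_Sch"
    unfolding W_Sch_def
  proof (intro CollectI conjI ballI)
    show "a \<in> extensional Lambda_Sch" by (simp add: a_def extensional_def)
    show "a 0 = 0" using a[of "[]"] by simp
    have "A (\<lambda>_. 0) = 1" using A by (simp add: pieri_def)
    then show "a 1 = 1" using aS[OF ypart_zero] pieri_yschur by (simp add: pieri_def)
    fix x y assume "x \<in> Lambda_Sch" "y \<in> Lambda_Sch"
    then obtain ps qs where x: "\<forall>p\<in>set ps. ypart p" "x = ysum yschur ps" and y: "\<forall>p\<in>set qs. ypart p" "y = ysum yschur qs"
      unfolding Lambda_Sch_ysum by blast
    show "a (x + y) = a x + a y"
      using a[of "ps @ qs"] a[OF x(1)] a[OF y(1)] x y by auto
    obtain rs where rs: "\<forall>r\<in>set rs. ypart r"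
      "\<And>(\<phi> :: (nat \<Rightarrow> nat) \<Rightarrow> xseries) c. pieri \<phi> c \<Longrightarrow> ysum \<phi> ps * ysum \<phi> qs = ysum \<phi> rs"
      using ysum_mult[OF x(1) y(1)] by blast
    have "of_int (int (ysum A ps) * int (ysum A qs)) = (of_int (int (ysum A rs)) :: xseries)"
      using rs(2)[OF \<phi>] by (simp add: \<phi>A)
    then have "int (ysum A ps) * int (ysum A qs) = int (ysum A rs)" by (rule of_int_xseries_inject)
    then have "ysum A ps * ysum A qs = ysum A rs" by (metis of_nat_eq_iff of_nat_mult)
    moreover have "x * y = ysum yschur rs" using rs(2)[OF pieri_yschur] x y by simp
    ultimately show "a (x * y) = a x * a y" using a[OF rs(1)] a[OF x(1)] a[OF y(1)] x y by simp
  qed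
  moreover have "sigma a = f"
  proof (rule fps_ext)
    fix n show "fps_nth (sigma a) n = fps_nth f n"
      using aS[OF ypart_column, of n] pieri_nth[OF A, of n] by (simp add: sigma_def elem_sym_yschur)
  qed
  ultimately show ?thesis by blast
qed

theorem theorem1p2:
  shows "bij_betw sigma (W_Sch :: (xseries \<Rightarrow> nat) set)
           {f :: int fps. fps_nth f 0 = 1 \<and> (\<exists>g h. neg_pos_quotient f g h)} \<and>
         (\<forall>f g h g' h'. neg_pos_quotient f g h \<and> neg_pos_quotient f g' h' \<longrightarrow> g = g' \<and> h = h')"
proof (intro conjI)
  show "bij_betw sigma (W_Sch :: (xseries \<Rightarrow> nat) set)
           {f :: int fps. fps_nth f 0 = 1 \<and> (\<exists>g h. neg_pos_quotient f g h)}"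
    unfolding bij_betw_def
  proof (intro conjI equalityI subsetI)
    show "inj_on sigma (W_Sch :: (xseries \<Rightarrow> nat) set)" by (rule inj_on_sigma)
  next
    fix f assume "f \<in> sigma ` (W_Sch :: (xseries \<Rightarrow> nat) set)"
    then obtain a :: "xseries \<Rightarrow> nat" where a: "a \<in> W_Sch" "f = sigma a" by blast
    have p: "pieri (\<lambda>p. int (a (yschur p))) f" unfolding a(2) by (rule pieri_W_Sch[OF a(1)])
    have "fps_nth f 0 = 1" using pieri_nth[OF p, of 0] p by (simp add: pieri_def)
    moreover have "\<exists>g h. neg_pos_quotient f g h" by (rule pieri_int_quotient[OF p]) simp
    ultimately show "f \<in> {f. fps_nth f 0 = 1 \<and> (\<exists>g h. neg_pos_quotient f g h)}" by blast
  next
    fix f assume "f \<in> {f :: int fps. fps_nth f 0 = 1 \<and> (\<exists>g h. neg_pos_quotient f g h)}"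
    then obtain g h where "neg_pos_quotient f g h" by blast
    then show "f \<in> sigma ` (W_Sch :: (xseries \<Rightarrow> nat) set)"
      using quotient_pieri pieri_extends by blast
  qed
  show "\<forall>f g h g' h'. neg_pos_quotient f g h \<and> neg_pos_quotient f g' h' \<longrightarrow> g = g' \<and> h = h'"
    using neg_pos_quotient_unique by blast
qed

end
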